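(* Let $j\ge1$, let $k_1,\dots,k_j$ be positive integers and let $n_1,\dots,n_j$ be non-negative integers (all fixed). Put $K=k_1+\cdots+k_j$, $N=k_1n_1+\cdots+k_jn_j$, and let $$(a_1,\ldots,a_K)=(\underbrace{n_1,\ldots,n_1}_{k_1\text{ times}},\underbrace{n_2,\ldots,n_2}_{k_2\text{ times}},\ldots,\underbrace{n_j,\ldots,n_j}_{k_j\text{ times}}).$$ Then, as $T\to\infty$, $$\int_T^{2T}\prod_{\mu=1}^{j}\left|\zeta^{(n_\mu)}\left(\tfrac12+it\right)\right|^{2k_\mu}dt\ \geq\ \left(C(a_1,\ldots,a_K)+o(1)\right)T(\log T)^{K^2+2N}.$$ The same lower bound holds with the interval of integration $[T,2T]$ replaced by $[1,T]$.
   Context: $\zeta^{(n)}$ denotes the $n$-th derivative of the Riemann zeta function ($\zeta^{(0)}=\zeta$). The constant $C(a_1,\ldots,a_K)$ is defined by $$\begin{aligned}C(a_1,\ldots,a_K)={}&\frac{1}{\Gamma(K^2+2N+1)}\left(\prod_p\left(1-\frac1p\right)^{K^2}\sum_{\ell=0}^{\infty}\frac{\binom{\ell+K-1}{K-1}^2}{p^\ell}\right)\\&\times\left.\frac{\partial^{2N}}{\partial x_1^{a_1}\cdots\partial x_K^{a_K}\,\partial y_1^{a_1}\cdots\partial y_K^{a_K}}\prod_{r=1}^{K}\prod_{q=1}^{K}\frac{1}{1+x_r+y_q}\right|_{x_1=\cdots=x_K=y_1=\cdots=y_K=0},\end{aligned}$$ where the product is over primes $p$ and $N=a_1+\cdots+a_K$.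 *)

theory Defs
  imports
    "HOL-Complex_Analysis.Complex_Analysis"
    "HOL-Library.Landau_Symbols"
    "HOL-Computational_Algebra.Primes"
begin

(* HOL-Complex_Analysis does not provide the zeta function, so it is introduced as the analytic
   continuation of the Dirichlet series. At the pole it gets the value 0, which makes the
   description definite. Existence and uniqueness are proved below, see riemann_zeta_props. *)
definition is_riemann_zeta :: "(complex \<Rightarrow> complex) \<Rightarrow> bool" where
  "is_riemann_zeta f \<longleftrightarrow>
     f holomorphic_on - {1} \<and> f 1 = 0 \<and>
     (\<forall>s. Re s > 1 \<longrightarrow> (\<lambda>n. of_nat (Suc n) powr (- s)) sums f s)"

definition riemann_zeta :: "complex \<Rightarrow> complex" where
  "riemann_zeta = (THE f. is_riemann_zeta f)"

(* A function of the coordinates v i is a function of v :: 'i => real; v(i := u) varies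
   the coordinate i only. *)
definition partial_deriv :: "'i \<Rightarrow> (('i \<Rightarrow> real) \<Rightarrow> real) \<Rightarrow> ('i \<Rightarrow> real) \<Rightarrow> real" where
  "partial_deriv i f v = deriv (\<lambda>u. f (v(i := u))) (v i)"

(* The coordinates Inl r and Inr q with r, q < K carry the variables x and y
   (indexed from 0 instead of from 1). *)
definition cauchy_kernel :: "nat \<Rightarrow> (nat + nat \<Rightarrow> real) \<Rightarrow> real" where
  "cauchy_kernel K v = (\<Prod>r<K. \<Prod>q<K. 1 / (1 + v (Inl r) + v (Inr q)))"

definition mixed_deriv ::
    "nat list \<Rightarrow> ((nat + nat \<Rightarrow> real) \<Rightarrow> real) \<Rightarrow> (nat + nat \<Rightarrow> real) \<Rightarrow> real" where
  "mixed_deriv as f =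
     foldr (\<lambda>r. partial_deriv (Inl r) ^^ (as ! r)) [0..<length as]
       (foldr (\<lambda>q. partial_deriv (Inr q) ^^ (as ! q)) [0..<length as] f)"

definition arith_factor :: "nat \<Rightarrow> real" where
  "arith_factor K =
     (\<Prod>p. if prime p
           then (1 - 1 / real p) ^ (K\<^sup>2) *
                (\<Sum>l. real ((l + K - 1) choose (K - 1)) ^ 2 / real p ^ l)
           else 1)"

definition moment_const :: "nat list \<Rightarrow> real" where
  "moment_const as =
     (let K = length as; N = sum_list as
      in 1 / Gamma (real (K\<^sup>2 + 2 * N + 1)) * arith_factor K *
         mixed_deriv as (cauchy_kernel K) (\<lambda>_. 0))"

lemma holomorphic_on_suminf_bound:
  fixes f :: "nat \<Rightarrow> complex \<Rightarrow> complex"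
  assumes S: "open S" and hol: "\<And>n. f n holomorphic_on S"
    and bd: "\<And>x. x \<in> S \<Longrightarrow> \<exists>d>0. \<exists>h. cball x d \<subseteq> S \<and> summable h \<and>
                     (\<forall>n. \<forall>y\<in>cball x d. norm (f n y) \<le> h n)"
  shows "(\<lambda>x. \<Sum>n. f n x) holomorphic_on S"
    and "\<And>x. x \<in> S \<Longrightarrow> summable (\<lambda>n. f n x)"
proof -
  show "(\<lambda>x. \<Sum>n. f n x) holomorphic_on S"
  proof (rule holomorphic_uniform_sequence[OF S, where f = "\<lambda>N x. \<Sum>n<N. f n x"])
    show "(\<lambda>x. \<Sum>n<N. f n x) holomorphic_on S" for N
      by (intro holomorphic_intros hol)
    fix x assume "x \<in> S"
    from bd[OF this] obtain d h where d: "d > 0" "cball x d \<subseteq> S" "summable h"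
      and h: "\<And>n y. y \<in> cball x d \<Longrightarrow> norm (f n y) \<le> h n" by blast
    have "uniform_limit (cball x d) (\<lambda>N x. \<Sum>n<N. f n x) (\<lambda>x. \<Sum>n. f n x) sequentially"
      using h d(3) by (intro Weierstrass_m_test)
    with d show "\<exists>d>0. cball x d \<subseteq> S \<and>
        uniform_limit (cball x d) (\<lambda>N x. \<Sum>n<N. f n x) (\<lambda>x. \<Sum>n. f n x) sequentially"
      by blast
  qed
  fix x assume "x \<in> S"
  from bd[OF this] obtain d h where d: "d > 0" "summable h"
    and h: "\<And>n y. y \<in> cball x d \<Longrightarrow> norm (f n y) \<le> h n" by blast
  show "summable (\<lambda>n. f n x)"
    using d by (intro summable_comparison_test'[OF d(2)] h) auto
qed

lemma norm_nat_powr: "norm (of_nat (Suc n) powr s) = real (Suc n) powr Re s" for s :: complex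
  by (subst norm_powr_real_powr) auto

lemma summable_real_powr_Suc: "summable (\<lambda>n. real (Suc n) powr s)" if "s < -1"
proof -
  have "summable (\<lambda>n. real n powr s)" using that by (simp add: summable_real_powr_iff)
  thus ?thesis by (subst summable_Suc_iff[of "\<lambda>n. real n powr s"])
qed

lemma dirichlet_zeta_holomorphic:
  "(\<lambda>s. \<Sum>n. of_nat (Suc n) powr (- s)) holomorphic_on {s::complex. Re s > 1}" (is ?A)
  "Re s > 1 \<Longrightarrow> summable (\<lambda>n. of_nat (Suc n) powr (- s :: complex))"
proof -
  have hol: "(\<lambda>s::complex. of_nat (Suc n) powr (- s)) holomorphic_on {s. Re s > 1}" for n
    by (intro holomorphic_intros)
  have bd: "\<exists>d>0. \<exists>h. cball x d \<subseteq> {s. Re s > 1} \<and> summable h \<and>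
          (\<forall>n. \<forall>y\<in>cball x d. norm (of_nat (Suc n) powr (- y)) \<le> h n)"
    if x: "x \<in> {s::complex. Re s > 1}" for x
  proof -
    define d where "d = (Re x - 1) / 2"
    have d: "d > 0" using x by (simp add: d_def)
    have Re: "Re y \<ge> 1 + d" if "y \<in> cball x d" for y
    proof -
      have "Re x - Re y \<le> norm (x - y)" using complex_Re_le_cmod[of "x - y"] by simp
      with that show ?thesis by (simp add: dist_norm d_def field_simps)
    qed
    show ?thesis
    proof (intro exI[of _ d] exI[of _ "\<lambda>n. real (Suc n) powr (-1 - d)"] conjI allI ballI)
      show "cball x d \<subseteq> {s. Re s > 1}" using Re d by force
      show "summable (\<lambda>n. real (Suc n) powr (-1 - d))"
        using d by (intro summable_real_powr_Suc) auto
      fix n y assume "y \<in> cball x d"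
      from Re[OF this] show "norm (of_nat (Suc n) powr (- y)) \<le> real (Suc n) powr (-1 - d)"
        unfolding norm_nat_powr by (intro powr_mono) auto
    qed (use d in auto)
  qed
  have op: "open {s::complex. Re s > 1}" by (rule open_halfspace_Re_gt)
  show ?A by (rule holomorphic_on_suminf_bound(1)[OF op hol bd])
  show "Re s > 1 \<Longrightarrow> summable (\<lambda>n. of_nat (Suc n) powr (- s :: complex))"
    using holomorphic_on_suminf_bound(2)[OF op hol bd, of s] by simp
qed

definition zeta_taylor_term :: "nat \<Rightarrow> nat \<Rightarrow> complex \<Rightarrow> complex" where
  "zeta_taylor_term m n s = of_nat (Suc (Suc n)) powr (1 - s) -
     (\<Sum>i\<le>m. (\<Prod>j<i. 1 - s - of_nat j) * of_nat (Suc n) powr (1 - s - of_nat i) / fact i)"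

lemma norm_zeta_taylor_term_le:
  assumes "Re s + real m > 0"
  shows "norm (zeta_taylor_term m n s)
           \<le> (\<Prod>j\<le>m. norm s + 1 + real j) * real (Suc n) powr (- Re s - real m)"
proof -
  define f where "f = (\<lambda>i x. (\<Prod>j<i. 1 - s - of_nat j) * x powr (1 - s - of_nat i))"
  define w z :: complex where "w = of_nat (Suc n)" and "z = of_nat (Suc (Suc n))"
  define S where "S = closed_segment w z"
  have S: "\<exists>t\<ge>real (Suc n). x = of_real t" if "x \<in> S" for x
  proof -
    from that obtain u where u: "0 \<le> u" "x = (1 - u) *\<^sub>R w + u *\<^sub>R z"
      unfolding S_def closed_segment_def by auto
    have "x = of_real (real (Suc n) + u)"
      unfolding u(2) w_def z_def by (simp add: scaleR_conv_of_real algebra_simps)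
    with u(1) show ?thesis by (intro exI[of _ "real (Suc n) + u"]) auto
  qed
  have "norm (f 0 z - (\<Sum>i\<le>m. f i w * (z - w) ^ i / fact i)) \<le>
          ((\<Prod>j\<le>m. norm s + 1 + real j) * real (Suc n) powr (- Re s - real m)) *
          norm (z - w) ^ Suc m / fact m"
  proof (rule complex_Taylor)
    show "convex S" "w \<in> S" "z \<in> S" by (auto simp: S_def)
  next
    fix i x assume "x \<in> S"
    then obtain t where t: "t \<ge> real (Suc n)" "x = of_real t" using S by blast
    have "x \<notin> \<real>\<^sub>\<le>\<^sub>0" using t by (auto simp: complex_nonpos_Reals_iff)
    thus "(f i has_field_derivative f (Suc i) x) (at x within S)"
      unfolding f_def
      by (auto intro!: derivative_eq_intros simp: algebra_simps)
  next
    fix x assume "x \<in> S"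
    then obtain t where t: "t \<ge> real (Suc n)" "x = of_real t" using S by blast
    have "norm (f (Suc m) x) = (\<Prod>j\<le>m. norm (1 - s - of_nat j)) * t powr (- Re s - real m)"
      unfolding f_def norm_mult t(2) using t(1)
      by (subst norm_powr_real_powr)
         (auto simp: prod_norm lessThan_Suc_atMost algebra_simps)
    also have "\<dots> \<le> (\<Prod>j\<le>m. norm s + 1 + real j) * real (Suc n) powr (- Re s - real m)"
    proof (intro mult_mono prod_mono)
      fix j
      have "norm (1 - s - of_nat j) \<le> norm (1 - s) + norm (of_nat j :: complex)"
        by (rule norm_triangle_ineq4)
      also have "norm (1 - s) \<le> 1 + norm s" using norm_triangle_ineq4[of 1 s] by simp
      finally show "0 \<le> norm (1 - s - of_nat j) \<and> norm (1 - s - of_nat j) \<le> norm s + 1 + real j"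
        by (simp add: algebra_simps)
    next
      show "t powr (- Re s - real m) \<le> real (Suc n) powr (- Re s - real m)"
        using assms t(1) by (intro powr_mono2') auto
    qed (auto intro!: prod_nonneg)
    finally show "norm (f (Suc m) x) \<le>
      (\<Prod>j\<le>m. norm s + 1 + real j) * real (Suc n) powr (- Re s - real m)" .
  qed
  also have "z - w = 1" by (simp add: z_def w_def)
  also have "f 0 z - (\<Sum>i\<le>m. f i w * 1 ^ i / fact i) = zeta_taylor_term m n s"
    unfolding zeta_taylor_term_def f_def w_def z_def by simp
  also have "X * norm (1::complex) ^ Suc m / fact m \<le> X" if "X \<ge> 0" for X :: real
  proof -
    have "X / fact m \<le> X / 1" using that fact_ge_1[of m] by (intro divide_left_mono) auto
    thus ?thesis by simp
  qed
  finally show ?thesis by (simp add: prod_nonneg)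
qed

lemma zeta_taylor_holomorphic:
  "(\<lambda>s. \<Sum>n. zeta_taylor_term (Suc m) n s) holomorphic_on {s. Re s > - real m}" (is ?A)
  "Re s > - real m \<Longrightarrow> summable (\<lambda>n. zeta_taylor_term (Suc m) n s)"
proof -
  have hol: "zeta_taylor_term (Suc m) n holomorphic_on {s. Re s > - real m}" for n
    unfolding zeta_taylor_term_def[abs_def] by (intro holomorphic_intros) auto
  have bd: "\<exists>d>0. \<exists>h. cball x d \<subseteq> {s. Re s > - real m} \<and> summable h \<and>
          (\<forall>n. \<forall>y\<in>cball x d. norm (zeta_taylor_term (Suc m) n y) \<le> h n)"
    if x: "x \<in> {s::complex. Re s > - real m}" for x
  proof -
    define d where "d = (Re x + real m) / 2"
    have d: "d > 0" using x by (simp add: d_def)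
    have Re: "Re y + real m \<ge> d" if "y \<in> cball x d" for y
    proof -
      have "Re x - Re y \<le> norm (x - y)" using complex_Re_le_cmod[of "x - y"] by simp
      with that show ?thesis by (simp add: dist_norm d_def field_simps)
    qed
    have nrm: "norm y \<le> norm x + d" if "y \<in> cball x d" for y
      using that norm_triangle_ineq2[of y x] by (simp add: dist_norm norm_minus_commute)
    define B where "B = (\<Prod>j\<le>Suc m. norm x + d + 1 + real j)"
    show ?thesis
    proof (intro exI[of _ d] exI[of _ "\<lambda>n. B * real (Suc n) powr (-1 - d)"] conjI allI ballI)
      show "cball x d \<subseteq> {s. Re s > - real m}" using Re d by force
      show "summable (\<lambda>n. B * real (Suc n) powr (-1 - d))"
        using d by (intro summable_mult summable_real_powr_Suc) auto
      fix n y assume y: "y \<in> cball x d"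
      have "norm (zeta_taylor_term (Suc m) n y)
           \<le> (\<Prod>j\<le>Suc m. norm y + 1 + real j) * real (Suc n) powr (- Re y - real (Suc m))"
        using Re[OF y] d by (intro norm_zeta_taylor_term_le) auto
      also have "\<dots> \<le> B * real (Suc n) powr (-1 - d)"
        unfolding B_def using Re[OF y] nrm[OF y] d
        by (intro mult_mono prod_mono powr_mono prod_nonneg conjI add_mono add_nonneg_nonneg) auto
      finally show "norm (zeta_taylor_term (Suc m) n y) \<le> B * real (Suc n) powr (-1 - d)" .
    qed (use d in auto)
  qed
  have op: "open {s::complex. Re s > - real m}" by (rule open_halfspace_Re_gt)
  show ?A by (rule holomorphic_on_suminf_bound(1)[OF op hol bd])
  show "Re s > - real m \<Longrightarrow> summable (\<lambda>n. zeta_taylor_term (Suc m) n s)"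
    using holomorphic_on_suminf_bound(2)[OF op hol bd, of s] by simp
qed

lemma zeta_taylor_sum:
  assumes s: "Re s > 1"
  defines "Z \<equiv> \<lambda>s::complex. \<Sum>n. of_nat (Suc n) powr (- s)"
  shows "(s - 1) * Z s = 1 + (\<Sum>n. zeta_taylor_term (Suc m) n s) +
           (\<Sum>i<m. (\<Prod>j<i+2. 1 - s - of_nat j) / fact (i+2) * Z (s + of_nat i + 1))"
proof -
  define P where "P = (\<lambda>i. (\<Prod>j<i. 1 - s - of_nat j) / fact i)"
  have Zs: "(\<lambda>n. of_nat (Suc n) powr (- s)) sums Z s" if "Re s > 1" for s
    using dirichlet_zeta_holomorphic(2)[OF that] unfolding Z_def by (rule summable_sums)
  have lim: "(\<lambda>n. of_nat (Suc n) powr (1 - s)) \<longlonglongrightarrow> 0"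
  proof (rule tendsto_norm_zero_cancel)
    have "(\<lambda>n. real (Suc n) powr Re (1 - s)) \<longlonglongrightarrow> 0"
      using s by (intro tendsto_neg_powr filterlim_compose[OF filterlim_real_sequentially]
                    filterlim_Suc) auto
    thus "(\<lambda>n. norm (of_nat (Suc n) powr (1 - s))) \<longlonglongrightarrow> 0"
      unfolding norm_nat_powr .
  qed
  have tele: "(\<lambda>n. of_nat (Suc (Suc n)) powr (1 - s) - of_nat (Suc n) powr (1 - s)) sums (0 - 1)"
    using telescope_sums[OF lim] by simp
  have sm: "(\<lambda>n. \<Sum>i\<le>m. P (Suc i) * of_nat (Suc n) powr (- (s + of_nat i)))
              sums (\<Sum>i\<le>m. P (Suc i) * Z (s + of_nat i))"
    using s by (intro sums_sum sums_mult Zs) auto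
  have eq: "zeta_taylor_term (Suc m) n s =
      (of_nat (Suc (Suc n)) powr (1 - s) - of_nat (Suc n) powr (1 - s)) -
      (\<Sum>i\<le>m. P (Suc i) * of_nat (Suc n) powr (- (s + of_nat i)))" for n
  proof -
    have "(\<Sum>i\<le>Suc m. (\<Prod>j<i. 1 - s - of_nat j) * of_nat (Suc n) powr (1 - s - of_nat i) / fact i)
        = (\<Sum>i\<le>Suc m. P i * of_nat (Suc n) powr (1 - s - of_nat i))"
      by (simp add: P_def)
    also have "\<dots> = of_nat (Suc n) powr (1 - s) +
                  (\<Sum>i\<le>m. P (Suc i) * of_nat (Suc n) powr (- (s + of_nat i)))"
      by (subst sum.atMost_Suc_shift) (simp add: P_def)
    finally show ?thesis by (simp add: zeta_taylor_term_def)
  qed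
  have "(\<lambda>n. zeta_taylor_term (Suc m) n s) sums
          ((0 - 1) - (\<Sum>i\<le>m. P (Suc i) * Z (s + of_nat i)))"
    unfolding eq by (rule sums_diff[OF tele sm])
  hence 1: "(\<Sum>n. zeta_taylor_term (Suc m) n s) =
          (0 - 1) - (\<Sum>i\<le>m. P (Suc i) * Z (s + of_nat i))"
    by (rule sums_unique[symmetric])
  have "(\<Sum>i\<le>m. P (Suc i) * Z (s + of_nat i)) =
          (1 - s) * Z s + (\<Sum>i<m. P (i + 2) * Z (s + of_nat i + 1))"
    unfolding sum.atMost_shift by (simp add: P_def add_ac)
  with 1 have "(s - 1) * Z s = 1 + (\<Sum>n. zeta_taylor_term (Suc m) n s) +
      (\<Sum>i<m. P (i + 2) * Z (s + of_nat i + 1))"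
    by (simp add: left_diff_distrib)
  thus ?thesis unfolding P_def .
qed

lemma zeta_continuation_halfplane:
  "\<exists>g. g holomorphic_on {s. Re s > 1 - real m} \<and>
      (\<forall>s. Re s > 1 \<longrightarrow> g s = (s - 1) * (\<Sum>n. of_nat (Suc n) powr (- s)))"
proof (induction m)
  case 0
  have "(\<lambda>s::complex. (s - 1) * (\<Sum>n. of_nat (Suc n) powr (- s))) holomorphic_on {s. Re s > 1}"
    by (intro holomorphic_intros dirichlet_zeta_holomorphic)
  thus ?case by (intro exI[of _ "\<lambda>s. (s - 1) * (\<Sum>n. of_nat (Suc n) powr (- s))"]) simp
next
  case (Suc m)
  define Z where "Z = (\<lambda>s::complex. \<Sum>n. of_nat (Suc n) powr (- s))"
  from Suc obtain g where hol: "g holomorphic_on {s. Re s > 1 - real m}"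
    and g: "\<And>s. Re s > 1 \<Longrightarrow> g s = (s - 1) * Z s" unfolding Z_def by blast
  define h where "h = (\<lambda>s. 1 + (\<Sum>n. zeta_taylor_term (Suc m) n s) -
     (\<Sum>i<m. (\<Prod>j<i+1. 1 - s - of_nat j) / fact (i+2) * g (s + of_nat i + 1)))"
  have "h holomorphic_on {s. Re s > - real m}"
    unfolding h_def
  proof (intro holomorphic_intros zeta_taylor_holomorphic)
    show "fact (i + 2) \<noteq> (0::complex)" for i by (rule fact_nonzero)
    fix i
    have "(g \<circ> (\<lambda>s. s + of_nat i + 1)) holomorphic_on {s. Re s > - real m}"
      by (rule holomorphic_on_compose_gen[OF _ hol]) (auto intro!: holomorphic_intros)
    thus "(\<lambda>s. g (s + of_nat i + 1)) holomorphic_on {s. Re s > - real m}"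
      by (simp add: o_def)
  qed
  moreover have "h s = (s - 1) * Z s" if s: "Re s > 1" for s
  proof -
    have "(\<Prod>j<i+2. 1 - s - of_nat j) / fact (i+2) * Z (s + of_nat i + 1) =
          - ((\<Prod>j<i+1. 1 - s - of_nat j) / fact (i+2) * g (s + of_nat i + 1))" for i
    proof -
      have "(\<Prod>j<i+2. 1 - s - of_nat j) = (\<Prod>j<i+1. 1 - s - of_nat j) * (- (s + of_nat i))"
        by simp
      moreover have "g (s + of_nat i + 1) = (s + of_nat i) * Z (s + of_nat i + 1)"
        using s by (subst g) auto
      moreover have "A * (- (s + of_nat i)) / B * w = - (A / B * ((s + of_nat i) * w))"
        for A B w :: complex by (simp add: mult_ac minus_divide_left[symmetric] del: minus_add_distrib)
      ultimately show ?thesis by (simp only:)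
    qed
    hence "(s - 1) * Z s = h s"
      using zeta_taylor_sum[OF s, of m] unfolding h_def Z_def by (simp only: sum_negf) simp
    thus ?thesis by simp
  qed
  ultimately show ?case unfolding Z_def by (intro exI[of _ h]) simp
qed

lemma is_riemann_zeta_exists: "\<exists>f. is_riemann_zeta f"
proof -
  define Z where "Z = (\<lambda>s::complex. \<Sum>n. of_nat (Suc n) powr (- s))"
  define H where "H = (\<lambda>m. {s::complex. Re s > 1 - real m})"
  have "\<forall>m. \<exists>g. g holomorphic_on H m \<and> (\<forall>s. Re s > 1 \<longrightarrow> g s = (s - 1) * Z s)"
    using zeta_continuation_halfplane unfolding H_def Z_def by blast
  then obtain g where hol: "\<And>m. g m holomorphic_on H m"
    and g: "\<And>m s. Re s > 1 \<Longrightarrow> g m s = (s - 1) * Z s" by metis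
  have op: "open (H m)" for m unfolding H_def by (rule open_halfspace_Re_gt)
  have sub: "H m \<subseteq> H n" if "m \<le> n" for m n using that by (auto simp: H_def)
  have agree: "g n s = g m s" if "m \<le> n" "s \<in> H m" for m n s
  proof (rule analytic_continuation_open[of "H 0" "H m" "g n" "g m"])
    show "H 0 \<noteq> {}" by (auto simp: H_def intro!: exI[of _ 2])
    show "connected (H m)"
      unfolding H_def by (intro convex_connected convex_halfspace_Re_gt)
    show "g n holomorphic_on H m" by (rule holomorphic_on_subset[OF hol sub[OF that(1)]])
    show "g n z = g m z" if "z \<in> H 0" for z using that by (simp add: H_def g)
  qed (use op hol sub that in auto)
  define M where "M = (\<lambda>s. nat \<lceil>2 - Re s\<rceil>)"
  have M: "s \<in> H (M s)" for s unfolding H_def M_def by simp linarith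
  define f where "f = (\<lambda>s. if s = 1 then 0 else g (M s) s / (s - 1))"
  have f: "f s = g m s / (s - 1)" if "s \<in> H m" "s \<noteq> 1" for m s
    using agree[of m "M s" s] agree[of "M s" m s] M[of s] that
    by (cases "m \<le> M s") (auto simp: f_def)
  have "f field_differentiable at s" if s: "s \<noteq> 1" for s
  proof -
    have "(\<lambda>s. g (M s0) s / (s - 1)) holomorphic_on H (M s0) - {1}" for s0
      by (intro holomorphic_intros holomorphic_on_subset[OF hol]) auto
    hence "f holomorphic_on H (M s) - {1}"
      by (rule holomorphic_transform) (auto simp: f)
    moreover have "open (H (M s) - {1})" by (intro open_Diff op) auto
    ultimately show ?thesis using M[of s] s by (auto simp: holomorphic_on_open field_differentiable_def)
  qed
  hence "f holomorphic_on - {1}"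
    by (auto simp: holomorphic_on_def intro: field_differentiable_at_within)
  moreover have "(\<lambda>n. of_nat (Suc n) powr (- s)) sums f s" if s: "Re s > 1" for s
  proof -
    have "f s = g 0 s / (s - 1)" using s by (intro f) (auto simp: H_def)
    also have "\<dots> = Z s" using s by (subst g) auto
    finally show ?thesis
      using dirichlet_zeta_holomorphic(2)[OF s] unfolding Z_def by (simp add: summable_sums)
  qed
  ultimately have "is_riemann_zeta f" by (auto simp: is_riemann_zeta_def f_def)
  thus ?thesis by blast
qed

lemma is_riemann_zeta_unique:
  assumes f: "is_riemann_zeta f" and g: "is_riemann_zeta g"
  shows "f = g"
proof
  fix s
  have "f s = g s" if "s \<noteq> 1"
  proof (rule analytic_continuation_open[of "{s. Re s > 1}" "- {1}" f g])
    show "open {s::complex. Re s > 1}" by (rule open_halfspace_Re_gt)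
    show "{s::complex. Re s > 1} \<noteq> {}" by (auto intro!: exI[of _ 2])
    show "connected (- {1::complex})" by (rule connected_punctured_universe) simp
    show "f z = g z" if "z \<in> {s. Re s > 1}" for z
      using f g that unfolding is_riemann_zeta_def by (blast intro: sums_unique2)
  qed (use f g that in \<open>auto simp: is_riemann_zeta_def\<close>)
  thus "f s = g s" using f g by (cases "s = 1") (auto simp: is_riemann_zeta_def)
qed

lemma riemann_zeta_props:
  shows "riemann_zeta holomorphic_on - {1}" and "riemann_zeta 1 = 0"
    and "Re s > 1 \<Longrightarrow> (\<lambda>n. of_nat (Suc n) powr (- s)) sums riemann_zeta s"
proof -
  have "\<exists>!f. is_riemann_zeta f"
    using is_riemann_zeta_exists is_riemann_zeta_unique by blast
  hence "is_riemann_zeta riemann_zeta" unfolding riemann_zeta_def by (rule theI')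
  thus "riemann_zeta holomorphic_on - {1}" "riemann_zeta 1 = 0"
    "Re s > 1 \<Longrightarrow> (\<lambda>n. of_nat (Suc n) powr (- s)) sums riemann_zeta s"
    by (auto simp: is_riemann_zeta_def)
qed

end

theory Submission
  imports Defs "HOL-Probability.Probability" "HOL-Real_Asymp.Real_Asymp"
begin

text \<open>
  Write \<open>f\<close> for the product of the derivatives of zeta and \<open>a(n)\<close> for the coefficients of its
  Dirichlet series up to sign. For the partial sum \<open>A\<close> of length \<open>X = T\<^sup>1\<^sup>-\<^sup>\<epsilon>\<close>,
  \<open>\<bar>f\<bar>\<^sup>2 \<ge> 2 Re (f cnj A) - \<bar>A\<bar>\<^sup>2\<close>. Integrate this on the critical line against a Gaussian of
  width \<open>T\<^sup>1\<^sup>-\<^sup>\<epsilon>\<^sup>/\<^sup>2\<close>: off-diagonal terms are exponentially small because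
  \<open>\<bar>ln (m / n)\<bar>\<close> is at least of order \<open>1 / X\<close>, and \<open>f\<close> may be replaced by a very long partial
  sum after a shift to \<open>Re s = 3\<close>, the Gaussian making the horizontal sides negligible. Averaging
  over the centre of the Gaussian bounds the mean square of \<open>f\<close> below by
  \<open>T \<Sum>\<^sub>n\<^sub>\<le>\<^sub>X a(n)\<^sup>2 / n\<close> up to a factor tending to 1.

  A one-sided form of Karamata's theorem reduces this sum to the behaviour of
  \<open>\<Sum> a(n)\<^sup>2 n powr (-1 - s)\<close> as \<open>s \<rightarrow> 0\<close>. Without logarithms the series, with a shift in each
  variable, is an Euler product whose quotient by \<open>\<Prod> \<zeta>(1 + s (x\<^sub>r + y\<^sub>q))\<close> converges uniformly down to
  \<open>s = 0\<close>. The logarithms are restored one at a time: \<open>t exp (- x t)\<close> lies between two difference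
  quotients of \<open>x \<mapsto> exp (- x t)\<close>, so the limits can be differentiated in the shifts although
  they are only known pointwise.
\<close>

section \<open>A one-sided Tauberian theorem\<close>

text \<open>The variable s of the Tauberian theorem also scales the shifts: a divisor d carries the
  power d^(-s(1/2 + v)), with v one of the variables x, y. Hence each \<zeta>(1 + s(1 + x + y))
  behaves like 1 / (s(1 + x + y)), the double product turns directly into
  \<open>cauchy_kernel\<close>, and every derivative in a shift brings down s ln d, so that powers
  of s alone record the exponent K^2 + 2N. Nonnegative coefficients, obtained by dropping the signs
  of the derivatives, drive the argument: they allow polynomial minorants, monotone comparison of
  difference quotients, and Euler products without bounds for single coefficients. The length X lies
  below the Gaussian width, and the width below T, by a factor T^(\<epsilon>/2) each. This makes all
  off-diagonal and window errors smaller than any power of T, so crude polynomial bounds suffice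
  elsewhere. The price is a factor (1 - \<epsilon>)^(K^2 + 2N), which tends to 1.\<close>

lemma erlang_density_has_integral:
  assumes "l > 0"
  shows "(erlang_density k l has_integral 1) UNIV"
proof -
  have "(\<integral>\<^sup>+ x. ennreal (erlang_density k l x) \<partial>lborel) = ennreal 1"
    using nn_integral_erlang_ith_moment[OF assms, of k 0] by simp
  thus ?thesis using assms
    by (intro nn_integral_has_integral) auto
qed

text \<open>Multiplying the density of rate 1 by exp(-ix) gives the density of rate i + 1 up to
  normalisation. For a polynomial in exp(-x) this produces the sum of
  \<open>a i / (i + 1) ^ (k + 1)\<close> that appears in the Karamata limit.\<close>

lemma erlang_exp_moment:
  "((\<lambda>x. erlang_density k 1 x * exp (- x) ^ i) has_integral 1 / real (Suc i) ^ Suc k) UNIV"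
proof -
  have "((\<lambda>x. erlang_density k (real (Suc i)) x * (1 / real (Suc i) ^ Suc k)) has_integral
          1 * (1 / real (Suc i) ^ Suc k)) UNIV"
    by (intro has_integral_mult_left erlang_density_has_integral) simp
  also have "(\<lambda>x. erlang_density k (real (Suc i)) x * (1 / real (Suc i) ^ Suc k)) =
             (\<lambda>x. erlang_density k 1 x * exp (- x) ^ i)"
  proof
    fix x :: real
    have "exp (- (real (Suc i) * x)) = exp (- x) * exp (- x) ^ i"
      by (simp add: exp_of_nat_mult[symmetric] exp_add[symmetric] algebra_simps)
    thus "erlang_density k (real (Suc i)) x * (1 / real (Suc i) ^ Suc k) =
            erlang_density k 1 x * exp (- x) ^ i"
      by (simp add: erlang_density_def del: power_Suc of_nat_Suc)
  qed
  finally show ?thesis by simp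
qed

lemma weierstrass_unit_interval:
  fixes f :: "real \<Rightarrow> real"
  assumes "continuous_on {0..1} f" "e > 0"
  obtains a n where "\<And>x. x \<in> {0..1} \<Longrightarrow> \<bar>f x - (\<Sum>i\<le>n. a i * x ^ i)\<bar> < e"
proof -
  obtain g where g: "real_polynomial_function g" "\<And>x. x \<in> {0..1} \<Longrightarrow> \<bar>f x - g x\<bar> < e"
    using Stone_Weierstrass_real_polynomial_function[OF _ assms(1,2)] by (metis compact_Icc)
  then obtain a n where "g = (\<lambda>x. \<Sum>i\<le>n. a i * x ^ i)"
    unfolding real_polynomial_function_iff_sum by blast
  with g(2) show ?thesis using that by blast
qed

text \<open>Under x = exp(-t) the indicator of [1/e, 1] becomes that of [0, 1], whose integral
  against t^k / k! is 1 / (k + 1)!. A continuous ramp below it is divided by x and approximated by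
  Weierstrass; the factor x kept outside makes the powers start at x^1, so that only convergent
  series are met later.\<close>

lemma karamata_polynomial:
  assumes "e > 0"
  obtains a n where
    "\<And>x. 0 < x \<Longrightarrow> x \<le> 1 \<Longrightarrow> x * (\<Sum>i\<le>n. a i * x ^ i) \<le> (if x \<ge> exp (-1) then 1 else 0)"
    "(\<Sum>i\<le>n. a i / real (Suc i) ^ Suc k) \<ge> 1 / fact (Suc k) - (e::real)"
proof -
  have "((\<lambda>\<kappa>. (1 - \<kappa>) ^ Suc k / fact (Suc k) - 2 * \<kappa>) \<longlongrightarrow> (1 - 0) ^ Suc k / fact (Suc k) - 2 * 0) (at_right (0::real))"
    by (intro tendsto_intros) auto
  hence "\<forall>\<^sub>F \<kappa> in at_right (0::real). (1 - \<kappa>) ^ Suc k / fact (Suc k) - 2 * \<kappa> > 1 / fact (Suc k) - e"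
    using assms by (intro order_tendstoD) auto
  hence "\<forall>\<^sub>F \<kappa> in at_right (0::real). (1 - \<kappa>) ^ Suc k / fact (Suc k) - 2 * \<kappa> > 1 / fact (Suc k) - e
           \<and> \<kappa> \<in> {0<..<1}"
    by (intro eventually_conj eventually_at_right_real) auto
  then obtain \<kappa> :: real where \<kappa>: "(1 - \<kappa>) ^ Suc k / fact (Suc k) - 2 * \<kappa> > 1 / fact (Suc k) - e"
       "0 < \<kappa>" "\<kappa> < 1"
    using eventually_happens[of _ "at_right (0::real)"] trivial_limit_at_right_real by fastforce
  \<comment> \<open>Clamping at 1/e keeps the logarithm and the division in \<open>\<phi>\<close>
    continuous on all of [0, 1], and makes \<open>\<phi>\<close> vanish below 1/e.\<close>
  define m where "m = (\<lambda>x::real. max x (exp (-1)))"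
  \<comment> \<open>At x = exp(-t) the product \<open>x * \<phi> x\<close> equals 1 for 0 \<le> t
    \<le> 1 - \<kappa> and falls linearly to 0 at t = 1.\<close>
  define \<phi> where "\<phi> = (\<lambda>x. min 1 ((1 + ln (m x)) / \<kappa>) / m x)"
  have m: "m x > 0" for x unfolding m_def by (auto simp: less_max_iff_disj)
  have "continuous_on {0..1} \<phi>"
  proof -
    have "m x \<noteq> 0" for x using m[of x] by simp
    moreover have "continuous_on {0..1} m" unfolding m_def by (intro continuous_intros)
    ultimately show ?thesis unfolding \<phi>_def using \<kappa>(2)
      by (intro continuous_intros) auto
  qed
  \<comment> \<open>Lowering by \<kappa> before approximating within \<kappa> leaves a polynomial
    between \<open>\<phi> - 2 * \<kappa>\<close> and \<open>\<phi>\<close>.\<close>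
  hence "continuous_on {0..1} (\<lambda>x. \<phi> x - \<kappa>)" by (intro continuous_intros)
  then obtain a n where an: "\<And>x. x \<in> {0..1} \<Longrightarrow> \<bar>\<phi> x - \<kappa> - (\<Sum>i\<le>n. a i * x ^ i)\<bar> < \<kappa>"
    using weierstrass_unit_interval[of "\<lambda>x. \<phi> x - \<kappa>" \<kappa>] \<kappa>(2) by blast
  show ?thesis
  proof (rule that[of a n])
    fix x :: real assume x: "0 < x" "x \<le> 1"
    have le: "(\<Sum>i\<le>n. a i * x ^ i) \<le> \<phi> x" using an[of x] x by (auto simp: abs_less_iff)
    show "x * (\<Sum>i\<le>n. a i * x ^ i) \<le> (if x \<ge> exp (-1) then 1 else 0)"
    proof (cases "x \<ge> exp (-1)")
      case True
      hence "m x = x" by (simp add: m_def)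
      hence "x * \<phi> x \<le> 1" using x by (simp add: \<phi>_def)
      moreover have "x * (\<Sum>i\<le>n. a i * x ^ i) \<le> x * \<phi> x"
        using le x by (intro mult_left_mono) auto
      ultimately show ?thesis using True by (simp del: mult_le_cancel_left_pos)
    next
      case False
      hence "\<phi> x = 0" by (simp add: \<phi>_def m_def)
      thus ?thesis using le False x mult_nonneg_nonpos[of x] by auto
    qed
  next
    \<comment> \<open>A minorant of the Erlang-weighted polynomial in the variable t: only the
      plateau of the ramp is kept, and the approximation loss integrates to 2\<kappa> because the
      density has mass 1.\<close>
    define g where "g = (\<lambda>x::real. (if x \<in> {0..1-\<kappa>} then x ^ k / fact k else 0) - 2 * \<kappa> * erlang_density k 1 x)"
    have "((\<lambda>x::real. x ^ k) has_integral ((1-\<kappa>) ^ Suc k / real (Suc k) - 0 ^ Suc k / real (Suc k))) {0..1-\<kappa>}"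
    proof (intro fundamental_theorem_of_calculus)
      fix x assume "x \<in> {0..1-\<kappa>}"
      have "((\<lambda>x. x ^ Suc k / real (Suc k)) has_real_derivative x ^ k) (at x within {0..1-\<kappa>})"
        by (rule derivative_eq_intros refl | simp)+
      thus "((\<lambda>x. x ^ Suc k / real (Suc k)) has_vector_derivative x ^ k) (at x within {0..1-\<kappa>})"
        by (simp add: has_real_derivative_iff_has_vector_derivative)
    qed (use \<kappa> in auto)
    hence "((\<lambda>x::real. x ^ k / fact k) has_integral ((1-\<kappa>) ^ Suc k / real (Suc k)) / fact k) {0..1-\<kappa>}"
      by (intro has_integral_divide) simp
    hence "((\<lambda>x::real. if x \<in> {0..1-\<kappa>} then x ^ k / fact k else 0) has_integral
              ((1-\<kappa>) ^ Suc k / real (Suc k)) / fact k) UNIV"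
      by (subst has_integral_restrict_UNIV)
    hence g: "(g has_integral (((1-\<kappa>) ^ Suc k / real (Suc k)) / fact k - 2 * \<kappa> * 1)) UNIV"
      unfolding g_def by (intro has_integral_diff has_integral_mult_right erlang_density_has_integral) auto
    have "((\<lambda>x. \<Sum>i\<le>n. a i * (erlang_density k 1 x * exp (- x) ^ i)) has_integral
                 (\<Sum>i\<le>n. a i * (1 / real (Suc i) ^ Suc k))) UNIV"
      by (intro has_integral_sum has_integral_mult_right erlang_exp_moment) auto
    with g have "((1-\<kappa>) ^ Suc k / real (Suc k)) / fact k - 2 * \<kappa> * 1 \<le>
                 (\<Sum>i\<le>n. a i * (1 / real (Suc i) ^ Suc k))"
    proof (rule has_integral_le)
      fix x :: real
      have eq: "(\<Sum>i\<le>n. a i * (erlang_density k 1 x * exp (- x) ^ i)) =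
                  erlang_density k 1 x * (\<Sum>i\<le>n. a i * exp (-x) ^ i)"
        by (simp add: sum_distrib_left mult_ac)
      show "g x \<le> (\<Sum>i\<le>n. a i * (erlang_density k 1 x * exp (- x) ^ i))"
      proof (cases "x \<ge> 0")
        case True
        have P: "(\<Sum>i\<le>n. a i * exp (-x) ^ i) \<ge> \<phi> (exp (-x)) - 2 * \<kappa>"
          using an[of "exp (-x)"] True by (auto simp: abs_less_iff)
        have er: "erlang_density k 1 x = x ^ k * exp (-x) / fact k" "erlang_density k 1 x \<ge> 0"
          using True by (simp_all add: erlang_density_def)
        have \<phi>0: "\<phi> y \<ge> 0" for y
        proof -
          have "ln (m y) \<ge> ln (exp (-1))" unfolding m_def by (subst ln_le_cancel_iff) (auto simp: less_max_iff_disj)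
          thus ?thesis unfolding \<phi>_def using m[of y] \<kappa>(2) by auto
        qed
        have "(if x \<in> {0..1-\<kappa>} then x ^ k / fact k else 0) \<le> erlang_density k 1 x * \<phi> (exp (-x))"
        proof (cases "x \<le> 1 - \<kappa>")
          case True
          hence "m (exp (-x)) = exp (-x)" using \<kappa>(2) by (simp add: m_def)
          hence "\<phi> (exp (-x)) = 1 / exp (-x)" using True \<kappa>(2) by (simp add: \<phi>_def field_simps)
          thus ?thesis using True \<open>x \<ge> 0\<close> by (simp add: er(1))
        next
          case False
          thus ?thesis using mult_nonneg_nonneg[OF er(2) \<phi>0[of "exp (-x)"]] by simp
        qed
        also have "erlang_density k 1 x * \<phi> (exp (-x)) - 2 * \<kappa> * erlang_density k 1 x
             = erlang_density k 1 x * (\<phi> (exp (-x)) - 2 * \<kappa>)" by (simp add: algebra_simps)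
        finally show ?thesis unfolding g_def eq
          using mult_left_mono[OF P er(2)] by (simp add: algebra_simps)
      qed (auto simp: g_def erlang_density_def)
    qed
    moreover have "((1-\<kappa>) ^ Suc k / real (Suc k)) / fact k = (1-\<kappa>) ^ Suc k / fact (Suc k)"
      by (simp add: field_simps)
    ultimately show "(\<Sum>i\<le>n. a i / real (Suc i) ^ Suc k) \<ge> 1 / fact (Suc k) - e"
      using \<kappa>(1) by simp
  qed
qed

text \<open>Evaluated at n^(-s), the polynomial minorant bounds the sum over n \<le> X from below by
  a combination of the series at the points (i + 1)s, each of which is governed by the assumed
  limit.\<close>

theorem karamata_lower:
  fixes b :: "nat \<Rightarrow> real"
  assumes b: "\<And>n. b n \<ge> 0"
    and sm: "\<And>s. s > 0 \<Longrightarrow> summable (\<lambda>n. b n * real n powr (-s))"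
    and lim: "((\<lambda>s. s ^ Suc k * (\<Sum>n. b n * real n powr (-s))) \<longlongrightarrow> L) (at_right 0)"
    and e: "e > 0"
  shows "\<forall>\<^sub>F X in at_top. (\<Sum>n\<in>{1..nat \<lfloor>X\<rfloor>}. b n) \<ge> (L / fact (Suc k) - e) * ln X ^ Suc k"
proof -
  define S where "S = (\<lambda>s. \<Sum>n. b n * real n powr (-s))"
  have limS: "((\<lambda>s. s ^ Suc k * S s) \<longlongrightarrow> L) (at_right 0)" using lim by (simp add: S_def)
  have "L \<ge> 0"
    by (rule tendsto_lowerbound[OF lim])
       (auto intro!: eventually_at_rightI[of 0 1] mult_nonneg_nonneg suminf_nonneg sm b)
  \<comment> \<open>The summand 1 keeps the denominator positive when L = 0, and
    \<open>L * d < e\<close> holds in every case.\<close>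
  define d where "d = e / (2 * (L + 1))"
  have d: "d > 0" using e \<open>L \<ge> 0\<close> by (simp add: d_def)
  obtain a n where a1: "\<And>x. 0 < x \<Longrightarrow> x \<le> 1 \<Longrightarrow> x * (\<Sum>i\<le>n. a i * x ^ i) \<le> (if x \<ge> exp (-1) then 1 else 0)"
    and a2: "(\<Sum>i\<le>n. a i / real (Suc i) ^ Suc k) \<ge> 1 / fact (Suc k) - d"
    using karamata_polynomial[OF d] by blast
  have lim': "((\<lambda>s. \<Sum>i\<le>n. a i * (s ^ Suc k * S (real (Suc i) * s))) \<longlongrightarrow>
                (\<Sum>i\<le>n. a i * (L / real (Suc i) ^ Suc k))) (at_right 0)"
  proof (intro tendsto_intros)
    fix i
    have "filterlim (\<lambda>s::real. real (Suc i) * s) (at_right 0) (at_right 0)"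
      by real_asymp
    hence "((\<lambda>s. (real (Suc i) * s) ^ Suc k * S (real (Suc i) * s)) \<longlongrightarrow> L) (at_right 0)"
      by (rule filterlim_compose[OF limS])
    hence "((\<lambda>s. (real (Suc i) * s) ^ Suc k * S (real (Suc i) * s) / real (Suc i) ^ Suc k)
              \<longlongrightarrow> L / real (Suc i) ^ Suc k) (at_right 0)"
      by (intro tendsto_intros) auto
    thus "((\<lambda>s. s ^ Suc k * S (real (Suc i) * s)) \<longlongrightarrow> L / real (Suc i) ^ Suc k) (at_right 0)"
      unfolding power_mult_distrib by (simp del: power_Suc of_nat_Suc)
  qed
  have "(\<Sum>i\<le>n. a i * (L / real (Suc i) ^ Suc k)) = L * (\<Sum>i\<le>n. a i / real (Suc i) ^ Suc k)"
    by (simp add: sum_distrib_left mult_ac)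
  also have "\<dots> \<ge> L * (1 / fact (Suc k) - d)"
    using a2 \<open>L \<ge> 0\<close> by (intro mult_left_mono)
  also have "L * (1 / fact (Suc k) - d) = L / fact (Suc k) - L * d" by (simp add: algebra_simps)
  finally have "(\<Sum>i\<le>n. a i * (L / real (Suc i) ^ Suc k)) \<ge> L / fact (Suc k) - L * d" .
  moreover have "L * d < e"
    using \<open>L \<ge> 0\<close> e by (simp add: d_def field_simps) (simp add: add_nonneg_pos)
  ultimately have gt: "(\<Sum>i\<le>n. a i * (L / real (Suc i) ^ Suc k)) > L / fact (Suc k) - e" by linarith
  have "filterlim (\<lambda>X::real. 1 / ln X) (at_right 0) at_top" by real_asymp
  from order_tendstoD(1)[OF filterlim_compose[OF lim' this] gt]
  have ev: "\<forall>\<^sub>F X in at_top. L / fact (Suc k) - e <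
              (\<Sum>i\<le>n. a i * ((1 / ln X) ^ Suc k * S (real (Suc i) * (1 / ln X))))" .
  show ?thesis
    using ev eventually_gt_at_top[of 1]
  proof eventually_elim
    case (elim X)
    \<comment> \<open>With this scale, n^(-s) \<ge> 1/e holds for n \<ge> 1 exactly when n \<le> X,
      so the indicator cuts the series at X.\<close>
    define s where "s = 1 / ln X"
    have s: "s > 0" using elim by (simp add: s_def)
    have "(\<Sum>i\<le>n. a i * S (real (Suc i) * s)) =
           (\<Sum>m. \<Sum>i\<le>n. a i * (b m * real m powr (- (real (Suc i) * s))))"
      unfolding S_def using s
      by (subst suminf_sum) (auto simp: suminf_mult sm intro!: summable_mult sm)
    also have "\<dots> \<le> (\<Sum>m. if m \<in> {1..nat \<lfloor>X\<rfloor>} then b m else 0)"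
    proof (rule suminf_le)
      fix m
      show "(\<Sum>i\<le>n. a i * (b m * real m powr (- (real (Suc i) * s)))) \<le>
              (if m \<in> {1..nat \<lfloor>X\<rfloor>} then b m else 0)"
      proof (cases "m = 0")
        case False
        define x where "x = real m powr (-s)"
        have x: "0 < x" "x \<le> 1" using False s by (auto simp: x_def powr_minus inverse_le_1_iff ge_one_powr_ge_zero)
        have pw: "real m powr (- (real (Suc i) * s)) = x * x ^ i" for i
          using False by (simp add: x_def powr_powr powr_add[symmetric] flip: powr_realpow power_Suc)
                         (simp add: algebra_simps)
        have "x \<ge> exp (-1) \<longleftrightarrow> ln x \<ge> -1" using x by (subst ln_ge_iff) auto
        also have "ln x = - (ln m / ln X)" using False by (simp add: x_def ln_powr s_def)
        also have "\<dots> \<ge> -1 \<longleftrightarrow> ln m \<le> ln X" using elim by (simp add: field_simps)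
        also have "\<dots> \<longleftrightarrow> m \<in> {1..nat \<lfloor>X\<rfloor>}" using False elim by (auto simp: le_nat_iff le_floor_iff)
        finally have *: "x \<ge> exp (-1) \<longleftrightarrow> m \<in> {1..nat \<lfloor>X\<rfloor>}" .
        have "(\<Sum>i\<le>n. a i * (b m * real m powr (- (real (Suc i) * s)))) =
                b m * (x * (\<Sum>i\<le>n. a i * x ^ i))"
          unfolding pw by (simp add: sum_distrib_left mult_ac)
        also have "\<dots> \<le> b m * (if x \<ge> exp (-1) then 1 else 0)"
          by (intro mult_left_mono a1 x b)
        finally show ?thesis unfolding * by (auto split: if_splits)
      qed auto
    qed (use s in \<open>auto intro!: summable_sum summable_mult sm\<close>)
    also have "\<dots> = (\<Sum>m\<in>{1..nat \<lfloor>X\<rfloor>}. b m)"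
      by (subst suminf_finite[of "{1..nat \<lfloor>X\<rfloor>}"]) auto
    finally have le: "(\<Sum>i\<le>n. a i * S (real (Suc i) * s)) \<le> (\<Sum>m\<in>{1..nat \<lfloor>X\<rfloor>}. b m)" .
    have "(L / fact (Suc k) - e) * ln X ^ Suc k \<le>
            (\<Sum>i\<le>n. a i * (s ^ Suc k * S (real (Suc i) * s))) * ln X ^ Suc k"
      using elim unfolding s_def by (intro mult_right_mono) auto
    also have "\<dots> = (\<Sum>i\<le>n. a i * S (real (Suc i) * s)) * (s * ln X) ^ Suc k"
      unfolding power_mult_distrib by (simp add: sum_distrib_left sum_distrib_right mult_ac)
    also have "s * ln X = 1" using elim by (simp add: s_def)
    finally show ?case using le by simp
  qed
qed

section \<open>Dirichlet convolutions\<close>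

text \<open>The n-th coefficient of the product of the Dirichlet series with coefficients
  \<open>f 0\<close>, ..., \<open>f (k - 1)\<close>. An indexed family allows a single factor to be
  varied.\<close>

primrec dconv :: "(nat \<Rightarrow> nat \<Rightarrow> 'a :: comm_ring_1) \<Rightarrow> nat \<Rightarrow> nat \<Rightarrow> 'a" where
  "dconv f 0 n = (if n = 1 then 1 else 0)"
| "dconv f (Suc k) n = (\<Sum>d | d dvd n. f k d * dconv f k (n div d))"

text \<open>Every number divides 0, so the recursion sums over an infinite set, where
  \<open>sum\<close> is 0 by convention.\<close>

lemma dconv_0_right [simp]: "dconv f k 0 = 0"
  by (cases k) auto

lemma dconv_cong:
  assumes "\<And>r d. r < k \<Longrightarrow> d > 0 \<Longrightarrow> f r d = g r d"
  shows "dconv f k n = dconv g k n"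
  using assms
proof (induction k arbitrary: n)
  case (Suc k)
  show ?case
  proof (cases "n = 0")
    case False
    have "f k d * dconv f k (n div d) = g k d * dconv g k (n div d)" if "d dvd n" for d
    proof -
      have "d > 0" using that False by (auto intro: dvd_pos_nat[of n])
      with Suc show ?thesis by simp
    qed
    thus ?thesis by (auto intro!: sum.cong)
  qed simp
qed simp

lemma dconv_mono:
  fixes f g :: "nat \<Rightarrow> nat \<Rightarrow> real"
  assumes "\<And>r d. r < k \<Longrightarrow> d > 0 \<Longrightarrow> 0 \<le> f r d \<and> f r d \<le> g r d"
  shows "0 \<le> dconv f k n \<and> dconv f k n \<le> dconv g k n"
  using assms
proof (induction k arbitrary: n)
  case (Suc k)
  show ?case
  proof (cases "n = 0")
    case False
    have "0 \<le> f k d * dconv f k (n div d) \<and> f k d * dconv f k (n div d) \<le> g k d * dconv g k (n div d)"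
      if "d dvd n" for d
    proof -
      have "d > 0" using that False by (auto intro: dvd_pos_nat[of n])
      hence "0 \<le> f k d" "f k d \<le> g k d" using Suc.prems[of k d] by auto
      moreover have "0 \<le> dconv f k (n div d)" "dconv f k (n div d) \<le> dconv g k (n div d)"
        using Suc.IH[of "n div d"] Suc.prems by simp_all
      ultimately show ?thesis by (auto intro!: mult_mono)
    qed
    thus ?thesis by (auto intro!: sum_nonneg sum_mono)
  qed auto
qed auto

text \<open>Each factor enters the recursion linearly. This is what lets a difference quotient in
  one shift act on a single factor.\<close>

lemma dconv_fun_upd_linear:
  assumes "r < k"
  shows "dconv (f(r := \<lambda>d. a * g d + b * h d)) k n = a * dconv (f(r := g)) k n + b * dconv (f(r := h)) k n"
  using assms
proof (induction k arbitrary: n)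
  case (Suc k)
  show ?case
  proof (cases "r = k")
    case True
    have "dconv (f(k := q)) k m = dconv f k m" for q m
      by (intro dconv_cong) auto
    hence "dconv (f(r := q)) (Suc k) n = (\<Sum>d | d dvd n. q d * dconv f k (n div d))" for q
      unfolding True by simp
    thus ?thesis
      by (simp only: distrib_right sum.distrib sum_distrib_left mult.assoc)
  next
    case False
    with Suc have "r < k" by simp
    thus ?thesis using False Suc.IH
      by (simp add: sum_distrib_left distrib_left mult.left_commute sum.distrib)
  qed
qed auto

text \<open>Since \<psi> splits over d and n div d, every term of the convolution contains the same
  \<open>\<psi> n\<close>. With \<psi> a power of n this extracts a common shift, while the
  \<open>c r\<close> collect powers of s.\<close>

lemma dconv_twist:
  assumes \<psi>: "\<psi> 1 = 1" "\<And>m n. m > 0 \<Longrightarrow> n > 0 \<Longrightarrow> \<psi> (m * n) = \<psi> m * \<psi> n"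
    and "n > 0"
  shows "dconv (\<lambda>r d. c r * f r d * \<psi> d) k n = (\<Prod>r<k. c r) * dconv f k n * \<psi> n"
  using \<open>n > 0\<close>
proof (induction k arbitrary: n)
  case (Suc k)
  have "c k * f k d * \<psi> d * dconv (\<lambda>r d. c r * f r d * \<psi> d) k (n div d) =
          (c k * (\<Prod>r<k. c r) * \<psi> n) * (f k d * dconv f k (n div d))" if "d dvd n" for d
  proof -
    from that obtain e where e: "n = d * e" by auto
    with Suc.prems have "d > 0" "e > 0" by auto
    with Suc.IH[of e] \<psi>(2)[of d e] show ?thesis by (simp add: e mult_ac)
  qed
  hence "dconv (\<lambda>r d. c r * f r d * \<psi> d) (Suc k) n =
          (\<Sum>d | d dvd n. (c k * (\<Prod>r<k. c r) * \<psi> n) * (f k d * dconv f k (n div d)))"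
    by (auto intro!: sum.cong)
  also have "\<dots> = (c k * (\<Prod>r<k. c r) * \<psi> n) * dconv f (Suc k) n"
    by (simp add: sum_distrib_left)
  finally show ?case by (simp add: mult_ac)
qed (use \<psi> in auto)

lemma dconv_of_real: "dconv (\<lambda>r d. of_real (f r d) :: complex) k n = of_real (dconv f k n)"
  by (induction k arbitrary: n) auto

lemma sum_divisors_mult_coprime:
  fixes m n :: nat
  assumes "coprime m n" "m > 0" "n > 0"
  shows "(\<Sum>d | d dvd m * n. g d) = (\<Sum>d | d dvd m. \<Sum>e | e dvd n. g (d * e))"
proof -
  have "inj_on (\<lambda>(d,e). d * e) ({d. d dvd m} \<times> {e. e dvd n})"
  proof (intro inj_onI; clarify)
    fix d e d' e' assume *: "d dvd m" "e dvd n" "d' dvd m" "e' dvd n" "d * e = d' * e'"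
    have c: "coprime d e'" "coprime d' e" 
      using * assms(1) by (meson coprime_divisors)+
    have "d dvd d'" "d' dvd d" using * c
      by (metis coprime_dvd_mult_left_iff dvd_triv_left)+
    hence "d = d'" by (rule dvd_antisym)
    moreover have "d > 0" using *(1) assms by (meson dvd_pos_nat)
    ultimately show "d = d' \<and> e = e'" using * by auto
  qed
  moreover have "(\<lambda>(d,e). d * e) ` ({d. d dvd m} \<times> {e. e dvd n}) = {d. d dvd m * n}"
  proof (intro equalityI subsetI)
    fix x assume "x \<in> {d. d dvd m * n}"
    then obtain d e where "x = d * e" "d dvd m" "e dvd n" using division_decomp[of x m n] by auto
    thus "x \<in> (\<lambda>(d,e). d * e) ` ({d. d dvd m} \<times> {e. e dvd n})" by auto
  qed (auto intro: mult_dvd_mono)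
  ultimately have bij: "bij_betw (\<lambda>(d,e). d * e) ({d. d dvd m} \<times> {e. e dvd n}) {d. d dvd m * n}"
    by (simp add: bij_betw_def)
  show ?thesis using sum.reindex_bij_betw[OF bij, of g]
    by (simp add: sum.cartesian_product case_prod_unfold)
qed

text \<open>A divisor of m n splits into divisors of m and of n with coprime cofactors, so the
  induction hypothesis applies to the cofactors and the double sum factors.\<close>

lemma dconv_mult_coprime:
  assumes f: "\<And>r m n. r < k \<Longrightarrow> m > 0 \<Longrightarrow> n > 0 \<Longrightarrow> f r (m * n) = f r m * f r n"
    and mn: "coprime m n" "m > 0" "n > 0"
  shows "dconv f k (m * n) = dconv f k m * dconv f k n"
  using mn f
proof (induction k arbitrary: m n)
  case (Suc k)
  have "dconv f (Suc k) (m * n) =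
          (\<Sum>d | d dvd m. \<Sum>e | e dvd n. f k (d * e) * dconv f k (m * n div (d * e)))"
    using Suc.prems by (simp add: sum_divisors_mult_coprime)
  also have "\<dots> = (\<Sum>d | d dvd m. \<Sum>e | e dvd n.
                  (f k d * dconv f k (m div d)) * (f k e * dconv f k (n div e)))"
  proof (intro sum.cong refl; clarify)
    fix d e assume "d dvd m" "e dvd n"
    then obtain m' n' where m': "m = d * m'" and n': "n = e * n'" by (auto elim!: dvdE)
    from Suc.prems m' n' have pos: "d > 0" "e > 0" "m' > 0" "n' > 0" by auto
    have "coprime m' n'" using Suc.prems(1) m' n' by auto
    hence "dconv f k (m' * n') = dconv f k m' * dconv f k n'" using pos Suc.prems by (intro Suc.IH) auto
    moreover have "m * n div (d * e) = m' * n'" "m div d = m'" "n div e = n'" using pos by (simp_all add: m' n')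
    moreover have "f k (d * e) = f k d * f k e" using pos Suc.prems by auto
    ultimately show "f k (d * e) * dconv f k (m * n div (d * e)) =
       (f k d * dconv f k (m div d)) * (f k e * dconv f k (n div e))" by simp
  qed
  also have "\<dots> = dconv f (Suc k) m * dconv f (Suc k) n"
    by (simp add: sum_product)
  finally show ?case .
qed auto

text \<open>Complete homogeneous symmetric polynomials of degree \<open>l\<close> in \<open>u 0, \<dots>, u (k - 1)\<close>.\<close>

primrec hsym :: "(nat \<Rightarrow> 'a :: comm_ring_1) \<Rightarrow> nat \<Rightarrow> nat \<Rightarrow> 'a" where
  "hsym u 0 l = (if l = 0 then 1 else 0)"
| "hsym u (Suc k) l = (\<Sum>i\<le>l. u k ^ i * hsym u k (l - i))"

text \<open>The divisors of p^l are the powers p^i, so the convolution becomes the Cauchy product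
  that defines \<open>hsym\<close>.\<close>

lemma dconv_prime_power:
  fixes p :: nat
  assumes p: "prime p" and f: "\<And>r i. r < k \<Longrightarrow> f r (p ^ i) = f r p ^ i"
  shows "dconv f k (p ^ l) = hsym (\<lambda>r. f r p) k l"
  using f
proof (induction k arbitrary: l)
  case 0
  show ?case using p by (auto simp: prime_gt_1_nat)
next
  case (Suc k)
  have eq: "{d. d dvd p ^ l} = (\<lambda>i. p ^ i) ` {..l}"
    using p by (auto simp: divides_primepow_nat)
  have "inj_on (\<lambda>i. p ^ i) {..l}"
    using prime_gt_1_nat[OF p] by (intro inj_onI) (simp add: power_inject_exp)
  hence "dconv f (Suc k) (p ^ l) = (\<Sum>i\<le>l. f k (p ^ i) * dconv f k (p ^ l div p ^ i))"
    by (simp add: eq sum.reindex)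
  also have "\<dots> = (\<Sum>i\<le>l. f k p ^ i * hsym (\<lambda>r. f r p) k (l - i))"
  proof (intro sum.cong refl)
    fix i assume "i \<in> {..l}"
    hence "p ^ l div p ^ i = p ^ (l - i)"
      using prime_gt_0_nat[OF p] by (simp add: power_diff)
    thus "f k (p ^ i) * dconv f k (p ^ l div p ^ i) = f k p ^ i * hsym (\<lambda>r. f r p) k (l - i)"
      using Suc by simp
  qed
  finally show ?case by simp
qed

lemma hsym_0_right [simp]: "hsym u k 0 = 1"
  by (induction k) auto

lemma hsym_1_right: "hsym u k (Suc 0) = (\<Sum>r<k. u r)"
  by (induction k) (auto simp: numeral_2_eq_2)

lemma hsym_mono:
  fixes u w :: "nat \<Rightarrow> real"
  assumes "\<And>r. r < k \<Longrightarrow> 0 \<le> u r \<and> u r \<le> w r"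
  shows "0 \<le> hsym u k l \<and> hsym u k l \<le> hsym w k l"
  using assms
proof (induction k arbitrary: l)
  case (Suc k)
  hence IH: "0 \<le> hsym u k l \<and> hsym u k l \<le> hsym w k l" for l by simp
  have "0 \<le> u k" "u k \<le> w k" using Suc.prems by auto
  with IH show ?case by (auto intro!: sum_nonneg sum_mono mult_mono power_mono)
qed auto

text \<open>At all ones \<open>hsym\<close> counts the monomials of degree l in k + 1 variables;
  this is the source of the binomials in \<open>arith_factor\<close>.\<close>

lemma hsym_one: "hsym (\<lambda>_. 1 :: real) (Suc k) l = real ((l + k) choose k)"
proof (induction k arbitrary: l)
  case 0
  have "(\<Sum>i\<le>l. hsym (\<lambda>_. 1 :: real) 0 (l - i)) = (\<Sum>i\<in>{l}. 1)"
    by (rule sum.mono_neutral_cong_right) auto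
  thus ?case by simp
next
  case (Suc k)
  have "hsym (\<lambda>_. 1 :: real) (Suc (Suc k)) l = (\<Sum>i\<le>l. real ((l - i + k) choose k))"
    using Suc by (simp add: hsym.simps(2)[of _ "Suc k"] del: hsym.simps)
  also have "\<dots> = (\<Sum>i\<le>l. real ((k + i) choose k))"
    by (rule sum.reindex_bij_witness[of _ "\<lambda>i. l - i" "\<lambda>i. l - i"]) (auto simp: add_ac)
  also have "\<dots> = real (\<Sum>i\<le>l. (k + i) choose k)" by simp
  also have "(\<Sum>i\<le>l. (k + i) choose k) = (\<Sum>i\<le>l. (k + i) choose i)"
  proof (intro sum.cong refl)
    fix i show "(k + i) choose k = (k + i) choose i" by (subst binomial_symmetric) auto
  qed
  also have "\<dots> = Suc (k + l) choose l" by (rule sum_choose_lower)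
  also have "\<dots> = (l + Suc k) choose (Suc k)"
    by (subst binomial_symmetric) (auto simp: add_ac)
  finally show ?case .
qed

lemma continuous_on_hsym [continuous_intros]:
  fixes u :: "nat \<Rightarrow> 'b :: topological_space \<Rightarrow> real"
  assumes "\<And>r. r < k \<Longrightarrow> continuous_on A (u r)"
  shows "continuous_on A (\<lambda>x. hsym (\<lambda>r. u r x) k l)"
  using assms by (induction k arbitrary: l) (auto intro!: continuous_intros)

section \<open>Euler products of multiplicative functions\<close>

lemma has_sum_mult_Times:
  fixes f :: "'a \<Rightarrow> 'c :: {real_normed_field, banach, second_countable_topology}"
  assumes "(\<lambda>x. norm (f x)) summable_on A" "(\<lambda>y. norm (g y)) summable_on B" "(f has_sum a) A" "(g has_sum b) B"
  shows "(\<lambda>(x,y). norm (f x * g y)) summable_on A \<times> B"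
    and "((\<lambda>(x,y). f x * g y) has_sum a * b) (A \<times> B)"
proof -
  show *: "(\<lambda>(x,y). norm (f x * g y)) summable_on A \<times> B"
    using assms(1,2) Infinite_Sum.abs_summable_on_Sigma_iff[where f = "\<lambda>(x,y). f x * g y" and A = A and B = "\<lambda>_. B"]
    by (auto simp: case_prod_unfold norm_mult abs_mult infsum_cmult_right' intro!: summable_on_cmult_right summable_on_cmult_left)
  show "((\<lambda>(x,y). f x * g y) has_sum a * b) (A \<times> B)"
  proof (rule has_sum_SigmaI)
    show "((\<lambda>y. (\<lambda>(x,y). f x * g y) (x, y)) has_sum f x * b) B" for x
      using has_sum_cmult_right[OF assms(4), of "f x"] by simp
    show "((\<lambda>x. f x * b) has_sum a * b) A"
      by (rule has_sum_cmult_left[OF assms(3)])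
    show "(\<lambda>(x, y). f x * g y) summable_on A \<times> B"
      by (rule abs_summable_summable) (use * in \<open>simp add: case_prod_unfold\<close>)
  qed
qed

lemma has_sum_mult_Times_real:
  fixes f :: "'a \<Rightarrow> real"
  assumes "(f has_sum a) A" "(g has_sum b) B"
  shows "((\<lambda>(x,y). f x * g y) has_sum a * b) (A \<times> B)"
  using assms summable_on_iff_abs_summable_on_real[THEN iffD1, OF has_sum_imp_summable[OF assms(1)]]
    summable_on_iff_abs_summable_on_real[THEN iffD1, OF has_sum_imp_summable[OF assms(2)]]
  by (rule has_sum_mult_Times(2)[rotated 2])

definition euler_factor :: "(nat \<Rightarrow> real) \<Rightarrow> nat \<Rightarrow> real" where
  "euler_factor F p = (if prime p then \<Sum>l. F (p ^ l) else 1)"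

context
  fixes F :: "nat \<Rightarrow> real"
  assumes nonneg: "\<And>n. F n \<ge> 0" and F0: "F 0 = 0" and F1: "F 1 = 1"
    and mult: "\<And>m n. coprime m n \<Longrightarrow> m > 0 \<Longrightarrow> n > 0 \<Longrightarrow> F (m * n) = F m * F n"
    and sm: "\<And>p. prime p \<Longrightarrow> summable (\<lambda>l. F (p ^ l))"
begin

lemma euler_factor_ge_1: "euler_factor F p \<ge> 1"
proof (cases "prime p")
  case True
  have "(\<Sum>l\<in>{0}. F (p ^ l)) \<le> (\<Sum>l. F (p ^ l))"
    by (intro sum_le_suminf sm True) (auto simp: nonneg)
  thus ?thesis using True F1 by (simp add: euler_factor_def)
qed (auto simp: euler_factor_def)

lemma smooth_numbers_has_sum:
  "(F has_sum (\<Prod>p<Q. euler_factor F p)) {n. n > 0 \<and> (\<forall>p. prime p \<longrightarrow> p dvd n \<longrightarrow> p < Q)}"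
proof (induction Q)
  case 0
  have "{n :: nat. n > 0 \<and> (\<forall>p. prime p \<longrightarrow> p dvd n \<longrightarrow> p < 0)} = {1}"
    using prime_factor_nat by (auto intro: ccontr)
  thus ?case using has_sum_finite[of "{1}" F] F1 by simp
next
  case (Suc Q)
  let ?A = "\<lambda>Q. {n :: nat. n > 0 \<and> (\<forall>p. prime p \<longrightarrow> p dvd n \<longrightarrow> p < Q)}"
  show ?case
  proof (cases "prime Q")
    case False
    hence "?A (Suc Q) = ?A Q" by (auto simp: less_Suc_eq)
    thus ?thesis using Suc False by (simp add: euler_factor_def)
  next
    case True
    have cop: "coprime (Q ^ l) m" if "m \<in> ?A Q" for l m
      using that True by (intro coprime_power_left_iff[THEN iffD2] disjI1 prime_imp_coprime) auto
    have "((\<lambda>l. F (Q ^ l)) has_sum euler_factor F Q) UNIV"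
      unfolding euler_factor_def using True sm[OF True]
      by (auto intro!: sums_nonneg_imp_has_sum summable_sums simp: nonneg)
    from has_sum_mult_Times_real[OF this Suc]
    have "((\<lambda>(l,m). F (Q ^ l) * F m) has_sum (euler_factor F Q * (\<Prod>p<Q. euler_factor F p))) (UNIV \<times> ?A Q)"
      by auto
    also have "?this \<longleftrightarrow> (F has_sum (euler_factor F Q * (\<Prod>p<Q. euler_factor F p))) (?A (Suc Q))"
    proof (rule has_sum_reindex_bij_witness[where j = "\<lambda>(l,m). Q ^ l * m"
              and i = "\<lambda>n. (multiplicity Q n, n div Q ^ multiplicity Q n)"])
      fix a :: "nat \<times> nat" assume "a \<in> UNIV \<times> ?A Q"
      then obtain l m where a: "a = (l, m)" "m \<in> ?A Q" by auto
      have "\<not> Q dvd m" using a(2) True by auto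
      hence "multiplicity Q (Q ^ l * m) = l"
        using True a(2) by (subst prime_elem_multiplicity_mult_distrib)
             (auto simp: not_dvd_imp_multiplicity_0 multiplicity_same_power prime_gt_0_nat)
      thus "(multiplicity Q (case a of (l,m) \<Rightarrow> Q ^ l * m), (case a of (l,m) \<Rightarrow> Q ^ l * m) div
              Q ^ multiplicity Q (case a of (l,m) \<Rightarrow> Q ^ l * m)) = a"
        using True by (simp add: a(1) prime_gt_0_nat)
      show "(case a of (l,m) \<Rightarrow> Q ^ l * m) \<in> ?A (Suc Q)"
      proof -
        have "p = Q" if "prime p" "p dvd Q ^ l" for p
          using prime_dvd_power[OF that] primes_dvd_imp_eq[OF that(1) True] by simp
        thus ?thesis using a True by (auto simp: prime_dvd_mult_iff prime_gt_0_nat less_Suc_eq)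
      qed
      show "F (case a of (l,m) \<Rightarrow> Q ^ l * m) = (case a of (l,m) \<Rightarrow> F (Q ^ l) * F m)"
        using mult[OF cop[OF a(2)], of l] a True by (auto simp: prime_gt_0_nat)
    next
      fix n assume n: "n \<in> ?A (Suc Q)"
      have d: "Q ^ multiplicity Q n dvd n" by (rule multiplicity_dvd)
      then obtain m where m: "n = Q ^ multiplicity Q n * m" by (elim dvdE)
      have [simp]: "n div Q ^ multiplicity Q n = m" using m True
        by (metis True nonzero_mult_div_cancel_left not_prime_0 power_not_zero)
      have "\<not> Q dvd m"
        using n True multiplicity_decompose[of n Q] prime_gt_1_nat[OF True] by auto
      moreover have "p < Suc Q" if "prime p" "p dvd m" for p
        using n that m by (metis (mono_tags, lifting) dvd_mult mem_Collect_eq)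
      moreover have "m > 0" using m n by (auto intro: ccontr)
      ultimately show "(multiplicity Q n, n div Q ^ multiplicity Q n) \<in> UNIV \<times> ?A Q"
        by (auto simp: less_Suc_eq)
      show "(case (multiplicity Q n, n div Q ^ multiplicity Q n) of (l,m) \<Rightarrow> Q ^ l * m) = n"
        using m by simp
    qed auto
    finally show ?thesis by (simp add: mult_ac)
  qed
qed

lemma sum_le_euler_prod: "(\<Sum>n<Q. F n) \<le> (\<Prod>p<Q. euler_factor F p)"
proof -
  have "(\<Sum>n<Q. F n) = (\<Sum>n\<in>{1..<Q}. F n)"
    by (rule sum.mono_neutral_right) (auto simp: F0 not_le less_Suc_eq)
  also have "\<dots> \<le> (\<Prod>p<Q. euler_factor F p)"
    by (rule has_sum_mono2[OF has_sum_finite smooth_numbers_has_sum])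
       (auto simp: nonneg dest: dvd_imp_le)
  finally show ?thesis .
qed

text \<open>The products increase to L and dominate all partial sums, so summability is a
  conclusion. This direction serves the shifted series, whose product is shown to converge
  beforehand.\<close>

lemma euler_prod_sums:
  assumes "(\<lambda>Q. \<Prod>p<Q. euler_factor F p) \<longlonglongrightarrow> L"
  shows "F sums L"
proof -
  have mono: "mono (\<lambda>Q. \<Prod>p<Q. euler_factor F p)"
    by (intro monoI prod_mono2) (auto intro: euler_factor_ge_1 order_trans[OF zero_le_one])
  have le: "(\<Prod>p<Q. euler_factor F p) \<le> L" for Q
    by (rule incseq_le[OF mono assms])
  have sF: "summable F"
    using order_trans[OF sum_le_euler_prod le] by (intro summableI_nonneg_bounded nonneg)
  have "suminf F \<le> L"
    using order_trans[OF sum_le_euler_prod le] by (intro suminf_le_const sF)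
  moreover have "L \<le> suminf F"
  proof (rule LIMSEQ_le_const2[OF assms], intro exI allI impI)
    fix Q
    have "(F has_sum suminf F) UNIV"
      by (intro sums_nonneg_imp_has_sum summable_sums sF nonneg)
    thus "(\<Prod>p<Q. euler_factor F p) \<le> suminf F"
      by (intro has_sum_mono2[OF smooth_numbers_has_sum]) (auto simp: nonneg)
  qed
  ultimately show ?thesis using sF by (simp add: sums_iff)
qed

text \<open>The opposite direction, for a series already known to converge: the product lies between
  the partial sum below Q and the full sum. It serves zeta itself.\<close>

lemma euler_prod_tendsto:
  assumes "summable F"
  shows "(\<lambda>Q. \<Prod>p<Q. euler_factor F p) \<longlonglongrightarrow> suminf F"
proof (rule tendsto_sandwich)
  show "\<forall>\<^sub>F Q in sequentially. (\<Prod>p<Q. euler_factor F p) \<le> suminf F"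
  proof (intro always_eventually allI)
    fix Q
    have "(F has_sum suminf F) UNIV"
      by (intro sums_nonneg_imp_has_sum summable_sums assms nonneg)
    thus "(\<Prod>p<Q. euler_factor F p) \<le> suminf F"
      by (intro has_sum_mono2[OF smooth_numbers_has_sum]) (auto simp: nonneg)
  qed
  show "\<forall>\<^sub>F Q in sequentially. (\<Sum>n<Q. F n) \<le> (\<Prod>p<Q. euler_factor F p)"
    by (intro always_eventually allI sum_le_euler_prod)
qed (use assms in \<open>auto intro: summable_LIMSEQ\<close>)

end

section \<open>The zeta function near 1\<close>

text \<open>The case m = 0 of the Taylor identity, carried from Re s > 1 to Re s > 0 by analytic
  continuation. At s = 1 the left side is 0 through its first factor, whereas the continued
  expression has the value 1, the residue.\<close>

lemma zeta_eq_taylor: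
  assumes "Re s > 0"
  shows "(s - 1) * riemann_zeta s = (if s = 1 then 0 else 1 + (\<Sum>n. zeta_taylor_term 1 n s))"
proof (cases "s = 1")
  case False
  let ?h = "\<lambda>s. 1 + (\<Sum>n. zeta_taylor_term 1 n s)"
  have hol: "?h holomorphic_on {s. Re s > 0}"
    using zeta_taylor_holomorphic(1)[of 0] by (intro holomorphic_intros) simp
  have op: "open {s::complex. Re s > a}" for a by (rule open_halfspace_Re_gt)
  have "(s - 1) * riemann_zeta s = ?h s"
  proof (rule analytic_continuation_open[of "{s. Re s > 1}" "{s. Re s > 0} - {1}"
              "\<lambda>s. (s - 1) * riemann_zeta s" ?h])
    show "open ({s::complex. Re s > 0} - {1})" by (intro open_Diff op) auto
    show "{s::complex. Re s > 1} \<noteq> {}" by (auto intro!: exI[of _ 2])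
    show "connected ({s::complex. Re s > 0} - {1})"
      by (intro connected_open_delete convex_connected convex_halfspace_Re_gt op) auto
    show "(\<lambda>s. (s - 1) * riemann_zeta s) holomorphic_on {s. Re s > 0} - {1}"
      by (intro holomorphic_intros holomorphic_on_subset[OF riemann_zeta_props(1)]) auto
    show "?h holomorphic_on {s. Re s > 0} - {1}"
      by (rule holomorphic_on_subset[OF hol]) auto
    fix z :: complex assume "z \<in> {s. Re s > 1}"
    thus "(z - 1) * riemann_zeta z = ?h z"
      using zeta_taylor_sum[of z 0] sums_unique[OF riemann_zeta_props(3)[of z]] by simp
  qed (use assms False op in auto)
  thus ?thesis using False by simp
qed simp

lemma summable_zeta_real: "\<theta> > 0 \<Longrightarrow> summable (\<lambda>n. real n powr (- 1 - \<theta>))"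
  by (simp add: summable_real_powr_iff)

text \<open>The continued function (s - 1) \<zeta>(s) is continuous at s = 1, and all its Taylor
  terms vanish there, leaving the value 1.\<close>

lemma zeta_real_tendsto: "((\<lambda>\<theta>. \<theta> * (\<Sum>n. real n powr (- 1 - \<theta>))) \<longlongrightarrow> 1) (at_right 0)"
proof -
  define h where "h = (\<lambda>s. 1 + (\<Sum>n. zeta_taylor_term 1 n s))"
  have "h holomorphic_on {s. Re s > 0}"
    using zeta_taylor_holomorphic(1)[of 0] unfolding h_def by (intro holomorphic_intros) simp
  hence "continuous_on {s. Re s > 0} h" by (rule holomorphic_on_imp_continuous_on)
  hence "isCont h 1" by (rule continuous_on_interior) (auto simp: interior_open open_halfspace_Re_gt)
  moreover have "((\<lambda>\<theta>::real. 1 + of_real \<theta>) \<longlongrightarrow> (1 + of_real 0 :: complex)) (at_right 0)"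
    by (intro tendsto_intros)
  ultimately have "((\<lambda>\<theta>::real. h (1 + of_real \<theta>)) \<longlongrightarrow> h 1) (at_right 0)"
    by (intro isCont_tendsto_compose[of 1 h]) auto
  moreover have "zeta_taylor_term 1 n 1 = 0" for n
    using of_nat_neq_0[of n, where ?'a = complex] of_nat_neq_0[of "Suc n", where ?'a = complex]
    by (simp add: zeta_taylor_term_def del: of_nat_Suc)
  hence "h 1 = 1" by (simp add: h_def)
  ultimately have lim: "((\<lambda>\<theta>::real. Re (h (1 + of_real \<theta>))) \<longlongrightarrow> 1) (at_right 0)"
    using tendsto_Re by fastforce
  have "Re (h (1 + of_real \<theta>)) = \<theta> * (\<Sum>n. real n powr (- 1 - \<theta>))" if \<theta>: "\<theta> > 0" for \<theta>
  proof -
    have "(\<lambda>n. real (Suc n) powr (- 1 - \<theta>)) sums (\<Sum>n. real n powr (- 1 - \<theta>))"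
      using summable_sums[OF summable_zeta_real[OF \<theta>]] by (subst sums_Suc_iff) simp
    hence "(\<lambda>n. complex_of_real (real (Suc n) powr (- 1 - \<theta>))) sums of_real (\<Sum>n. real n powr (- 1 - \<theta>))"
      by (rule sums_of_real)
    also have "(\<lambda>n. complex_of_real (real (Suc n) powr (- 1 - \<theta>))) = (\<lambda>n. of_nat (Suc n) powr - (1 + of_real \<theta>))"
      by (subst powr_of_real[symmetric]) (auto simp: algebra_simps)
    finally have "riemann_zeta (1 + of_real \<theta>) = of_real (\<Sum>n. real n powr (- 1 - \<theta>))"
      using riemann_zeta_props(3)[of "1 + of_real \<theta>"] \<theta> by (intro sums_unique2) auto
    with zeta_eq_taylor[of "1 + of_real \<theta>"] \<theta>
    have "h (1 + of_real \<theta>) = of_real (\<theta> * (\<Sum>n. real n powr (- 1 - \<theta>)))"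
      by (simp add: h_def)
    thus ?thesis by simp
  qed
  hence "\<forall>\<^sub>F \<theta> in at_right 0. Re (h (1 + of_real \<theta>)) = \<theta> * (\<Sum>n. real n powr (- 1 - \<theta>))"
    by (intro eventually_at_rightI[of 0 1]) auto
  with lim show ?thesis by (rule Lim_transform_eventually)
qed

lemma zeta_euler_prod:
  assumes "\<theta> > 0"
  shows "(\<lambda>Q. \<Prod>p<Q. if prime p then 1 / (1 - real p powr (- \<theta>) / real p) else 1)
           \<longlonglongrightarrow> (\<Sum>n. real n powr (- 1 - \<theta>))"
proof -
  define F where "F = (\<lambda>n. real n powr (- 1 - \<theta>))"
  have pw: "F (p ^ l) = (real p powr (- \<theta>) / real p) ^ l" if "prime p" for p l
  proof -
    have p: "real p > 0" using prime_gt_0_nat[OF that] by simp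
    have "real p powr (- \<theta>) / real p = real p powr (- 1 - \<theta>)"
      using p by (simp add: powr_diff powr_minus field_simps)
    thus ?thesis using p
      by (simp add: F_def powr_powr mult.commute flip: powr_realpow)
  qed
  have lt: "real p powr (- \<theta>) / real p < 1" if "prime p" for p
  proof -
    have "real p powr (- \<theta>) \<le> real p powr 0"
      using prime_gt_0_nat[OF that] assms by (intro powr_mono) auto
    also have "\<dots> < real p" using prime_gt_1_nat[OF that] by auto
    finally show ?thesis using prime_gt_0_nat[OF that] by simp
  qed
  have "(\<lambda>Q. \<Prod>p<Q. euler_factor F p) \<longlonglongrightarrow> suminf F"
  proof (rule euler_prod_tendsto)
    show "summable F" unfolding F_def by (rule summable_zeta_real[OF assms])
    show "summable (\<lambda>l. F (p ^ l))" if "prime p" for p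
      unfolding pw[OF that] using lt[OF that] by (intro summable_geometric) simp
    show "F (m * n) = F m * F n" for m n
      by (simp add: F_def powr_mult)
  qed (auto simp: F_def)
  moreover have "euler_factor F p = (if prime p then 1 / (1 - real p powr (- \<theta>) / real p) else 1)" for p
    using lt[of p] by (simp add: euler_factor_def pw suminf_geometric)
  ultimately show ?thesis by (simp add: F_def)
qed

text \<open>A second-order Bonferroni bound. Adding a factor 1 - a turns the remainder R into R(1 -
  a) + a S, with S the old sum, so it stays between 0 and the square of the new sum.\<close>

lemma prod_one_minus_bounds:
  fixes a :: "'i \<Rightarrow> real"
  assumes "finite A" "\<And>i. i \<in> A \<Longrightarrow> 0 \<le> a i \<and> a i \<le> 1"
  shows "0 \<le> (\<Prod>i\<in>A. 1 - a i) - 1 + (\<Sum>i\<in>A. a i) \<and>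
         (\<Prod>i\<in>A. 1 - a i) - 1 + (\<Sum>i\<in>A. a i) \<le> (\<Sum>i\<in>A. a i) ^ 2"
  using assms
proof (induction A rule: finite_induct)
  case (insert i A)
  define S where "S = (\<Sum>i\<in>A. a i)"
  define R where "R = (\<Prod>i\<in>A. 1 - a i) - 1 + S"
  have a: "0 \<le> a i" "a i \<le> 1" and R: "0 \<le> R" "R \<le> S ^ 2"
    using insert by (auto simp: R_def S_def)
  have S: "S \<ge> 0" unfolding S_def using insert.prems by (intro sum_nonneg) auto
  have eq: "(\<Prod>i\<in>insert i A. 1 - a i) - 1 + (\<Sum>i\<in>insert i A. a i) = R * (1 - a i) + a i * S"
    using insert.hyps by (simp add: R_def S_def algebra_simps)
  have "R * (1 - a i) \<le> S ^ 2 * 1" using a R by (intro mult_mono) auto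
  moreover have "a i * S \<ge> 0" "R * (1 - a i) \<ge> 0" using a R S by auto
  moreover have "(\<Sum>i\<in>insert i A. a i) ^ 2 = S ^ 2 + 2 * (a i * S) + a i ^ 2"
    using insert.hyps by (simp add: S_def power2_sum)
  ultimately show ?case unfolding eq by (smt (verit) zero_le_power2)
qed auto

text \<open>The squared binomial is polynomially bounded in l; passing from base 1/2 to base 3/4
  absorbs the polynomial.\<close>

lemma summable_choose_power:
  fixes z :: real
  assumes "0 \<le> z" "z \<le> 1 / 2"
  shows "summable (\<lambda>l. real ((l + k) choose k) ^ 2 * z ^ l)"
proof (rule summable_comparison_test_bigo)
  show "summable (\<lambda>l. norm ((3 / 4 :: real) ^ l))" by (simp add: summable_geometric)
  have 1: "real ((l + k) choose k) \<le> real (l + k + 1) ^ k" for l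
  proof -
    have "(l + k) choose k \<le> ((l + k) choose k) * fact k" by (simp add: fact_ge_1)
    also have "\<dots> \<le> (l + k) ^ k" by (rule binomial_fact_pow)
    also have "\<dots> \<le> (l + k + 1) ^ k" by (intro power_mono) auto
    finally show ?thesis by (metis of_nat_le_iff of_nat_power)
  qed
  have "(\<lambda>l. real ((l + k) choose k) ^ 2 * z ^ l) \<in> O(\<lambda>l. (real (l + k + 1) ^ k) ^ 2 * (1 / 2) ^ l)"
  proof (intro landau_o.big_mono always_eventually allI)
    fix l
    have "real ((l + k) choose k) ^ 2 * z ^ l \<le> (real (l + k + 1) ^ k) ^ 2 * (1 / 2) ^ l"
      using assms 1[of l] by (intro mult_mono power_mono) auto
    thus "norm (real ((l + k) choose k) ^ 2 * z ^ l) \<le> norm ((real (l + k + 1) ^ k) ^ 2 * (1 / 2) ^ l)"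
      using assms by simp
  qed
  also have "(\<lambda>l. (real (l + k + 1) ^ k) ^ 2 * (1 / 2) ^ l) \<in> O(\<lambda>l. (3 / 4 :: real) ^ l)"
    by real_asymp
  finally show "(\<lambda>l. real ((l + k) choose k) ^ 2 * z ^ l) \<in> O(\<lambda>l. (3 / 4 :: real) ^ l)" .
qed

section \<open>The shifted Euler product\<close>

lemma dconv_1: "dconv f k (Suc 0) = (\<Prod>r<k. f r (Suc 0))"
  by (induction k) (auto simp: mult_ac)

context
  fixes k :: nat and x y :: "nat \<Rightarrow> real"
  assumes x: "\<And>r. x r > 0" and y: "\<And>r. y r > 0"
begin

definition local_term :: "real \<Rightarrow> nat \<Rightarrow> nat \<Rightarrow> real" where
  "local_term s p l = hsym (\<lambda>r. real p powr (- (s * x r))) (Suc k) l *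
     hsym (\<lambda>r. real p powr (- (s * y r))) (Suc k) l * (1 / real p) ^ l"

text \<open>The Euler factor at \<open>p\<close>, divided by that of the product of the \<open>\<zeta>(1 + s (x\<^sub>r + y\<^sub>q))\<close>.\<close>

definition local_ratio :: "nat \<Rightarrow> real \<Rightarrow> real" where
  "local_ratio p s = (if prime p then (\<Sum>l. local_term s p l) *
     (\<Prod>(r,q)\<in>{..<Suc k} \<times> {..<Suc k}. 1 - real p powr (- (s * (x r + y q))) / real p) else 1)"

lemma powr_unit:
  assumes "prime p" "s \<ge> 0" "a > 0"
  shows "0 \<le> real p powr (- (s * a)) \<and> real p powr (- (s * a)) \<le> 1"
proof -
  have "real p powr (- (s * a)) \<le> real p powr 0"
    using assms prime_gt_0_nat[OF assms(1)] by (intro powr_mono) auto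
  thus ?thesis using prime_gt_0_nat[OF assms(1)] by simp
qed

text \<open>For s \<ge> 0 all powers p^(-s x) are at most 1, and \<open>hsym\<close> is monotone.
  The resulting majorant is independent of s, which is the basis of all uniformity in s.\<close>

lemma local_term_bounds:
  assumes p: "prime p" and s: "s \<ge> 0"
  shows "0 \<le> local_term s p l \<and> local_term s p l \<le> real ((l + k) choose k) ^ 2 * (1 / real p) ^ l"
proof -
  note u = hsym_mono[of "Suc k" "\<lambda>r. real p powr (- (s * x r))" "\<lambda>_. 1" l, OF powr_unit[OF p s x]]
  note w = hsym_mono[of "Suc k" "\<lambda>r. real p powr (- (s * y r))" "\<lambda>_. 1" l, OF powr_unit[OF p s y]]
  show ?thesis using u w unfolding local_term_def power2_eq_square hsym_one
    by (auto intro!: mult_mono mult_nonneg_nonneg simp del: hsym.simps)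
qed

lemma local_term_le_half:
  assumes p: "prime p" and s: "s \<ge> 0"
  shows "local_term s p l \<le> real ((l + k) choose k) ^ 2 * (1 / 2) ^ l"
proof -
  have "real ((l + k) choose k) ^ 2 * (1 / real p) ^ l \<le> real ((l + k) choose k) ^ 2 * (1 / 2) ^ l"
    using prime_ge_2_nat[OF p] by (intro mult_left_mono power_mono divide_left_mono) auto
  thus ?thesis using local_term_bounds[OF p s, of l] by linarith
qed

lemma summable_local_term: "prime p \<Longrightarrow> s \<ge> 0 \<Longrightarrow> summable (local_term s p)"
  using local_term_bounds local_term_le_half
  by (intro summable_comparison_test'[OF summable_choose_power[of "1/2" k], of 0]) auto

text \<open>The Euler factor begins with 1 + S and the inverted zeta factors begin with 1 - S, for
  the same S = O(1/p). The linear parts cancel, and an error of order 1/p^2, uniform in s down to 0,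
  remains.\<close>

lemma local_ratio_bound:
  obtains C where "\<And>p s. s \<ge> 0 \<Longrightarrow> \<bar>local_ratio p s - 1\<bar> \<le> C * (1 / real p ^ 2)"
proof -
  \<comment> \<open>Controls the terms of degree at least 2: a factor 1/p^2 is taken out, and the
    remaining powers of 1/p are bounded by powers of 1/2.\<close>
  define C1 where "C1 = (\<Sum>l. real ((l + 2 + k) choose k) ^ 2 * (1 / 2) ^ l)"
  have sm1: "summable (\<lambda>l. real ((l + 2 + k) choose k) ^ 2 * (1 / 2 :: real) ^ l)"
  proof -
    have "summable (\<lambda>l. real ((l + 2 + k) choose k) ^ 2 * (1 / 2 :: real) ^ (l + 2))"
      using summable_ignore_initial_segment[OF summable_choose_power[of "1/2" k], of 2] by simp
    from summable_mult[OF this, of 4] show ?thesis by (simp add: power_add mult_ac)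
  qed
  \<comment> \<open>The number of pairs (r, q), so that S \<le> m / p.\<close>
  define m where "m = real ((Suc k) ^ 2)"
  define C where "C = m ^ 2 * (2 + m) + C1"
  have m0: "m \<ge> 0" by (simp add: m_def)
  have C0: "C \<ge> 0" unfolding C_def C1_def using m0
    by (intro add_nonneg_nonneg mult_nonneg_nonneg suminf_nonneg sm1) auto
  have "\<bar>local_ratio p s - 1\<bar> \<le> C * (1 / real p ^ 2)" if s: "s \<ge> 0" for p s
  proof (cases "prime p")
    case False
    thus ?thesis using C0 by (simp add: local_ratio_def)
  next
    case p: True
    define z where "z = 1 / real p"
    have z: "0 \<le> z" "z \<le> 1 / 2" using prime_ge_2_nat[OF p] by (auto simp: z_def field_simps)
    define u where "u = (\<lambda>r. real p powr (- (s * x r)))"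
    define w where "w = (\<lambda>r. real p powr (- (s * y r)))"
    have u: "0 \<le> u r \<and> u r \<le> 1" and w: "0 \<le> w r \<and> w r \<le> 1" for r
      unfolding u_def w_def using powr_unit[OF p s] x y by auto
    define S where "S = (\<Sum>(r,q)\<in>{..<Suc k} \<times> {..<Suc k}. u r * w q * z)"
    define P where "P = (\<Prod>(r,q)\<in>{..<Suc k} \<times> {..<Suc k}. 1 - u r * w q * z)"
    define R where "R = (\<Sum>l. local_term s p (l + 2))"
    have uwz: "0 \<le> u r * w q * z" "u r * w q * z \<le> z" for r q
    proof -
      show "0 \<le> u r * w q * z" using u w z by simp
      have "u r * w q \<le> 1" using u w by (intro mult_le_one) auto
      thus "u r * w q * z \<le> z" using z by (intro mult_left_le_one_le) (use u w in auto)
    qed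
    have S: "0 \<le> S" "S \<le> m * z"
    proof -
      show "0 \<le> S" unfolding S_def using uwz by (intro sum_nonneg) auto
      have "S \<le> (\<Sum>(r,q)\<in>{..<Suc k} \<times> {..<Suc k}. z)" unfolding S_def
        using uwz by (intro sum_mono) auto
      also have "\<dots> = m * z" by (simp add: m_def power2_eq_square)
      finally show "S \<le> m * z" .
    qed
    have P: "0 \<le> P - 1 + S" "P - 1 + S \<le> S ^ 2" "0 \<le> P" "P \<le> 1"
    proof -
      have "0 \<le> u r * w q * z \<and> u r * w q * z \<le> 1" for r q
        using uwz[of r q] z by linarith
      thus "0 \<le> P - 1 + S" "P - 1 + S \<le> S ^ 2" "0 \<le> P" "P \<le> 1"
        unfolding P_def S_def case_prod_unfold
        using prod_one_minus_bounds[of "{..<Suc k} \<times> {..<Suc k}" "\<lambda>rq. u (fst rq) * w (snd rq) * z"]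
        by (auto intro!: prod_nonneg prod_le_1)
    qed
    have R: "0 \<le> R" "R \<le> C1 * z ^ 2"
    proof -
      have sm: "summable (\<lambda>l. local_term s p (l + 2))"
        by (rule summable_ignore_initial_segment[OF summable_local_term[OF p s]])
      show "0 \<le> R" unfolding R_def using local_term_bounds[OF p s] by (intro suminf_nonneg sm) auto
      have "R \<le> (\<Sum>l. real ((l + 2 + k) choose k) ^ 2 * (1 / 2) ^ l * z ^ 2)" unfolding R_def
      proof (rule suminf_le)
        fix l
        have "local_term s p (l + 2) \<le> real ((l + 2 + k) choose k) ^ 2 * z ^ (l + 2)"
          using local_term_bounds[OF p s, of "l + 2"] by (simp add: z_def)
        also have "\<dots> = real ((l + 2 + k) choose k) ^ 2 * z ^ l * z ^ 2"
          by (simp add: power_add mult_ac power2_eq_square)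
        also have "\<dots> \<le> real ((l + 2 + k) choose k) ^ 2 * (1 / 2) ^ l * z ^ 2"
          using z by (intro mult_right_mono mult_left_mono power_mono) auto
        finally show "local_term s p (l + 2) \<le> real ((l + 2 + k) choose k) ^ 2 * (1 / 2) ^ l * z ^ 2" .
      qed (use sm sm1 in \<open>auto intro: summable_mult2\<close>)
      also have "\<dots> = C1 * z ^ 2" unfolding C1_def by (rule suminf_mult2[OF sm1, symmetric])
      finally show "R \<le> C1 * z ^ 2" .
    qed
    have "(\<Sum>l. local_term s p l) = R + (\<Sum>l<2. local_term s p l)"
      unfolding R_def by (rule suminf_split_initial_segment[OF summable_local_term[OF p s]])
    also have "(\<Sum>l<2. local_term s p l) = 1 + S"
    proof -
      have "S = (\<Sum>r<Suc k. \<Sum>q<Suc k. u r * w q * z)"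
        unfolding S_def by (simp only: sum.cartesian_product)
      also have "\<dots> = (\<Sum>r<Suc k. u r) * (\<Sum>q<Suc k. w q) * z"
        by (subst sum_product) (simp only: sum_distrib_right)
      also have "\<dots> = local_term s p (Suc 0)"
        unfolding local_term_def hsym_1_right u_def w_def z_def by (simp only: power_one_right One_nat_def[symmetric])
      finally have "S = local_term s p (Suc 0)" .
      moreover have "local_term s p 0 = 1" by (simp add: local_term_def del: hsym.simps)
      ultimately show ?thesis by (simp add: numeral_2_eq_2)
    qed
    finally have E: "(\<Sum>l. local_term s p l) = 1 + S + R" by simp
    have "real p powr (- (s * (x r + y q))) / real p = u r * w q * z" for r q
      using prime_gt_0_nat[OF p]
      by (simp add: u_def w_def z_def powr_add[symmetric] algebra_simps)
    hence eq: "local_ratio p s = (1 + S + R) * P"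
      using p E by (simp add: local_ratio_def P_def)
    \<comment> \<open>The second-order remainder of P. Then (1 + S) P = 1 - S^2 + (1 + S) Q, in
      which no linear term survives.\<close>
    define Q where "Q = P - 1 + S"
    have "local_ratio p s - 1 = - (S ^ 2) + (1 + S) * Q + R * P"
      unfolding eq Q_def by (simp add: algebra_simps power2_eq_square)
    moreover have "0 \<le> (1 + S) * Q" "(1 + S) * Q \<le> (1 + S) * S ^ 2" "0 \<le> R * P" "R * P \<le> R * 1"
      using P S R unfolding Q_def by (auto intro!: mult_left_mono mult_left_le)
    ultimately have "\<bar>local_ratio p s - 1\<bar> \<le> S ^ 2 + (1 + S) * S ^ 2 + R"
      using zero_le_power2[of S] by linarith
    also have "\<dots> = (2 + S) * S ^ 2 + R" by (simp add: algebra_simps)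
    also have "\<dots> \<le> (2 + m) * (m * z) ^ 2 + C1 * z ^ 2"
    proof (intro add_mono mult_mono power_mono)
      have "m * z \<le> m * 1" using z m0 by (intro mult_left_mono) auto
      thus "S \<le> m" using S by simp
    qed (use S R m0 z in auto)
    also have "\<dots> = C * (1 / real p ^ 2)"
      by (simp add: C_def z_def power_mult_distrib algebra_simps power_divide add_divide_distrib)
    finally show ?thesis .
  qed
  thus ?thesis using that by blast
qed

lemma continuous_on_local_ratio: "continuous_on {0..1} (local_ratio p)"
proof (cases "prime p")
  case p: True
  have [simp]: "p \<noteq> 0" using prime_gt_0_nat[OF p] by simp
  have "continuous_on {0..1} (\<lambda>s. \<Sum>l. local_term s p l)"
  proof (rule uniform_limit_theorem[where F = sequentially])
    show "uniform_limit {0..1} (\<lambda>N s. \<Sum>l<N. local_term s p l) (\<lambda>s. \<Sum>l. local_term s p l) sequentially"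
      by (rule Weierstrass_m_test[OF _ summable_choose_power[of "1/2" k]])
         (use local_term_bounds[OF p] local_term_le_half[OF p] in auto)
    show "\<forall>\<^sub>F N in sequentially. continuous_on {0..1} (\<lambda>s. \<Sum>l<N. local_term s p l)"
      unfolding local_term_def by (intro always_eventually allI continuous_intros) auto
  qed auto
  hence "continuous_on {0..1} (\<lambda>s. (\<Sum>l. local_term s p l) *
     (\<Prod>(r,q)\<in>{..<Suc k} \<times> {..<Suc k}. 1 - real p powr (- (s * (x r + y q))) / real p))"
    unfolding case_prod_unfold by (intro continuous_intros) auto
  thus ?thesis using p by (simp add: local_ratio_def[abs_def])
qed (simp add: local_ratio_def[abs_def])

lemma local_ratio_0:
  "local_ratio p 0 = (if prime p then (1 - 1 / real p) ^ ((Suc k)\<^sup>2) *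
                (\<Sum>l. real ((l + Suc k - 1) choose (Suc k - 1)) ^ 2 / real p ^ l) else 1)"
proof (cases "prime p")
  case True
  have "local_term 0 p l = real ((l + Suc k - 1) choose (Suc k - 1)) ^ 2 / real p ^ l" for l
    using prime_gt_0_nat[OF True]
    by (simp add: local_term_def hsym_one power2_eq_square power_divide del: hsym.simps)
  moreover have "(\<Prod>(r,q)\<in>{..<Suc k} \<times> {..<Suc k}. 1 - real p powr (- (0 * (x r + y q))) / real p)
      = (1 - 1 / real p) ^ ((Suc k)\<^sup>2)"
    using prime_gt_0_nat[OF True] by (simp add: power2_eq_square del: power_Suc)
  ultimately show ?thesis using True by (simp only: local_ratio_def if_True mult.commute)
qed (simp add: local_ratio_def)

text \<open>Convergence is uniform on the closed interval [0, 1], so the limit is continuous at s =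
  0, although the zeta factors that were divided out diverge there.\<close>

lemma local_ratio_prod_limit:
  obtains g where "continuous_on {0..1} g" "g 0 = arith_factor (Suc k)"
    "\<And>s. s \<in> {0..1} \<Longrightarrow> (\<lambda>Q. \<Prod>p<Q. local_ratio p s) \<longlonglongrightarrow> g s"
proof -
  obtain C where C: "\<And>p s. s \<ge> 0 \<Longrightarrow> \<bar>local_ratio p s - 1\<bar> \<le> C * (1 / real p ^ 2)"
    using local_ratio_bound by blast
  have sC: "summable (\<lambda>p. C * (1 / real p ^ 2))"
    using inverse_power_summable[of 2, where ?'a = real]
    by (intro summable_mult) (simp add: field_simps)
  have "uniformly_convergent_on {0..1} (\<lambda>N s. \<Sum>p<N. norm (local_ratio p s - 1))"
    by (rule Weierstrass_m_test'[OF _ sC]) (use C in auto)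
  hence "uniformly_convergent_on {0..1} (\<lambda>N s. \<Prod>p<N. local_ratio p s)"
    by (intro uniformly_convergent_on_prod' continuous_on_local_ratio) auto
  then obtain g where g: "uniform_limit {0..1} (\<lambda>N s. \<Prod>p<N. local_ratio p s) g sequentially"
    unfolding uniformly_convergent_on_def by blast
  have lim: "(\<lambda>Q. \<Prod>p<Q. local_ratio p s) \<longlonglongrightarrow> g s" if "s \<in> {0..1}" for s
    using tendsto_uniform_limitI[OF g that] .
  have "continuous_on {0..1} g"
    by (rule uniform_limit_theorem[OF _ g])
       (auto intro!: always_eventually continuous_intros continuous_on_local_ratio)
  moreover have "g 0 = arith_factor (Suc k)"
  proof -
    \<comment> \<open>\<open>arith_factor\<close> is a \<open>prodinf\<close>; to identify it with
      the limit of the partial products, convergence as an infinite product has to be known.\<close>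
    have "summable (\<lambda>p. norm (local_ratio p 0 - 1))"
      by (rule summable_comparison_test'[OF sC, of 0]) (use C in auto)
    hence "abs_convergent_prod (\<lambda>p. local_ratio p 0)"
      by (simp add: summable_imp_abs_convergent_prod)
    hence "convergent_prod (\<lambda>p. local_ratio p 0)"
      by (rule abs_convergent_prod_imp_convergent_prod)
    hence "(\<lambda>n. \<Prod>p\<le>n. local_ratio p 0) \<longlonglongrightarrow> prodinf (\<lambda>p. local_ratio p 0)"
      by (rule convergent_prod_LIMSEQ)
    moreover have "(\<lambda>n. \<Prod>p\<le>n. local_ratio p 0) \<longlonglongrightarrow> g 0"
      using LIMSEQ_Suc[OF lim[of 0]] by (simp add: lessThan_Suc_atMost)
    ultimately have "prodinf (\<lambda>p. local_ratio p 0) = g 0" by (rule LIMSEQ_unique)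
    thus ?thesis unfolding local_ratio_0 arith_factor_def by (simp only:)
  qed
  ultimately show ?thesis using lim that by blast
qed

definition shifted_term :: "real \<Rightarrow> nat \<Rightarrow> real" where
  "shifted_term s n = dconv (\<lambda>r d. real d powr (- (s * x r))) (Suc k) n *
                  dconv (\<lambda>r d. real d powr (- (s * y r))) (Suc k) n / real n"

lemma shifted_term_prime_power:
  assumes "prime p"
  shows "shifted_term s (p ^ l) = local_term s p l"
proof -
  have "real (p ^ i) powr a = (real p powr a) ^ i" for i a
    using prime_gt_0_nat[OF assms]
    by (simp add: powr_powr mult.commute flip: powr_realpow)
  thus ?thesis unfolding shifted_term_def local_term_def
    by (simp add: dconv_prime_power[OF assms] power_divide del: hsym.simps dconv.simps)
qed

lemma shifted_sums:
  assumes s: "0 < s" and g: "(\<lambda>Q. \<Prod>p<Q. local_ratio p s) \<longlonglongrightarrow> gs"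
  shows "shifted_term s sums (gs * (\<Prod>(r,q)\<in>{..<Suc k} \<times> {..<Suc k}. \<Sum>n. real n powr (- 1 - s * (x r + y q))))"
proof (rule euler_prod_sums)
  show "shifted_term s n \<ge> 0" for n
    unfolding shifted_term_def
    using dconv_mono[of "Suc k" "\<lambda>r d. real d powr (- (s * x r))" "\<lambda>r d. real d powr (- (s * x r))" n]
      dconv_mono[of "Suc k" "\<lambda>r d. real d powr (- (s * y r))" "\<lambda>r d. real d powr (- (s * y r))" n]
    by (simp del: dconv.simps)
  show "shifted_term s 0 = 0" by (simp add: shifted_term_def)
  show "shifted_term s 1 = 1" by (simp add: shifted_term_def dconv_1 del: dconv.simps)
  show "shifted_term s (m * n) = shifted_term s m * shifted_term s n" if "coprime m n" "m > 0" "n > 0" for m n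
    using that by (simp add: shifted_term_def dconv_mult_coprime powr_mult del: dconv.simps)
  show "summable (\<lambda>l. shifted_term s (p ^ l))" if "prime p" for p
    using summable_local_term[OF that, of s] s by (simp add: shifted_term_prime_power[OF that])
  have eq: "euler_factor (shifted_term s) p = local_ratio p s *
      (\<Prod>(r,q)\<in>{..<Suc k} \<times> {..<Suc k}. if prime p then 1 / (1 - real p powr (- (s * (x r + y q))) / real p) else 1)" for p
  proof (cases "prime p")
    case p: True
    have ne: "1 - real p powr (- (s * (x r + y q))) / real p \<noteq> 0" for r q
    proof -
      have "real p powr (- (s * (x r + y q))) \<le> 1"
        using powr_unit[OF p, of s "x r + y q"] s x[of r] y[of q] by auto
      thus ?thesis using prime_gt_1_nat[OF p] by (auto simp: field_simps)
    qed
    show ?thesis using p ne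
      by (simp add: euler_factor_def local_ratio_def shifted_term_prime_power case_prod_unfold
            prod.distrib[symmetric] mult.assoc)
  qed (simp add: euler_factor_def local_ratio_def)
  have "(\<lambda>Q. (\<Prod>p<Q. local_ratio p s) * (\<Prod>(r,q)\<in>{..<Suc k} \<times> {..<Suc k}. \<Prod>p<Q. if prime p then 1 / (1 - real p powr (- (s * (x r + y q))) / real p) else 1))
       \<longlonglongrightarrow> gs * (\<Prod>(r,q)\<in>{..<Suc k} \<times> {..<Suc k}. \<Sum>n. real n powr (- 1 - s * (x r + y q)))"
    unfolding case_prod_unfold
    using s x y by (intro tendsto_intros g zeta_euler_prod mult_pos_pos add_pos_pos)
  also have "(\<lambda>Q. (\<Prod>p<Q. local_ratio p s) * (\<Prod>(r,q)\<in>{..<Suc k} \<times> {..<Suc k}. \<Prod>p<Q. if prime p then 1 / (1 - real p powr (- (s * (x r + y q))) / real p) else 1))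
      = (\<lambda>Q. \<Prod>p<Q. euler_factor (shifted_term s) p)"
    unfolding eq prod.distrib case_prod_unfold by (subst prod.swap) simp
  finally show "(\<lambda>Q. \<Prod>p<Q. euler_factor (shifted_term s) p) \<longlonglongrightarrow>
     gs * (\<Prod>(r,q)\<in>{..<Suc k} \<times> {..<Suc k}. \<Sum>n. real n powr (- 1 - s * (x r + y q)))" .
qed

lemma shifted_summable:
  assumes "0 < s" "s \<le> 1"
  shows "summable (shifted_term s)"
proof -
  obtain g where "\<And>s. s \<in> {0..1} \<Longrightarrow> (\<lambda>Q. \<Prod>p<Q. local_ratio p s) \<longlonglongrightarrow> g s"
    using local_ratio_prod_limit by blast
  from shifted_sums[OF assms(1) this[of s]] assms show ?thesis by (simp add: sums_iff)
qed

text \<open>Each of the K^2 zeta factors, where K = k + 1, tends to 1 after multiplication by s(x r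
  + y q), and the quotient of Euler products tends to its value at s = 0.\<close>

lemma shifted_limit:
  "((\<lambda>s. s ^ (Suc k)\<^sup>2 * (\<Sum>n. shifted_term s n)) \<longlongrightarrow>
      arith_factor (Suc k) * (\<Prod>r<Suc k. \<Prod>q<Suc k. 1 / (x r + y q))) (at_right 0)"
proof -
  let ?I = "{..<Suc k} \<times> {..<Suc k}"
  obtain g where g: "continuous_on {0..1} g" "g 0 = arith_factor (Suc k)"
    "\<And>s. s \<in> {0..1} \<Longrightarrow> (\<lambda>Q. \<Prod>p<Q. local_ratio p s) \<longlonglongrightarrow> g s"
    using local_ratio_prod_limit by blast
  have "(g \<longlongrightarrow> g 0) (at_right 0)"
    using g(1) by (simp add: continuous_on_Icc_at_rightD)
  moreover have "((\<lambda>s. (s * (x r + y q)) * (\<Sum>n. real n powr (- 1 - s * (x r + y q))) * (1 / (x r + y q)))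
                   \<longlongrightarrow> 1 * (1 / (x r + y q))) (at_right 0)" for r q
  proof (intro tendsto_mult filterlim_compose[OF zeta_real_tendsto] tendsto_const)
    have "x r + y q > 0" using x[of r] y[of q] by simp
    thus "filterlim (\<lambda>s. s * (x r + y q)) (at_right 0) (at_right 0)" by real_asymp
  qed
  ultimately have lim: "((\<lambda>s. g s * (\<Prod>(r,q)\<in>?I. (s * (x r + y q)) * (\<Sum>n. real n powr (- 1 - s * (x r + y q))) * (1 / (x r + y q))))
        \<longlongrightarrow> g 0 * (\<Prod>(r,q)\<in>?I. 1 * (1 / (x r + y q)))) (at_right 0)"
    unfolding case_prod_unfold by (intro tendsto_mult[of g] tendsto_prod)
  have "g s * (\<Prod>(r,q)\<in>?I. (s * (x r + y q)) * (\<Sum>n. real n powr (- 1 - s * (x r + y q))) * (1 / (x r + y q)))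
          = s ^ (Suc k)\<^sup>2 * (\<Sum>n. shifted_term s n)" if s: "s \<in> {0<..<1}" for s
  proof -
    have "x r + y q \<noteq> 0" for r q using x[of r] y[of q] by simp
    hence "(\<Prod>(r,q)\<in>?I. (s * (x r + y q)) * (\<Sum>n. real n powr (- 1 - s * (x r + y q))) * (1 / (x r + y q)))
        = (\<Prod>(r,q)\<in>?I. s * (\<Sum>n. real n powr (- 1 - s * (x r + y q))))"
      by (intro prod.cong) auto
    also have "\<dots> = s ^ (Suc k)\<^sup>2 * (\<Prod>(r,q)\<in>?I. \<Sum>n. real n powr (- 1 - s * (x r + y q)))"
      by (simp add: case_prod_unfold prod.distrib power2_eq_square del: power_Suc)
    finally show ?thesis
      using sums_unique[OF shifted_sums[of s "g s"]] g(3)[of s] s by (simp add: mult_ac)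
  qed
  hence "\<forall>\<^sub>F s in at_right 0. g s * (\<Prod>(r,q)\<in>?I. (s * (x r + y q)) * (\<Sum>n. real n powr (- 1 - s * (x r + y q))) * (1 / (x r + y q)))
          = s ^ (Suc k)\<^sup>2 * (\<Sum>n. shifted_term s n)"
    by (intro eventually_at_rightI[of 0 1]) auto
  from Lim_transform_eventually[OF lim this] show ?thesis
    by (simp only: g(2) prod.cartesian_product mult_1_left)
qed

end

section \<open>Differentiation in the shifts\<close>

text \<open>The \<open>Inl\<close> coordinates feed the first convolution and the \<open>Inr\<close>
  coordinates the second, matching the x and y variables of \<open>cauchy_kernel\<close>, so that a
  shift in either group is the update of one coordinate.\<close>

definition pair_term :: "nat \<Rightarrow> (nat + nat \<Rightarrow> nat \<Rightarrow> real) \<Rightarrow> nat \<Rightarrow> real" where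
  "pair_term K f n = dconv (\<lambda>r. f (Inl r)) K n * dconv (\<lambda>q. f (Inr q)) K n / real n"

definition coords :: "nat \<Rightarrow> (nat + nat) set" where
  "coords K = Inl ` {..<K} \<union> Inr ` {..<K}"

lemma pair_term_linear:
  assumes "i \<in> coords K"
  shows "pair_term K (f(i := \<lambda>d. a * g d + b * h d)) n =
           a * pair_term K (f(i := g)) n + b * pair_term K (f(i := h)) n"
proof -
  have *: "(\<lambda>r. (f(Inl q := w)) (Inl r)) = (\<lambda>r. f (Inl r))(q := w)"
          "(\<lambda>r. (f(Inr q := w)) (Inr r)) = (\<lambda>r. f (Inr r))(q := w)"
          "(\<lambda>r. (f(Inl q := w)) (Inr r)) = (\<lambda>r. f (Inr r))"
          "(\<lambda>r. (f(Inr q := w)) (Inl r)) = (\<lambda>r. f (Inl r))" for q w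
    by auto
  from assms consider r where "r < K" "i = Inl r" | r where "r < K" "i = Inr r"
    by (auto simp: coords_def)
  thus ?thesis
  proof cases
    case (1 r)
    show ?thesis unfolding pair_term_def 1(2) * dconv_fun_upd_linear[OF 1(1)]
      by (simp add: algebra_simps add_divide_distrib)
  next
    case (2 r)
    show ?thesis unfolding pair_term_def 2(2) * dconv_fun_upd_linear[OF 2(1)]
      by (simp add: algebra_simps add_divide_distrib)
  qed
qed

lemma pair_term_mono:
  assumes "\<And>i d. d > 0 \<Longrightarrow> 0 \<le> f i d \<and> f i d \<le> g i d"
  shows "0 \<le> pair_term K f n \<and> pair_term K f n \<le> pair_term K g n"
  using dconv_mono[of K "\<lambda>r. f (Inl r)" "\<lambda>r. g (Inl r)" n]
        dconv_mono[of K "\<lambda>r. f (Inr r)" "\<lambda>r. g (Inr r)" n] assms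
  unfolding pair_term_def by (auto intro!: divide_right_mono mult_mono divide_nonneg_nonneg)

text \<open>Up to sign, the derivative of order \<open>\<alpha> i\<close> in \<open>v i\<close> of
  d^(-s(1/2 + v i)). The offset 1/2 makes v = 0 an interior point, turns 1 / (x + y) into 1 / (1 + x
  + y), and at v = 0 gives n^(-s/2) from each of the two convolutions.\<close>

definition weight :: "real \<Rightarrow> (nat + nat \<Rightarrow> nat) \<Rightarrow> (nat + nat \<Rightarrow> real) \<Rightarrow> nat + nat \<Rightarrow> nat \<Rightarrow> real" where
  "weight s \<alpha> v i d = (s * ln (real d)) ^ \<alpha> i * real d powr (- (s * (1 / 2 + v i)))"

lemma weight_nonneg: "s \<ge> 0 \<Longrightarrow> d > 0 \<Longrightarrow> weight s \<alpha> v i d \<ge> 0"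
  by (simp add: weight_def)

definition shift_domain :: "(nat + nat \<Rightarrow> real) set" where
  "shift_domain = {v. \<forall>i. v i > - (1 / 2)}"

text \<open>Quantifying over all admissible shifts, not just v = 0, keeps neighbouring values
  available for the next difference quotient.\<close>

definition has_moment_limit ::
    "nat \<Rightarrow> (nat + nat \<Rightarrow> nat) \<Rightarrow> ((nat + nat \<Rightarrow> real) \<Rightarrow> real) \<Rightarrow> bool" where
  "has_moment_limit K \<alpha> D \<longleftrightarrow> (\<forall>v\<in>shift_domain.
     (\<forall>s\<in>{0<..1}. summable (pair_term K (weight s \<alpha> v))) \<and>
     ((\<lambda>s. s ^ (K\<^sup>2) * (\<Sum>n. pair_term K (weight s \<alpha> v) n)) \<longlongrightarrow> D v) (at_right 0))"

lemma has_moment_limit_base: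
  "has_moment_limit (Suc k) (\<lambda>_. 0) (\<lambda>v. arith_factor (Suc k) * cauchy_kernel (Suc k) v)"
  unfolding has_moment_limit_def
proof (intro ballI conjI)
  fix v assume v: "v \<in> shift_domain"
  define x y where "x = (\<lambda>r. 1 / 2 + v (Inl r))" and "y = (\<lambda>r. 1 / 2 + v (Inr r))"
  have xy: "x r > 0" "y r > 0" for r
  proof -
    have "v (Inl r) > - (1 / 2)" "v (Inr r) > - (1 / 2)" using v by (auto simp: shift_domain_def)
    thus "x r > 0" "y r > 0" unfolding x_def y_def by linarith+
  qed
  have eq: "pair_term (Suc k) (weight s (\<lambda>_. 0) v) = shifted_term k x y s" for s
    unfolding fun_eq_iff shifted_term_def[OF xy] pair_term_def weight_def
    by (simp add: x_def y_def del: dconv.simps)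
  show "summable (pair_term (Suc k) (weight s (\<lambda>_. 0) v))" if "s \<in> {0<..1}" for s
    unfolding eq using that by (intro shifted_summable xy) auto
  have "cauchy_kernel (Suc k) v = (\<Prod>r<Suc k. \<Prod>q<Suc k. 1 / (x r + y q))"
  proof -
    have "1 + v (Inl r) + v (Inr q) = x r + y q" for r q by (simp add: x_def y_def)
    thus ?thesis by (simp only: cauchy_kernel_def)
  qed
  thus "((\<lambda>s. s ^ (Suc k)\<^sup>2 * (\<Sum>n. pair_term (Suc k) (weight s (\<lambda>_. 0) v) n)) \<longlongrightarrow>
          arith_factor (Suc k) * cauchy_kernel (Suc k) v) (at_right 0)"
    unfolding eq using shifted_limit[OF xy] by simp
qed

text \<open>The tangent bound exp u \<ge> 1 + u at u = -ht and u = ht, where t = s ln d. The third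
  part makes the lower quotient nonnegative, as products of weights can be compared only between
  nonnegative factors.\<close>

lemma weight_sandwich:
  assumes s: "s > 0" and h: "h > 0" and d: "d > 0"
  shows "(weight s \<alpha> v i d - weight s \<alpha> (v(i := v i + h)) i d) / h \<le> weight s (\<alpha>(i := Suc (\<alpha> i))) v i d"
    and "weight s (\<alpha>(i := Suc (\<alpha> i))) v i d \<le> (weight s \<alpha> (v(i := v i - h)) i d - weight s \<alpha> v i d) / h"
    and "weight s \<alpha> (v(i := v i + h)) i d \<le> weight s \<alpha> v i d"
proof -
  define t where "t = s * ln (real d)"
  have t: "t \<ge> 0" using s d by (simp add: t_def)
  define w where "w = weight s \<alpha> v i d"
  have w: "w \<ge> 0" unfolding w_def by (rule weight_nonneg) (use s d in auto)
  have sh: "weight s \<alpha> (v(i := v i + c)) i d = w * exp (- c * t)" for c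
    using d by (simp add: weight_def w_def t_def powr_def exp_add[symmetric] algebra_simps)
  have up: "weight s (\<alpha>(i := Suc (\<alpha> i))) v i d = w * t"
    by (simp add: weight_def w_def t_def)
  have e: "exp (- h * t) \<ge> 1 + (- h * t)" "exp (h * t) \<ge> 1 + h * t" by (rule exp_ge_add_one_self)+
  have "w * (1 - exp (- h * t)) \<le> w * (h * t)" "w * (h * t) \<le> w * (exp (h * t) - 1)"
    using e by (intro mult_left_mono w; linarith)+
  thus "(weight s \<alpha> v i d - weight s \<alpha> (v(i := v i + h)) i d) / h \<le> weight s (\<alpha>(i := Suc (\<alpha> i))) v i d"
    "weight s (\<alpha>(i := Suc (\<alpha> i))) v i d \<le> (weight s \<alpha> (v(i := v i - h)) i d - weight s \<alpha> v i d) / h"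
    using sh[of h] sh[of "-h"] h unfolding up w_def[symmetric] by (auto simp: field_simps)
  have "w * exp (- h * t) \<le> w * 1" using w h t by (intro mult_left_mono) auto
  thus "weight s \<alpha> (v(i := v i + h)) i d \<le> weight s \<alpha> v i d" unfolding sh w_def[symmetric] by simp
qed

text \<open>Only the factor of coordinate i changes. Linearity moves the difference quotient into
  that factor, and monotonicity in nonnegative factors carries the sandwich over.\<close>

lemma pair_term_weight_sandwich:
  assumes i: "i \<in> coords K" and s: "s > 0" and h: "h > 0"
  shows "(pair_term K (weight s \<alpha> v) n - pair_term K (weight s \<alpha> (v(i := v i + h))) n) / h
           \<le> pair_term K (weight s (\<alpha>(i := Suc (\<alpha> i))) v) n" (is ?A)
    and "pair_term K (weight s (\<alpha>(i := Suc (\<alpha> i))) v) n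
           \<le> (pair_term K (weight s \<alpha> (v(i := v i - h))) n - pair_term K (weight s \<alpha> v) n) / h" (is ?B)
proof -
  define f where "f = weight s \<alpha> v"
  have f: "f i d \<ge> 0" if "d > 0" for i d unfolding f_def by (rule weight_nonneg) (use s that in auto)
  have upd: "weight s \<alpha> (v(i := c)) = f(i := weight s \<alpha> (v(i := c)) i)" for c
    by (auto simp: fun_eq_iff weight_def f_def)
  have up: "weight s (\<alpha>(i := Suc (\<alpha> i))) v = f(i := weight s (\<alpha>(i := Suc (\<alpha> i))) v i)"
    by (auto simp: fun_eq_iff weight_def f_def)
  note sw = weight_sandwich[OF s h, where \<alpha> = \<alpha> and v = v and i = i, folded f_def]
  have "(pair_term K f n - pair_term K (weight s \<alpha> (v(i := v i + h))) n) / h =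
          pair_term K (f(i := \<lambda>d. (1 / h) * f i d + (- 1 / h) * weight s \<alpha> (v(i := v i + h)) i d)) n"
    by (subst pair_term_linear[OF i]) (simp add: upd[symmetric] diff_divide_distrib)
  also have "\<dots> \<le> pair_term K (f(i := weight s (\<alpha>(i := Suc (\<alpha> i))) v i)) n"
  proof (rule pair_term_mono[THEN conjunct2])
    fix j d assume d: "(d :: nat) > 0"
    show "0 \<le> (f(i := \<lambda>d. (1 / h) * f i d + (- 1 / h) * weight s \<alpha> (v(i := v i + h)) i d)) j d \<and>
      (f(i := \<lambda>d. (1 / h) * f i d + (- 1 / h) * weight s \<alpha> (v(i := v i + h)) i d)) j d
         \<le> (f(i := weight s (\<alpha>(i := Suc (\<alpha> i))) v i)) j d"
      using f[OF d, of j] sw(1,3)[OF d] h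
      by (cases "j = i") (simp_all add: diff_divide_distrib divide_right_mono)
  qed
  finally show ?A unfolding f_def[symmetric] by (subst up)
  have "pair_term K (f(i := weight s (\<alpha>(i := Suc (\<alpha> i))) v i)) n \<le>
          pair_term K (f(i := \<lambda>d. (1 / h) * weight s \<alpha> (v(i := v i - h)) i d + (- 1 / h) * f i d)) n"
  proof (rule pair_term_mono[THEN conjunct2])
    fix j d assume d: "(d :: nat) > 0"
    show "0 \<le> (f(i := weight s (\<alpha>(i := Suc (\<alpha> i))) v i)) j d \<and>
      (f(i := weight s (\<alpha>(i := Suc (\<alpha> i))) v i)) j d \<le>
      (f(i := \<lambda>d. (1 / h) * weight s \<alpha> (v(i := v i - h)) i d + (- 1 / h) * f i d)) j d"
      using f[OF d, of j] sw(2)[OF d] weight_nonneg[of s d "\<alpha>(i := Suc (\<alpha> i))" v i] s d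
      by (cases "j = i") (simp_all add: diff_divide_distrib)
  qed
  also have "\<dots> = (pair_term K (weight s \<alpha> (v(i := v i - h))) n - pair_term K f n) / h"
    by (subst pair_term_linear[OF i]) (simp add: upd[symmetric] diff_divide_distrib)
  finally show ?B unfolding f_def[symmetric] by (subst up)
qed

text \<open>For fixed h, letting s tend to 0 confines the sum between two difference quotients of D;
  afterwards h tends to 0. Fixing h before s is what makes pointwise limits enough. The sign comes
  from differentiating exp(-x t).\<close>

lemma has_moment_limit_step:
  assumes D: "has_moment_limit K \<alpha> D" and i: "i \<in> coords K"
    and deriv: "\<And>v. v \<in> shift_domain \<Longrightarrow> ((\<lambda>u. D (v(i := u))) has_real_derivative D' v) (at (v i))"
  shows "has_moment_limit K (\<alpha>(i := Suc (\<alpha> i))) (\<lambda>v. - D' v)"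
  unfolding has_moment_limit_def
proof (intro ballI conjI)
  fix v assume v: "v \<in> shift_domain"
  define \<alpha>' where "\<alpha>' = \<alpha>(i := Suc (\<alpha> i))"
  define S where "S = (\<lambda>v s. \<Sum>n. pair_term K (weight s \<alpha> v) n)"
  define S' where "S' = (\<lambda>s. \<Sum>n. pair_term K (weight s \<alpha>' v) n)"
  \<comment> \<open>Half the distance of \<open>v i\<close> from the boundary -1/2, so that steps to
    the left stay inside the domain.\<close>
  define h0 where "h0 = (v i + 1 / 2) / 2"
  have vi: "v i > - (1 / 2)" using v by (auto simp: shift_domain_def)
  hence h0: "h0 > 0" by (simp add: h0_def)
  have vp: "v(i := v i + h) \<in> shift_domain" if "h > 0" for h
  proof -
    have "v i + h > - (1 / 2)" using vi that by linarith
    thus ?thesis using v by (auto simp: shift_domain_def)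
  qed
  have vm: "v(i := v i - h) \<in> shift_domain" if "0 < h" "h \<le> h0" for h
  proof -
    have "v i - h > - (1 / 2)" using vi that(2) by (simp add: h0_def field_simps)
    thus ?thesis using v by (auto simp: shift_domain_def)
  qed
  have sm: "summable (pair_term K (weight s \<alpha> v))" if "v \<in> shift_domain" "s \<in> {0<..1}" for v s
    using D that by (auto simp: has_moment_limit_def)
  have lim: "((\<lambda>s. s ^ (K\<^sup>2) * S v s) \<longlongrightarrow> D v) (at_right 0)" if "v \<in> shift_domain" for v
    using D that by (auto simp: has_moment_limit_def S_def)
  have sm': "summable (pair_term K (weight s \<alpha>' v))" if s: "s \<in> {0<..1}" for s
  proof (rule summable_comparison_test'[where N = 0])
    show "summable (\<lambda>n. (pair_term K (weight s \<alpha> (v(i := v i - h0))) n - pair_term K (weight s \<alpha> v) n) / h0)"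
      by (intro summable_divide summable_diff sm vm v s) (use h0 in auto)
    fix n
    have "pair_term K (weight s \<alpha>' v) n \<ge> 0"
      using s by (intro pair_term_mono[of _ "weight s \<alpha>' v", THEN conjunct1]) (auto intro: weight_nonneg)
    thus "norm (pair_term K (weight s \<alpha>' v) n) \<le> (pair_term K (weight s \<alpha> (v(i := v i - h0))) n - pair_term K (weight s \<alpha> v) n) / h0"
      using pair_term_weight_sandwich(2)[OF i, of s h0] s h0 by (simp add: \<alpha>'_def)
  qed
  show "summable (pair_term K (weight s (\<alpha>(i := Suc (\<alpha> i))) v))" if "s \<in> {0<..1}" for s
    using sm'[OF that] by (simp add: \<alpha>'_def)
  have lower: "(S v s - S (v(i := v i + h)) s) / h \<le> S' s" if s: "s \<in> {0<..1}" and h: "h > 0" for s h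
  proof -
    have "(S v s - S (v(i := v i + h)) s) / h =
            (\<Sum>n. (pair_term K (weight s \<alpha> v) n - pair_term K (weight s \<alpha> (v(i := v i + h))) n) / h)"
      unfolding S_def by (subst suminf_diff[OF sm sm], (rule v vp h s)+, rule suminf_divide[symmetric])
         (intro summable_diff sm v vp h s)
    also have "\<dots> \<le> S' s" unfolding S'_def
      using pair_term_weight_sandwich(1)[OF i, of s h] s h
      by (intro suminf_le sm' summable_divide summable_diff sm v vp) (auto simp: \<alpha>'_def)
    finally show ?thesis .
  qed
  have upper: "S' s \<le> (S (v(i := v i - h)) s - S v s) / h" if s: "s \<in> {0<..1}" and h: "h > 0" "h \<le> h0" for s h
  proof -
    have "S' s \<le> (\<Sum>n. (pair_term K (weight s \<alpha> (v(i := v i - h))) n - pair_term K (weight s \<alpha> v) n) / h)"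
      unfolding S'_def using pair_term_weight_sandwich(2)[OF i, of s h] s h
      by (intro suminf_le sm' summable_divide summable_diff sm v vm) (auto simp: \<alpha>'_def)
    also have "\<dots> = (S (v(i := v i - h)) s - S v s) / h"
      unfolding S_def by (subst suminf_diff[OF sm sm], (rule v vm h s)+, rule suminf_divide)
         (intro summable_diff sm v vm h s)
    finally show ?thesis .
  qed
  have der: "((\<lambda>h. (D (v(i := v i + h)) - D v) / h) \<longlongrightarrow> D' v) (at 0)"
    using deriv[OF v] by (simp add: DERIV_def)
  have quot: "((\<lambda>h. (D v - D (v(i := v i + h))) / h) \<longlongrightarrow> - D' v) (at_right 0)"
             "((\<lambda>h. (D (v(i := v i - h)) - D v) / h) \<longlongrightarrow> - D' v) (at_right 0)"
  proof -
    have "((\<lambda>h. - ((D (v(i := v i + h)) - D v) / h)) \<longlongrightarrow> - D' v) (at_right 0)"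
      by (intro tendsto_intros tendsto_mono[OF _ der] at_le) auto
    thus "((\<lambda>h. (D v - D (v(i := v i + h))) / h) \<longlongrightarrow> - D' v) (at_right 0)"
      by (simp add: minus_divide_left)
    have "filterlim (\<lambda>h::real. - h) (at 0) (at_right 0)" by real_asymp
    from tendsto_minus[OF filterlim_compose[OF der this]]
    show "((\<lambda>h. (D (v(i := v i - h)) - D v) / h) \<longlongrightarrow> - D' v) (at_right 0)" by simp
  qed
  have sev: "\<forall>\<^sub>F s::real in at_right 0. s \<in> {0<..1}"
    by (intro eventually_at_rightI[of 0 1]) auto
  have "((\<lambda>s. s ^ (K\<^sup>2) * S' s) \<longlongrightarrow> - D' v) (at_right 0)"
  proof (rule order_tendstoI)
    fix a assume "a < - D' v"
    from order_tendstoD(1)[OF quot(1) this] have "\<forall>\<^sub>F h in at_right 0. a < (D v - D (v(i := v i + h))) / h \<and> 0 < h"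
      by (intro eventually_conj eventually_at_right_less)
    then obtain h where h: "a < (D v - D (v(i := v i + h))) / h" "h > 0"
      using eventually_happens trivial_limit_at_right_real by blast
    have "((\<lambda>s. (s ^ (K\<^sup>2) * S v s - s ^ (K\<^sup>2) * S (v(i := v i + h)) s) / h) \<longlongrightarrow>
             (D v - D (v(i := v i + h))) / h) (at_right 0)"
      using h by (intro tendsto_intros lim v vp) auto
    from order_tendstoD(1)[OF this h(1)] sev
    show "\<forall>\<^sub>F s in at_right 0. a < s ^ (K\<^sup>2) * S' s"
    proof eventually_elim
      case (elim s)
      have "s ^ (K\<^sup>2) * ((S v s - S (v(i := v i + h)) s) / h) \<le> s ^ (K\<^sup>2) * S' s"
        using lower[OF elim(2) h(2)] elim(2) by (intro mult_left_mono) auto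
      with elim(1) show ?case by (simp add: right_diff_distrib diff_divide_distrib)
    qed
  next
    fix a assume "a > - D' v"
    from order_tendstoD(2)[OF quot(2) this]
    have "\<forall>\<^sub>F h in at_right 0. (D (v(i := v i - h)) - D v) / h < a \<and> h \<in> {0<..<h0}"
      by (intro eventually_conj eventually_at_right_real h0)
    then obtain h where h: "(D (v(i := v i - h)) - D v) / h < a" "h > 0" "h \<le> h0"
      using eventually_happens[of _ "at_right (0::real)"] trivial_limit_at_right_real by fastforce
    have "((\<lambda>s. (s ^ (K\<^sup>2) * S (v(i := v i - h)) s - s ^ (K\<^sup>2) * S v s) / h) \<longlongrightarrow>
             (D (v(i := v i - h)) - D v) / h) (at_right 0)"
      using h by (intro tendsto_intros lim v vm) auto
    from order_tendstoD(2)[OF this h(1)] sev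
    show "\<forall>\<^sub>F s in at_right 0. s ^ (K\<^sup>2) * S' s < a"
    proof eventually_elim
      case (elim s)
      have "s ^ (K\<^sup>2) * S' s \<le> s ^ (K\<^sup>2) * ((S (v(i := v i - h)) s - S v s) / h)"
        using upper[OF elim(2) h(2,3)] elim(2) by (intro mult_left_mono) auto
      with elim(1) show ?case by (simp add: right_diff_distrib diff_divide_distrib)
    qed
  qed
  thus "((\<lambda>s. s ^ (K\<^sup>2) * (\<Sum>n. pair_term K (weight s (\<alpha>(i := Suc (\<alpha> i))) v) n)) \<longlongrightarrow> - D' v) (at_right 0)"
    by (simp add: S'_def \<alpha>'_def)
qed

text \<open>A class that contains \<open>cauchy_kernel\<close> and is closed under partial
  derivatives on \<open>shift_domain\<close>. It provides all iterated partial derivatives by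
  one-variable calculus.\<close>

inductive shift_rational :: "((nat + nat \<Rightarrow> real) \<Rightarrow> real) \<Rightarrow> bool" where
  const: "shift_rational (\<lambda>_. c)"
| add: "shift_rational f \<Longrightarrow> shift_rational g \<Longrightarrow> shift_rational (\<lambda>v. f v + g v)"
| mult: "shift_rational f \<Longrightarrow> shift_rational g \<Longrightarrow> shift_rational (\<lambda>v. f v * g v)"
| inv: "shift_rational (\<lambda>v. 1 / (1 + v (Inl r) + v (Inr q)))"

lemma shift_rational_prod:
  "(\<And>i. i \<in> A \<Longrightarrow> shift_rational (f i)) \<Longrightarrow> shift_rational (\<lambda>v. \<Prod>i\<in>A. f i v)"
  by (induction A rule: infinite_finite_induct) (auto intro: shift_rational.intros)

lemma shift_rational_deriv:
  assumes "shift_rational f"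
  shows "\<exists>f'. shift_rational f' \<and>
     (\<forall>v\<in>shift_domain. ((\<lambda>u. f (v(i := u))) has_real_derivative f' v) (at (v i)))"
  using assms
proof induction
  case (const c)
  show ?case by (intro exI[of _ "\<lambda>_. 0"]) (auto intro: shift_rational.const)
next
  case (add f g)
  then obtain f' g' where "shift_rational f'" "shift_rational g'"
    "\<forall>v\<in>shift_domain. ((\<lambda>u. f (v(i := u))) has_real_derivative f' v) (at (v i))"
    "\<forall>v\<in>shift_domain. ((\<lambda>u. g (v(i := u))) has_real_derivative g' v) (at (v i))" by blast
  thus ?case
    by (intro exI[of _ "\<lambda>v. f' v + g' v"] conjI ballI shift_rational.add DERIV_add)
       (simp_all del: fun_upd_apply)
next
  case (mult f g)
  then obtain f' g' where f': "shift_rational f'" "shift_rational g'"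
    and d: "\<And>v. v \<in> shift_domain \<Longrightarrow> ((\<lambda>u. f (v(i := u))) has_real_derivative f' v) (at (v i))"
    "\<And>v. v \<in> shift_domain \<Longrightarrow> ((\<lambda>u. g (v(i := u))) has_real_derivative g' v) (at (v i))" by blast
  have "shift_rational (\<lambda>v. f' v * g v + g' v * f v)"
    by (intro shift_rational.add shift_rational.mult f' mult.hyps)
  moreover have "((\<lambda>u. f (v(i := u)) * g (v(i := u))) has_real_derivative f' v * g v + g' v * f v) (at (v i))"
    if "v \<in> shift_domain" for v
    using DERIV_mult[OF d[OF that]] by (simp only: fun_upd_triv)
  ultimately show ?case by blast
next
  case (inv r q)
  \<comment> \<open>The slope of the denominator in coordinate i: 1 if i is one of its two
    variables, and 0 otherwise.\<close>
  define c :: real where "c = of_bool (i = Inl r) + of_bool (i = Inr q)"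
  define e where "e = (\<lambda>v :: nat + nat \<Rightarrow> real. 1 / (1 + v (Inl r) + v (Inr q)))"
  have "shift_rational (\<lambda>v. (- c) * (e v * e v))"
    unfolding e_def by (intro shift_rational.intros)
  moreover have "((\<lambda>u. e (v(i := u))) has_real_derivative (- c) * (e v * e v)) (at (v i))"
    if v: "v \<in> shift_domain" for v
  proof -
    have "v (Inl r) > - (1 / 2)" "v (Inr q) > - (1 / 2)" using v by (auto simp: shift_domain_def)
    hence pos: "1 + v (Inl r) + v (Inr q) > 0" by simp
    have lin: "1 + (v(i := u)) (Inl r) + (v(i := u)) (Inr q) = (1 + v (Inl r) + v (Inr q)) + c * (u - v i)" for u
      by (auto simp: c_def of_bool_def algebra_simps)
    show ?thesis unfolding e_def lin
      by (rule derivative_eq_intros refl | use pos in force)+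
  qed
  ultimately show ?case unfolding e_def by blast
qed

text \<open>Agreement is asked only on \<open>shift_domain\<close>: elsewhere a denominator may
  vanish, and the value of \<open>deriv\<close> is then not controlled.\<close>

definition smooth_on_shifts :: "((nat + nat \<Rightarrow> real) \<Rightarrow> real) \<Rightarrow> bool" where
  "smooth_on_shifts D \<longleftrightarrow> (\<exists>f. shift_rational f \<and> (\<forall>v\<in>shift_domain. D v = f v))"

lemma smooth_on_shifts_partial_deriv:
  assumes "smooth_on_shifts D"
  shows "smooth_on_shifts (partial_deriv i D)"
    and "v \<in> shift_domain \<Longrightarrow> ((\<lambda>u. D (v(i := u))) has_real_derivative partial_deriv i D v) (at (v i))"
proof -
  obtain f where f: "shift_rational f" "\<And>v. v \<in> shift_domain \<Longrightarrow> D v = f v"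
    using assms by (auto simp: smooth_on_shifts_def)
  obtain f' where f': "shift_rational f'"
     "\<And>v. v \<in> shift_domain \<Longrightarrow> ((\<lambda>u. f (v(i := u))) has_real_derivative f' v) (at (v i))"
    using shift_rational_deriv[OF f(1), of i] by blast
  have der: "((\<lambda>u. D (v(i := u))) has_real_derivative f' v) (at (v i))" if v: "v \<in> shift_domain" for v
  \<comment> \<open>A one-variable derivative depends only on values near \<open>v i\<close>, and
    moving this coordinate within the open half-line stays in the domain.\<close>
  proof (rule has_field_derivative_transform_within_open[OF f'(2)[OF v]])
    show "open {- (1 / 2 :: real)<..}" "v i \<in> {- (1 / 2)<..}" using v by (auto simp: shift_domain_def)
    show "f (v(i := u)) = D (v(i := u))" if "u \<in> {- (1 / 2)<..}" for u
      using v that by (intro f(2)[symmetric]) (auto simp: shift_domain_def)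
  qed
  hence eq: "partial_deriv i D v = f' v" if "v \<in> shift_domain" for v
    using that unfolding partial_deriv_def by (intro DERIV_imp_deriv)
  show "smooth_on_shifts (partial_deriv i D)"
    unfolding smooth_on_shifts_def using f'(1) eq by blast
  show "v \<in> shift_domain \<Longrightarrow> ((\<lambda>u. D (v(i := u))) has_real_derivative partial_deriv i D v) (at (v i))"
    using der eq by simp
qed

text \<open>The constant stays outside D, so that \<open>partial_deriv\<close> is iterated on D
  itself, in the form in which \<open>mixed_deriv\<close> does it. Each derivative contributes one
  sign.\<close>

lemma has_moment_limit_funpow:
  assumes "has_moment_limit K \<alpha> (\<lambda>v. c * D v)" "smooth_on_shifts D" "i \<in> coords K"
  shows "has_moment_limit K (\<alpha>(i := \<alpha> i + m)) (\<lambda>v. (-1) ^ m * c * (partial_deriv i ^^ m) D v)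
         \<and> smooth_on_shifts ((partial_deriv i ^^ m) D)"
proof (induction m)
  case 0
  thus ?case using assms by simp
next
  case (Suc m)
  let ?D = "(partial_deriv i ^^ m) D"
  have "has_moment_limit K ((\<alpha>(i := \<alpha> i + m))(i := Suc ((\<alpha>(i := \<alpha> i + m)) i)))
          (\<lambda>v. - ((-1) ^ m * c * partial_deriv i ?D v))"
  proof (rule has_moment_limit_step)
    show "has_moment_limit K (\<alpha>(i := \<alpha> i + m)) (\<lambda>v. (-1) ^ m * c * ?D v)" by (rule conjunct1[OF Suc])
    show "((\<lambda>u. (-1) ^ m * c * ?D (v(i := u))) has_real_derivative (-1) ^ m * c * partial_deriv i ?D v) (at (v i))"
      if "v \<in> shift_domain" for v
      using smooth_on_shifts_partial_deriv(2)[OF conjunct2[OF Suc] that] by (rule DERIV_cmult)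
  qed fact
  moreover have "smooth_on_shifts (partial_deriv i ?D)"
    using smooth_on_shifts_partial_deriv(1) Suc by blast
  ultimately show ?case by (simp add: fun_upd_same del: fun_upd_apply)
qed

lemma has_moment_limit_foldr:
  assumes "has_moment_limit K \<alpha> (\<lambda>v. c * D v)" "smooth_on_shifts D" "\<And>r. r \<in> set rs \<Longrightarrow> \<iota> r \<in> coords K"
  shows "has_moment_limit K (foldr (\<lambda>r \<alpha>. \<alpha>(\<iota> r := \<alpha> (\<iota> r) + m r)) rs \<alpha>)
            (\<lambda>v. (-1) ^ sum_list (map m rs) * c * foldr (\<lambda>r. partial_deriv (\<iota> r) ^^ m r) rs D v)
         \<and> smooth_on_shifts (foldr (\<lambda>r. partial_deriv (\<iota> r) ^^ m r) rs D)"
  using assms(3)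
proof (induction rs)
  case Nil
  thus ?case using assms by simp
next
  case (Cons r rs)
  note IH = Cons.IH[OF Cons.prems[OF list.set_intros(2)]]
  from Cons have "\<iota> r \<in> coords K" by simp
  from has_moment_limit_funpow[OF conjunct1[OF IH] conjunct2[OF IH] this, of "m r"] show ?case
    by (simp add: power_add mult.assoc del: fun_upd_apply)
qed

text \<open>Reads off the exponents accumulated by the fold that accompanies the fold of
  derivatives; distinctness means that each coordinate is raised once.\<close>

lemma foldr_count_eq:
  assumes "inj \<iota>" "distinct rs"
  shows "foldr (\<lambda>r \<alpha>. \<alpha>(\<iota> r := \<alpha> (\<iota> r) + m r)) rs \<alpha> (\<iota> r) = \<alpha> (\<iota> r) + (if r \<in> set rs then m r else (0::nat))"
  using assms(2) by (induction rs) (auto dest: injD[OF assms(1)])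

lemma foldr_count_other:
  assumes "i \<notin> range \<iota>"
  shows "foldr (\<lambda>r \<alpha>. \<alpha>(\<iota> r := \<alpha> (\<iota> r) + m r)) rs \<alpha> i = \<alpha> i"
  using assms by (induction rs) auto

section \<open>Dirichlet coefficients with logarithms and their sums of squares\<close>

definition deriv_coeff :: "nat list \<Rightarrow> nat \<Rightarrow> real" where
  "deriv_coeff as = dconv (\<lambda>r d. ln (real d) ^ (as ! r)) (length as)"

lemma deriv_coeff_nonneg: "deriv_coeff as n \<ge> 0"
  unfolding deriv_coeff_def
  using dconv_mono[of "length as" "\<lambda>r d. ln (real d) ^ (as ! r)" "\<lambda>r d. ln (real d) ^ (as ! r)" n] by simp

text \<open>At v = 0 the twist extracts s^N n^(-s/2), N being the sum of the list, from each of the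
  two equal convolutions. Together they give s^(2N) n^(-s), which raises the power of s from K^2 to
  E.\<close>

lemma deriv_coeff_series_limit:
  fixes as :: "nat list"
  assumes "length as = Suc k"
  defines "E \<equiv> (Suc k)\<^sup>2 + 2 * sum_list as"
  shows "s > 0 \<Longrightarrow> summable (\<lambda>n. deriv_coeff as n ^ 2 / real n * real n powr (-s))"
    and "((\<lambda>s. s ^ E * (\<Sum>n. deriv_coeff as n ^ 2 / real n * real n powr (-s))) \<longlongrightarrow>
            arith_factor (Suc k) * mixed_deriv as (cauchy_kernel (Suc k)) (\<lambda>_. 0)) (at_right 0)"
proof -
  let ?K = "Suc k"
  define A where "A = arith_factor ?K"
  define \<alpha>1 where "\<alpha>1 = foldr (\<lambda>r \<alpha>. \<alpha>(Inr r := \<alpha> (Inr r) + as ! r)) [0..<?K] (\<lambda>_::nat+nat. 0)"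
  define \<alpha> where "\<alpha> = foldr (\<lambda>r \<alpha>. \<alpha>(Inl r := \<alpha> (Inl r) + as ! r)) [0..<?K] \<alpha>1"
  define D1 where "D1 = foldr (\<lambda>q. partial_deriv (Inr q) ^^ (as ! q)) [0..<?K] (cauchy_kernel ?K)"
  define D where "D = foldr (\<lambda>r. partial_deriv (Inl r) ^^ (as ! r)) [0..<?K] D1"
  have \<alpha>: "\<alpha> (Inl r) = as ! r" "\<alpha> (Inr r) = as ! r" if "r < ?K" for r
    using that unfolding \<alpha>_def \<alpha>1_def
    by (simp_all add: foldr_count_eq foldr_count_other image_iff del: upt_Suc)
  have N: "sum_list (map ((!) as) [0..<?K]) = sum_list as"
    using map_nth[of as] assms(1) by simp
  have "smooth_on_shifts (cauchy_kernel ?K)"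
    unfolding smooth_on_shifts_def cauchy_kernel_def
    by (intro exI[of _ "cauchy_kernel ?K", unfolded cauchy_kernel_def] conjI shift_rational_prod shift_rational.inv ballI refl)
  from has_moment_limit_foldr[OF has_moment_limit_base this, of "[0..<?K]" Inr "(!) as"]
  have 1: "has_moment_limit ?K \<alpha>1 (\<lambda>v. ((-1) ^ sum_list as * A) * D1 v)" "smooth_on_shifts D1"
    unfolding N \<alpha>1_def D1_def A_def by (auto simp: coords_def simp del: upt_Suc)
  from has_moment_limit_foldr[OF this, of "[0..<?K]" Inl "(!) as"]
  have "has_moment_limit ?K \<alpha> (\<lambda>v. (-1) ^ sum_list as * ((-1) ^ sum_list as * A) * D v)"
    unfolding N \<alpha>_def D_def by (auto simp: coords_def simp del: upt_Suc)
  \<comment> \<open>The x derivatives and the y derivatives contribute the same sign, and the two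
    cancel.\<close>
  also have "(-1) ^ sum_list as * ((-1) ^ sum_list as * A) = A"
    by (simp add: mult.assoc[symmetric] power_add[symmetric])
  finally have lim: "has_moment_limit ?K \<alpha> (\<lambda>v. A * D v)" .
  have "(\<lambda>_. 0) \<in> shift_domain" by (simp add: shift_domain_def)
  with lim have sm: "\<And>s. s \<in> {0<..1} \<Longrightarrow> summable (pair_term ?K (weight s \<alpha> (\<lambda>_. 0)))"
    and lim: "((\<lambda>s. s ^ (?K\<^sup>2) * (\<Sum>n. pair_term ?K (weight s \<alpha> (\<lambda>_. 0)) n)) \<longlongrightarrow> A * D (\<lambda>_. 0)) (at_right 0)"
    by (auto simp: has_moment_limit_def)
  have eq: "pair_term ?K (weight s \<alpha> (\<lambda>_. 0)) n =
              s ^ (2 * sum_list as) * (deriv_coeff as n ^ 2 / real n * real n powr (-s))" for s n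
  proof (cases "n = 0")
    case True
    thus ?thesis by (simp add: pair_term_def)
  next
    case False
    define f where "f = (\<lambda>r d. s ^ (as ! r) * ln (real d) ^ (as ! r) * real d powr (- (s / 2)))"
    have "dconv f ?K n = (\<Prod>r<?K. s ^ (as ! r)) * deriv_coeff as n * real n powr (- (s / 2))"
      unfolding f_def deriv_coeff_def assms(1) using False by (intro dconv_twist) (auto simp: powr_mult)
    also have "(\<Prod>r<?K. s ^ (as ! r)) = s ^ sum_list as"
      by (simp only: power_sum[symmetric] sum_list_sum_nth assms(1) atLeast0LessThan)
    finally have f: "dconv f ?K n = s ^ sum_list as * deriv_coeff as n * real n powr (- (s / 2))" .
    have "dconv (\<lambda>r. weight s \<alpha> (\<lambda>_. 0) (Inl r)) ?K n = dconv f ?K n"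
         "dconv (\<lambda>r. weight s \<alpha> (\<lambda>_. 0) (Inr r)) ?K n = dconv f ?K n"
      by (rule dconv_cong; simp add: f_def weight_def \<alpha> power_mult_distrib)+
    hence "pair_term ?K (weight s \<alpha> (\<lambda>_. 0)) n = dconv f ?K n * dconv f ?K n / real n"
      by (simp add: pair_term_def del: dconv.simps)
    also have "\<dots> = (s ^ sum_list as * s ^ sum_list as) * (deriv_coeff as n ^ 2 / real n *
                        (real n powr (- (s / 2)) * real n powr (- (s / 2))))"
      unfolding f by (simp add: power2_eq_square)
    also have "real n powr (- (s / 2)) * real n powr (- (s / 2)) = real n powr (- s)"
      by (simp add: powr_add[symmetric])
    also have "s ^ sum_list as * s ^ sum_list as = s ^ (2 * sum_list as)"
      by (simp add: power_add[symmetric] mult_2)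
    finally show ?thesis .
  qed
  have sm1: "summable (\<lambda>n. deriv_coeff as n ^ 2 / real n * real n powr (-s))" if s: "s \<in> {0<..1}" for s
    using sm[OF s] s unfolding eq[abs_def] by (subst (asm) summable_cmult_iff) auto
  show "summable (\<lambda>n. deriv_coeff as n ^ 2 / real n * real n powr (-s))" if s: "s > 0" for s
  \<comment> \<open>The limit statement covers s \<le> 1; for larger s the series at 1 dominates.
    Starting at n = 1 avoids comparing powers of 0.\<close>
  proof (rule summable_comparison_test'[OF sm1[of "min s 1"], where N = 1])
    fix n :: nat assume n: "n \<ge> 1"
    have "real n powr (-s) \<le> real n powr (- min s 1)" using n by (intro powr_mono) auto
    thus "norm (deriv_coeff as n ^ 2 / real n * real n powr (-s)) \<le> deriv_coeff as n ^ 2 / real n * real n powr (- min s 1)"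
      by (auto intro!: divide_right_mono mult_left_mono)
  qed (use s in auto)
  have "mixed_deriv as (cauchy_kernel ?K) (\<lambda>_. 0) = D (\<lambda>_. 0)"
    unfolding mixed_deriv_def D_def D1_def assms(1) ..
  moreover have "\<forall>\<^sub>F s in at_right 0. s ^ (?K\<^sup>2) * (\<Sum>n. pair_term ?K (weight s \<alpha> (\<lambda>_. 0)) n) =
      s ^ E * (\<Sum>n. deriv_coeff as n ^ 2 / real n * real n powr (-s))"
  proof (rule eventually_at_rightI[of 0 1])
    fix s :: real assume s: "s \<in> {0<..<1}"
    have "(\<Sum>n. pair_term ?K (weight s \<alpha> (\<lambda>_. 0)) n) =
            s ^ (2 * sum_list as) * (\<Sum>n. deriv_coeff as n ^ 2 / real n * real n powr (-s))"
      unfolding eq using s by (intro suminf_mult sm1) auto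
    thus "s ^ (?K\<^sup>2) * (\<Sum>n. pair_term ?K (weight s \<alpha> (\<lambda>_. 0)) n) =
            s ^ E * (\<Sum>n. deriv_coeff as n ^ 2 / real n * real n powr (-s))"
      by (simp only: E_def power_add mult.assoc)
  qed simp
  ultimately show "((\<lambda>s. s ^ E * (\<Sum>n. deriv_coeff as n ^ 2 / real n * real n powr (-s))) \<longlongrightarrow>
            arith_factor ?K * mixed_deriv as (cauchy_kernel ?K) (\<lambda>_. 0)) (at_right 0)"
    using Lim_transform_eventually[OF lim] by (simp add: A_def)
qed

text \<open>The factorial in Karamata's theorem with exponent E is the Gamma(E + 1) of
  \<open>moment_const\<close>. A nonempty list makes E positive, so E has the form
  \<open>Suc E'\<close> that the theorem asks for.\<close>

theorem deriv_coeff_square_sum_lower: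
  assumes "as \<noteq> []" "e > 0"
  shows "\<forall>\<^sub>F X in at_top. (\<Sum>n\<in>{1..nat \<lfloor>X\<rfloor>}. deriv_coeff as n ^ 2 / real n) \<ge>
           (moment_const as - e) * ln X ^ ((length as)\<^sup>2 + 2 * sum_list as)"
proof -
  obtain k where k: "length as = Suc k" using assms(1) by (cases as) auto
  define E where "E = (Suc k)\<^sup>2 + 2 * sum_list as"
  obtain E' where E': "E = Suc E'" unfolding E_def by (cases "(Suc k)\<^sup>2 + 2 * sum_list as") auto
  have "moment_const as = arith_factor (Suc k) * mixed_deriv as (cauchy_kernel (Suc k)) (\<lambda>_. 0) / fact (Suc E')"
    unfolding moment_const_def Let_def k E_def[symmetric] E'
    using Gamma_fact[of "Suc E'", where ?'a = real] by (simp add: add_ac)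
  thus ?thesis
    using karamata_lower[OF _ deriv_coeff_series_limit[OF k, folded E_def, unfolded E'] assms(2)]
    by (simp add: k E_def[symmetric] E' del: power_Suc fact_Suc)
qed

section \<open>The Dirichlet series of the product\<close>

text \<open>Absolute convergence allows the product of the series to be summed over pairs (d, e) and
  regrouped by n = d e. Summability of the norms is carried through the induction because the next
  regrouping uses it.\<close>

lemma dconv_has_sum:
  fixes f :: "nat \<Rightarrow> nat \<Rightarrow> complex"
  assumes "\<And>r. r < k \<Longrightarrow> (\<lambda>d. norm (f r d)) summable_on {1..}"
    and "\<And>r. r < k \<Longrightarrow> (f r has_sum L r) {1..}"
  shows "(\<lambda>n. norm (dconv f k n)) summable_on {1..} \<and> (dconv f k has_sum (\<Prod>r<k. L r)) {1..}"
  using assms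
proof (induction k)
  case 0
  have "(dconv f 0 has_sum 1) {1} \<longleftrightarrow> (dconv f 0 has_sum 1) {1..}"
    by (rule has_sum_cong_neutral) auto
  moreover have "(\<lambda>n. norm (dconv f 0 n)) summable_on {1} \<longleftrightarrow> (\<lambda>n. norm (dconv f 0 n)) summable_on {1..}"
    by (rule summable_on_cong_neutral) auto
  moreover have "(dconv f 0 has_sum 1) {1}" using has_sum_finite[of "{1}" "dconv f 0"] by simp
  moreover have "(\<lambda>n. norm (dconv f 0 n)) summable_on {1}" by (rule summable_on_finite) simp
  ultimately show ?case unfolding lessThan_0 prod.empty by blast
next
  case (Suc k)
  let ?g = "\<lambda>(d,e). f k d * dconv f k e"
  have IH: "(\<lambda>n. norm (dconv f k n)) summable_on {1..}" "(dconv f k has_sum (\<Prod>r<k. L r)) {1..}"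
    using Suc by auto
  have P: "(\<lambda>(d,e). norm (f k d * dconv f k e)) summable_on {1..} \<times> {1..}"
          "(?g has_sum (L k * (\<Prod>r<k. L r))) ({1..} \<times> {1..})"
    by (rule has_sum_mult_Times[OF Suc.prems(1)[of k] IH(1) Suc.prems(2)[of k] IH(2)]; simp)+
  have bij: "bij_betw (\<lambda>(n,d). (d, n div d)) (SIGMA n:{1::nat..}. {d. d dvd n}) ({1..} \<times> {1..})"
  proof (rule bij_betwI[where g = "\<lambda>(d,e). (d * e, d)"])
    show "(\<lambda>(n,d). (d, n div d)) \<in> (SIGMA n:{1::nat..}. {d. d dvd n}) \<rightarrow> {1..} \<times> {1..}"
    proof (rule funcsetI)
      fix x :: "nat \<times> nat" assume "x \<in> (SIGMA n:{1..}. {d. d dvd n})"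
      then obtain d e where "x = (d * e, d)" "d > 0" "e > 0" by (auto elim!: dvdE)
      thus "(case x of (n, d) \<Rightarrow> (d, n div d)) \<in> {1..} \<times> {1..}" by auto
    qed
  qed (auto elim!: dvdE)
  have S: "((\<lambda>(n,d). f k d * dconv f k (n div d)) has_sum (L k * (\<Prod>r<k. L r))) (SIGMA n:{1..}. {d. d dvd n})"
    using has_sum_reindex_bij_betw[OF bij, of ?g] P(2) by (simp add: case_prod_unfold)
  obtain B where B: "((\<lambda>(d,e). norm (f k d * dconv f k e)) has_sum B) ({1..} \<times> {1..})"
    using P(1) by (auto simp: summable_on_def)
  have S': "((\<lambda>(n,d). norm (f k d * dconv f k (n div d))) has_sum B) (SIGMA n:{1..}. {d. d dvd n})"
    using has_sum_reindex_bij_betw[OF bij, of "\<lambda>(d,e). norm (f k d * dconv f k e)"] B by (simp add: case_prod_unfold)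
  have fin: "finite {d. d dvd n}" if "n \<in> {1..}" for n :: nat using that by auto
  have "(dconv f (Suc k) has_sum (L k * (\<Prod>r<k. L r))) {1..}"
    unfolding dconv.simps by (rule has_sum_SigmaD[OF S]) (simp add: has_sum_finite fin)
  moreover have "((\<lambda>n. \<Sum>d | d dvd n. norm (f k d * dconv f k (n div d))) has_sum B) {1..}"
    by (rule has_sum_SigmaD[OF S']) (simp add: has_sum_finite fin)
  hence "(\<lambda>n. \<Sum>d | d dvd n. norm (f k d * dconv f k (n div d))) summable_on {1..}"
    by (auto simp: summable_on_def)
  hence "(\<lambda>n. norm (dconv f (Suc k) n)) summable_on {1..}"
    by (rule summable_on_comparison_test) (auto intro: norm_sum)
  ultimately show ?case by (simp add: mult.commute del: dconv.simps)
qed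

lemma summable_ln_powr:
  assumes "\<sigma> > 1"
  shows "summable (\<lambda>n. ln (real n) ^ k * real n powr (- \<sigma>))"
proof (rule summable_comparison_test_bigo)
  show "summable (\<lambda>n. norm (real n powr (- ((1 + \<sigma>) / 2))))"
    using assms by (simp add: summable_real_powr_iff)
  define c where "c = (\<sigma> - 1) / 2"
  have c: "c > 0" "- \<sigma> = - ((1 + \<sigma>) / 2) - c" using assms by (auto simp: c_def field_simps)
  show "(\<lambda>n. ln (real n) ^ k * real n powr (- \<sigma>)) \<in> O(\<lambda>n. real n powr (- ((1 + \<sigma>) / 2)))"
    unfolding c(2) using c(1) by real_asymp
qed

lemma norm_nat_powr': "n > 0 \<Longrightarrow> norm (of_nat n powr s :: complex) = real n powr Re s"
  using norm_powr_real_powr[of "of_nat n" s] by simp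

lemma nat_powr_mult: "of_nat (m * n) powr s = of_nat m powr s * (of_nat n powr s :: complex)"
  unfolding of_nat_mult by (rule powr_times_real) auto

text \<open>The series for the k-th derivative converges uniformly on small discs, so its partial
  sums can be differentiated term by term; each differentiation brings down -ln n.\<close>

lemma higher_deriv_zeta_sums:
  assumes "Re s > 1"
  shows "(\<lambda>n. (- of_real (ln (real (Suc n)))) ^ k * of_nat (Suc n) powr (- s)) sums (deriv ^^ k) riemann_zeta s"
  using assms
proof (induction k arbitrary: s)
  case 0
  thus ?case using riemann_zeta_props(3)[of s] by simp
next
  case (Suc k)
  define S where "S = {s::complex. Re s > 1}"
  have op: "open S" unfolding S_def by (rule open_halfspace_Re_gt)
  define t where "t = (\<lambda>k n s. (- complex_of_real (ln (real (Suc n)))) ^ k * of_nat (Suc n) powr (- s))"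
  have "\<exists>g'. \<forall>x\<in>S. ((deriv ^^ k) riemann_zeta has_field_derivative g' x) (at x) \<and>
           (\<lambda>N. \<Sum>n<N. t (Suc k) n x) \<longlonglongrightarrow> g' x"
  proof (rule has_complex_derivative_uniform_sequence[OF op, where f = "\<lambda>N x. \<Sum>n<N. t k n x"])
    show "((\<lambda>x. \<Sum>n<N. t k n x) has_field_derivative (\<Sum>n<N. t (Suc k) n x)) (at x)" for N x
    proof (intro DERIV_sum)
      fix n
      have "((\<lambda>x. of_nat (Suc n) powr (- x)) has_field_derivative
               of_real (ln (real (Suc n))) * of_nat (Suc n) powr (- x) * (- 1)) (at x)"
        using has_field_derivative_powr_right[of "of_nat (Suc n)" x] 
        by (intro DERIV_chain2[where g = uminus]) (auto intro!: derivative_eq_intros simp: Ln_of_nat simp del: of_nat_Suc)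
      from DERIV_cmult[OF this, of "(- complex_of_real (ln (real (Suc n)))) ^ k"]
      show "(t k n has_field_derivative t (Suc k) n x) (at x)"
        unfolding t_def by (simp add: mult_ac del: of_nat_Suc)
    qed
    fix x assume x: "x \<in> S"
    define d where "d = (Re x - 1) / 2"
    have d: "d > 0" using x by (simp add: d_def S_def)
    have Re: "Re y \<ge> 1 + d" if "y \<in> cball x d" for y
    proof -
      have "Re x - Re y \<le> norm (x - y)" using complex_Re_le_cmod[of "x - y"] by simp
      with that show ?thesis by (simp add: dist_norm d_def field_simps)
    qed
    hence sub: "cball x d \<subseteq> S" using d unfolding S_def by force
    have "uniform_limit (cball x d) (\<lambda>N x. \<Sum>n<N. t k n x) (\<lambda>x. \<Sum>n. t k n x) sequentially"
    proof (rule Weierstrass_m_test)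
      have "summable (\<lambda>n. ln (real n) ^ k * real n powr (- (1 + d)))"
        using d by (intro summable_ln_powr) auto
      thus "summable (\<lambda>n. ln (real (Suc n)) ^ k * real (Suc n) powr (- (1 + d)))"
        by (subst summable_Suc_iff)
      fix n y assume "y \<in> cball x d"
      from Re[OF this] have "real (Suc n) powr (- Re y) \<le> real (Suc n) powr (- (1 + d))"
        by (intro powr_mono) auto
      thus "norm (t k n y) \<le> ln (real (Suc n)) ^ k * real (Suc n) powr (- (1 + d))"
        unfolding t_def norm_mult norm_power norm_minus_cancel norm_nat_powr uminus_complex.sel
        by (auto intro!: mult_left_mono)
    qed
    also have "?this \<longleftrightarrow> uniform_limit (cball x d) (\<lambda>N x. \<Sum>n<N. t k n x) ((deriv ^^ k) riemann_zeta) sequentially"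
      using Suc.IH sub unfolding t_def S_def
      by (intro uniform_limit_cong') (auto simp: sums_iff)
    finally show "\<exists>d>0. cball x d \<subseteq> S \<and>
        uniform_limit (cball x d) (\<lambda>N x. \<Sum>n<N. t k n x) ((deriv ^^ k) riemann_zeta) sequentially"
      using d sub by blast
  qed
  then obtain g' where g': "((deriv ^^ k) riemann_zeta has_field_derivative g' s) (at s)"
     "(\<lambda>N. \<Sum>n<N. t (Suc k) n s) \<longlonglongrightarrow> g' s"
    using Suc.prems by (auto simp: S_def)
  have "(deriv ^^ Suc k) riemann_zeta s = g' s"
    using DERIV_imp_deriv[OF g'(1)] by simp
  thus ?case using g'(2) by (simp add: sums_def t_def)
qed

text \<open>The inserted signs turn the coefficients (-ln n)^a into nonnegative ones and leave the
  absolute value unchanged.\<close>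

definition zeta_prod :: "nat list \<Rightarrow> complex \<Rightarrow> complex" where
  "zeta_prod as s = (\<Prod>r<length as. (- 1) ^ (as ! r) * (deriv ^^ (as ! r)) riemann_zeta s)"

lemma zeta_prod_has_sum:
  assumes "Re s > 1"
  shows "(\<lambda>n. deriv_coeff as n * real n powr (- Re s)) summable_on {1..}"
    and "((\<lambda>n. of_real (deriv_coeff as n) * of_nat n powr (- s)) has_sum zeta_prod as s) {1..}"
proof -
  define f where "f = (\<lambda>r d. 1 * complex_of_real (ln (real d) ^ (as ! r)) * of_nat d powr (- s))"
  have f: "dconv f (length as) n = of_real (deriv_coeff as n) * of_nat n powr (- s)" if "n > 0" for n
  proof -
    have "dconv f (length as) n = (\<Prod>r<length as. 1) *
             dconv (\<lambda>r d. complex_of_real (ln (real d) ^ (as ! r))) (length as) n * of_nat n powr (- s)"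
      unfolding f_def using that by (intro dconv_twist nat_powr_mult) auto
    thus ?thesis by (simp only: dconv_of_real deriv_coeff_def prod.neutral_const mult_1_left)
  qed
  have 1: "(\<lambda>d. norm (f r d)) summable_on {1..}" for r
  proof -
    have "(\<lambda>d. ln (real d) ^ (as ! r) * real d powr (- Re s)) summable_on UNIV"
    proof (intro summable_nonneg_imp_summable_on summable_ln_powr assms)
      have "ln (real n) \<ge> 0" for n by (cases n) auto
      thus "0 \<le> ln (real d) ^ (as ! r) * real d powr (- Re s)" for d by simp
    qed
    hence "(\<lambda>d. ln (real d) ^ (as ! r) * real d powr (- Re s)) summable_on {1..}"
      by (rule summable_on_subset_banach) auto
    also have "?this \<longleftrightarrow> ?thesis"
      by (intro summable_on_cong) (auto simp: f_def norm_mult norm_power norm_nat_powr')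
    finally show ?thesis .
  qed
  have 2: "(f r has_sum ((- 1) ^ (as ! r) * (deriv ^^ (as ! r)) riemann_zeta s)) {1..}" for r
  proof -
    have sm: "f r summable_on {1..}" using 1[of r] by (rule abs_summable_summable)
    then obtain l where l: "(f r has_sum l) {1..}" by (auto simp: summable_on_def)
    hence "((\<lambda>n. f r (Suc n)) has_sum l) UNIV"
      by (subst has_sum_reindex_bij_witness[of UNIV "\<lambda>n. n - 1" Suc "{1..}" "f r" _ _ l]) auto
    hence "(\<lambda>n. f r (Suc n)) sums l" by (rule has_sum_imp_sums)
    moreover have "(\<lambda>n. (- 1) ^ (as ! r) * ((- of_real (ln (real (Suc n)))) ^ (as ! r) * of_nat (Suc n) powr (- s)))
            sums ((- 1) ^ (as ! r) * (deriv ^^ (as ! r)) riemann_zeta s)"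
      by (intro sums_mult higher_deriv_zeta_sums assms)
    moreover have "(- 1) ^ (as ! r) * ((- of_real (ln (real (Suc n)))) ^ (as ! r) * of_nat (Suc n) powr (- s)) = f r (Suc n)" for n
      unfolding f_def by (simp add: power_mult_distrib[symmetric] mult.assoc[symmetric])
    ultimately show ?thesis using l by (simp add: sums_iff del: of_nat_Suc)
  qed
  have D: "(\<lambda>n. norm (dconv f (length as) n)) summable_on {1..}" "(dconv f (length as) has_sum zeta_prod as s) {1..}"
    unfolding zeta_prod_def
    using dconv_has_sum[of "length as" f "\<lambda>r. (- 1) ^ (as ! r) * (deriv ^^ (as ! r)) riemann_zeta s"] 1 2
    by blast+
  have "(\<lambda>n. norm (dconv f (length as) n)) summable_on {1..} \<longleftrightarrow>
      (\<lambda>n. deriv_coeff as n * real n powr (- Re s)) summable_on {1..}"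
    by (intro summable_on_cong) (auto simp: f norm_mult norm_nat_powr' deriv_coeff_nonneg)
  with D(1) show "(\<lambda>n. deriv_coeff as n * real n powr (- Re s)) summable_on {1..}" by simp
  have "(dconv f (length as) has_sum zeta_prod as s) {1..} \<longleftrightarrow>
    ((\<lambda>n. of_real (deriv_coeff as n) * of_nat n powr (- s)) has_sum zeta_prod as s) {1..}"
    by (intro has_sum_cong) (auto simp: f)
  with D(2) show "((\<lambda>n. of_real (deriv_coeff as n) * of_nat n powr (- s)) has_sum zeta_prod as s) {1..}" by simp
qed

section \<open>Polynomial growth of zeta and its derivatives away from the pole\<close>

lemma zeta_growth:
  obtains C where "C > 0" "\<And>s. Re s \<ge> 1/4 \<Longrightarrow> \<bar>Im s\<bar> \<ge> 1/2 \<Longrightarrow> norm (riemann_zeta s) \<le> C * (norm s + 2) ^ 2"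
proof -
  define Z where "Z = (\<Sum>n. real (Suc n) powr (- 5 / 4))"
  have smZ: "summable (\<lambda>n. real (Suc n) powr (- 5 / 4))" by (rule summable_real_powr_Suc) simp
  have Z: "Z \<ge> 0" unfolding Z_def by (intro suminf_nonneg smZ) auto
  have "norm (riemann_zeta s) \<le> 2 * (1 + Z) * (norm s + 2) ^ 2" if s: "Re s \<ge> 1/4" "\<bar>Im s\<bar> \<ge> 1/2" for s
  proof -
    have ne: "s \<noteq> 1" using s(2) by auto
    define S where "S = (\<Sum>n. zeta_taylor_term 1 n s)"
    \<comment> \<open>For Re s \<ge> 1/4 the terms are summable uniformly, with exponent -5/4. The
      margin left of the critical line is room for Cauchy's inequality.\<close>
    have bd: "norm (zeta_taylor_term 1 n s) \<le> (norm s + 2) ^ 2 * real (Suc n) powr (- 5 / 4)" for n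
    proof -
      have "norm (zeta_taylor_term 1 n s) \<le> (\<Prod>j\<le>1. norm s + 1 + real j) * real (Suc n) powr (- Re s - real 1)"
        using s by (intro norm_zeta_taylor_term_le) auto
      also have "\<dots> \<le> (norm s + 2) ^ 2 * real (Suc n) powr (- 5 / 4)"
      proof (intro mult_mono powr_mono)
        show "(\<Prod>j\<le>1. norm s + 1 + real j) \<le> (norm s + 2) ^ 2"
          by (simp add: power2_eq_square algebra_simps)
      qed (use s in auto)
      finally show ?thesis .
    qed
    have "norm S \<le> (\<Sum>n. (norm s + 2) ^ 2 * real (Suc n) powr (- 5 / 4))"
      unfolding S_def by (intro norm_suminf_le bd summable_mult smZ)
    also have "\<dots> = (norm s + 2) ^ 2 * Z" unfolding Z_def by (intro suminf_mult smZ)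
    finally have S: "norm S \<le> (norm s + 2) ^ 2 * Z" .
    have "norm (s - 1) * norm (riemann_zeta s) = norm (1 + S)"
      using zeta_eq_taylor[of s] s ne by (simp add: S_def flip: norm_mult)
    also have "\<dots> \<le> 1 + (norm s + 2) ^ 2 * Z" using S norm_triangle_ineq[of 1 S] by simp
    also have "1 \<le> (norm s + 2) ^ 2" by (rule one_le_power) simp
    finally have "norm (s - 1) * norm (riemann_zeta s) \<le> (1 + Z) * (norm s + 2) ^ 2"
      by (simp add: algebra_simps)
    moreover have "1 / 2 \<le> norm (s - 1)" using abs_Im_le_cmod[of "s - 1"] s by simp
    hence "1 / 2 * norm (riemann_zeta s) \<le> norm (s - 1) * norm (riemann_zeta s)"
      by (intro mult_right_mono) auto
    ultimately have "1 / 2 * norm (riemann_zeta s) \<le> (1 + Z) * (norm s + 2) ^ 2" by linarith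
    thus ?thesis by (simp add: algebra_simps)
  qed
  thus ?thesis using Z that[of "2 * (1 + Z)"] by auto
qed

text \<open>Cauchy's inequality on circles of radius 1/4, which remain in the region Re s \<ge> 1/4,
  |Im s| \<ge> 1/2 where zeta itself is bounded polynomially.\<close>

lemma higher_deriv_zeta_growth:
  obtains C where "C > 0" "\<And>s. Re s \<ge> 1/2 \<Longrightarrow> \<bar>Im s\<bar> \<ge> 1 \<Longrightarrow> norm ((deriv ^^ n) riemann_zeta s) \<le> C * (norm s + 3) ^ 2"
proof -
  obtain C where C: "C > 0" "\<And>s. Re s \<ge> 1/4 \<Longrightarrow> \<bar>Im s\<bar> \<ge> 1/2 \<Longrightarrow> norm (riemann_zeta s) \<le> C * (norm s + 2) ^ 2"
    using zeta_growth by blast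
  have "norm ((deriv ^^ n) riemann_zeta s) \<le> (fact n * C / (1 / 4) ^ n) * (norm s + 3) ^ 2"
    if s: "Re s \<ge> 1/2" "\<bar>Im s\<bar> \<ge> 1" for s
  proof -
    have sub: "cball s (1/4) \<subseteq> - {1}"
    proof -
      have "norm (s - 1) \<ge> 1" using abs_Im_le_cmod[of "s - 1"] s by simp
      thus ?thesis by (auto simp: dist_norm)
    qed
    have "norm ((deriv ^^ n) riemann_zeta s) \<le> fact n * (C * (norm s + 3) ^ 2) / (1 / 4) ^ n"
    proof (rule Cauchy_inequality)
      show "riemann_zeta holomorphic_on ball s (1/4)"
        by (rule holomorphic_on_subset[OF riemann_zeta_props(1)]) (use sub in auto)
      show "continuous_on (cball s (1/4)) riemann_zeta"
        by (intro holomorphic_on_imp_continuous_on holomorphic_on_subset[OF riemann_zeta_props(1)] sub)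
      fix x assume x: "norm (s - x) = 1/4"
      have "\<bar>Re s - Re x\<bar> \<le> 1/4" "\<bar>Im s - Im x\<bar> \<le> 1/4"
        using abs_Re_le_cmod[of "s - x"] abs_Im_le_cmod[of "s - x"] x by auto
      hence "norm (riemann_zeta x) \<le> C * (norm x + 2) ^ 2" using s by (intro C) linarith+
      also have "\<dots> \<le> C * (norm s + 3) ^ 2"
      proof (intro mult_left_mono power_mono)
        show "norm x + 2 \<le> norm s + 3" using norm_triangle_ineq2[of x s] x by (simp add: norm_minus_commute)
      qed (use C in auto)
      finally show "norm (riemann_zeta x) \<le> C * (norm s + 3) ^ 2" .
    qed auto
    thus ?thesis by (simp add: mult_ac)
  qed
  thus ?thesis using C(1) that[of "fact n * C / (1 / 4) ^ n"] by auto
qed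

lemma zeta_prod_growth:
  obtains C where "C > 0"
    "\<And>s. Re s \<ge> 1/2 \<Longrightarrow> \<bar>Im s\<bar> \<ge> 1 \<Longrightarrow> norm (zeta_prod as s) \<le> C * (norm s + 3) ^ (2 * length as)"
proof -
  have "\<forall>n. \<exists>C>0. \<forall>s. Re s \<ge> 1/2 \<longrightarrow> \<bar>Im s\<bar> \<ge> 1 \<longrightarrow> norm ((deriv ^^ n) riemann_zeta s) \<le> C * (norm s + 3) ^ 2"
    using higher_deriv_zeta_growth by metis
  then obtain C where C: "\<And>n. C n > 0" "\<And>n s. Re s \<ge> 1/2 \<Longrightarrow> \<bar>Im s\<bar> \<ge> 1 \<Longrightarrow> norm ((deriv ^^ n) riemann_zeta s) \<le> C n * (norm s + 3) ^ 2"
    by metis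
  have "norm (zeta_prod as s) \<le> (\<Prod>r<length as. C (as ! r)) * (norm s + 3) ^ (2 * length as)"
    if "Re s \<ge> 1/2" "\<bar>Im s\<bar> \<ge> 1" for s
  proof -
    have "norm (zeta_prod as s) = (\<Prod>r<length as. norm ((deriv ^^ (as ! r)) riemann_zeta s))"
      by (simp add: zeta_prod_def norm_mult norm_power flip: prod_norm)
    also have "\<dots> \<le> (\<Prod>r<length as. C (as ! r) * (norm s + 3) ^ 2)"
      using C(2) that by (intro prod_mono) auto
    also have "\<dots> = (\<Prod>r<length as. C (as ! r)) * (norm s + 3) ^ (2 * length as)"
      by (simp add: prod.distrib power_mult)
    finally show ?thesis .
  qed
  thus ?thesis using that[of "\<Prod>r<length as. C (as ! r)"] C(1) by (auto intro: prod_pos)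
qed

lemma zeta_prod_holomorphic: "zeta_prod as holomorphic_on - {1}"
  unfolding zeta_prod_def
  by (intro holomorphic_intros holomorphic_higher_deriv riemann_zeta_props(1)) auto

section \<open>Gaussian means of Dirichlet polynomials\<close>

text \<open>The substitution t = u + H x reduces this to the characteristic function of the standard
  normal distribution.\<close>

lemma normal_density_fourier:
  assumes H: "H > 0"
  shows "(LINT t|lborel. of_real (normal_density u H t) * exp (\<i> * of_real (\<xi> * t)) :: complex) =
           exp (\<i> * of_real (\<xi> * u)) * of_real (exp (- (H * \<xi>)\<^sup>2 / 2))"
proof -
  have "(LINT t|lborel. of_real (normal_density u H t) * exp (\<i> * of_real (\<xi> * t)) :: complex) =
         \<bar>H\<bar> *\<^sub>R (LINT x|lborel. of_real (normal_density u H (u + H * x)) * exp (\<i> * of_real (\<xi> * (u + H * x))))"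
    using H by (intro lborel_integral_real_affine) auto
  also have "\<dots> = (LINT x|lborel. exp (\<i> * of_real (\<xi> * u)) * (std_normal_density x *\<^sub>R exp (\<i> * of_real ((H * \<xi>) * x))))"
  proof -
    have "\<bar>H\<bar> *\<^sub>R (of_real (normal_density u H (u + H * x)) * exp (\<i> * of_real (\<xi> * (u + H * x)))) =
            exp (\<i> * of_real (\<xi> * u)) * (std_normal_density x *\<^sub>R exp (\<i> * of_real ((H * \<xi>) * x)))" for x
    proof -
      have "H * normal_density u H (u + H * x) = std_normal_density x"
        using H by (simp add: normal_density_def real_sqrt_mult power_mult_distrib)
      hence "\<bar>H\<bar> *\<^sub>R of_real (normal_density u H (u + H * x)) = (of_real (std_normal_density x) :: complex)"
        using H by (metis abs_of_pos of_real_mult scaleR_conv_of_real)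
      moreover have "exp (\<i> * of_real (\<xi> * (u + H * x))) = exp (\<i> * of_real (\<xi> * u)) * exp (\<i> * of_real ((H * \<xi>) * x))"
        by (simp add: exp_add[symmetric] algebra_simps)
      ultimately show ?thesis
        by (metis mult.left_commute mult_scaleR_left scaleR_conv_of_real)
    qed
    thus ?thesis by (simp flip: integral_scaleR_right)
  qed
  also have "\<dots> = exp (\<i> * of_real (\<xi> * u)) * (LINT x|lborel. std_normal_density x *\<^sub>R exp (\<i> * of_real ((H * \<xi>) * x)))"
    by (rule integral_mult_right_zero)
  also have "(LINT x|lborel. std_normal_density x *\<^sub>R exp (\<i> * of_real ((H * \<xi>) * x))) =
               char std_normal_distribution (H * \<xi>)"
    unfolding char_def by (subst integral_density) auto
  finally show ?thesis by (simp add: char_std_normal_distribution)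
qed

text \<open>Outside the window |t - u| \<ge> \<Delta>. Half of the Gaussian exponent pays for the
  small factor; the other half is a normal density of variance 2 H^2, whose normalisation costs sqrt
  2.\<close>

lemma normal_density_window:
  assumes H: "H > 0" and "\<Delta> \<ge> 0" "T1 + \<Delta> \<le> u" "u \<le> T2 - \<Delta>"
  shows "norm (integral {T1..T2} (\<lambda>t. of_real (normal_density u H t) * exp (\<i> * of_real (\<xi> * t))) -
            exp (\<i> * of_real (\<xi> * u)) * of_real (exp (- (H * \<xi>)\<^sup>2 / 2)) :: complex)
         \<le> sqrt 2 * exp (- \<Delta>\<^sup>2 / (4 * H\<^sup>2))"
proof -
  define q where "q = (\<lambda>t. of_real (normal_density u H t) * exp (\<i> * of_real (\<xi> * t)) :: complex)"
  have nq: "norm (q t) = normal_density u H t" for t by (simp add: q_def norm_mult)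
  have qm [measurable]: "q \<in> borel_measurable borel" unfolding q_def by measurable
  have qi: "integrable lborel q"
    by (rule Bochner_Integration.integrable_bound[OF integrable_normal_density[OF H, of u]]) (auto simp: nq)
  define S where "S = {T1..T2}"
  have Si: "set_integrable lborel S q" "set_integrable lborel (- S) q"
    using qi unfolding S_def by (auto intro!: integrable_mult_indicator simp: set_integrable_def)
  define H' where "H' = sqrt 2 * H"
  have H': "H' > 0" "H'\<^sup>2 = 2 * H\<^sup>2" using H by (auto simp: H'_def power_mult_distrib)
  define c where "c = sqrt 2 * exp (- \<Delta>\<^sup>2 / (4 * H\<^sup>2))"
  have "(LINT t|lborel. q t) - (LINT t:S|lborel. q t) = (LINT t:-S|lborel. q t)"
  proof -
    have "(LINT t:S \<union> -S|lborel. q t) = (LINT t:S|lborel. q t) + (LINT t:-S|lborel. q t)"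
      by (rule set_integral_Un[OF _ Si]) auto
    thus ?thesis by (simp add: set_lebesgue_integral_def)
  qed
  also have "norm \<dots> \<le> (LINT t|lborel. c * normal_density u H' t)"
    unfolding set_lebesgue_integral_def
  proof (rule Bochner_Integration.integral_norm_bound_integral)
    show "integrable lborel (\<lambda>t. indicator (- S) t *\<^sub>R q t)" using Si(2) by (simp add: set_integrable_def)
    show "integrable lborel (\<lambda>t. c * normal_density u H' t)"
      by (intro integrable_mult_right integrable_normal_density H')
    fix t
    show "norm (indicator (- S) t *\<^sub>R q t) \<le> c * normal_density u H' t"
    proof (cases "t \<in> S")
      case True
      thus ?thesis using H by (auto simp: c_def)
    next
      case False
      hence "\<bar>t - u\<bar> \<ge> \<Delta>" using assms by (auto simp: S_def)
      hence sq: "(t - u)\<^sup>2 \<ge> \<Delta>\<^sup>2" using assms(2) by (metis abs_le_square_iff abs_of_nonneg)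
      have "- (t - u)\<^sup>2 / (2 * H\<^sup>2) = - (t - u)\<^sup>2 / (4 * H\<^sup>2) + - (t - u)\<^sup>2 / (2 * H'\<^sup>2)"
        using H by (simp add: H' field_simps)
      also have "\<dots> \<le> - \<Delta>\<^sup>2 / (4 * H\<^sup>2) + - (t - u)\<^sup>2 / (2 * H'\<^sup>2)"
        using sq H by (intro add_mono divide_right_mono) auto
      finally have "exp (- (t - u)\<^sup>2 / (2 * H\<^sup>2)) \<le> exp (- \<Delta>\<^sup>2 / (4 * H\<^sup>2)) * exp (- (t - u)\<^sup>2 / (2 * H'\<^sup>2))"
        by (simp add: exp_add[symmetric])
      moreover have "1 / sqrt (2 * pi * H\<^sup>2) = sqrt 2 * (1 / sqrt (2 * pi * H'\<^sup>2))"
        using H by (simp add: H' real_sqrt_mult field_simps)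
      ultimately have "normal_density u H t \<le> c * normal_density u H' t"
        unfolding normal_density_def c_def by (simp add: divide_right_mono mult.assoc)
      thus ?thesis using False by (simp add: nq)
    qed
  qed
  also have "\<dots> = c" using H' by simp
  also have "(LINT t:S|lborel. q t) = integral S q"
    by (rule set_borel_integral_eq_integral(2)[OF Si(1)])
  finally show ?thesis
    using normal_density_fourier[OF H, of u \<xi>]
    by (simp add: q_def S_def c_def norm_minus_commute)
qed

text \<open>From ln x \<le> x - 1, logarithms of distinct integers near n differ by at least 1 / (n
  + 1). The bound is in terms of n alone, so m may run over a much longer range, as it does in the
  correlation of a long sum with a short one.\<close>

lemma ln_gap:
  assumes "m \<noteq> n" "m \<ge> 1" "n \<ge> 1" "n \<le> X"
  shows "\<bar>ln (real n) - ln (real m)\<bar> \<ge> 1 / (2 * real X)"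
proof (cases "n < m")
  case True
  have "ln (real n / real m) \<le> real n / real m - 1" using assms by (intro ln_le_minus_one) auto
  also have "real n / real m \<le> real n / (real n + 1)" using assms True by (intro divide_left_mono) auto
  also have "real n / (real n + 1) - 1 = - (1 / (real n + 1))" by (simp add: field_simps)
  finally have "ln (real m) - ln (real n) \<ge> 1 / (real n + 1)" using assms by (simp add: ln_div)
  moreover have "1 / (real n + 1) \<ge> 1 / (2 * real X)" using assms by (intro divide_left_mono) auto
  ultimately show ?thesis by linarith
next
  case False
  hence "m < n" using assms by simp
  have "ln (real m / real n) \<le> real m / real n - 1" using assms by (intro ln_le_minus_one) auto
  also have "real m / real n \<le> (real n - 1) / real n" using assms \<open>m < n\<close> by (intro divide_right_mono) auto
  also have "(real n - 1) / real n - 1 = - (1 / real n)" using assms by (simp add: field_simps)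
  finally have "ln (real n) - ln (real m) \<ge> 1 / real n" using assms by (simp add: ln_div)
  moreover have "1 / real n \<ge> 1 / (2 * real X)" using assms by (intro divide_left_mono) auto
  ultimately show ?thesis by linarith
qed

definition dpoly :: "(nat \<Rightarrow> real) \<Rightarrow> nat \<Rightarrow> complex \<Rightarrow> complex" where
  "dpoly a M s = (\<Sum>m=1..M. of_real (a m) * of_nat m powr (- s))"

lemma nat_powr_critical:
  assumes "m \<ge> 1"
  shows "(of_nat m :: complex) powr (- (1 / 2 + \<i> * of_real t)) =
           of_real (real m powr (- (1 / 2))) * exp (- \<i> * of_real (ln (real m) * t))"
proof -
  have "(of_nat m :: complex) powr (- (1 / 2 + \<i> * of_real t)) =
          exp (of_real (- (1 / 2) * ln (real m)) + (- \<i> * of_real (ln (real m) * t)))"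
  proof -
    have "- (1 / 2 + \<i> * of_real t) * complex_of_real (ln (real m)) =
            of_real (- (1 / 2) * ln (real m)) + (- \<i> * of_real (ln (real m) * t))"
      by (simp add: algebra_simps)
    thus ?thesis using assms by (simp only: powr_def Ln_of_nat of_nat_eq_0_iff) auto
  qed
  also have "\<dots> = exp (of_real (- (1 / 2) * ln (real m))) * exp (- \<i> * of_real (ln (real m) * t))"
    by (rule exp_add)
  also have "exp (of_real (- (1 / 2) * ln (real m))) = (of_real (real m powr (- (1 / 2))) :: complex)"
    using assms by (subst exp_of_real) (simp add: powr_def)
  finally show ?thesis .
qed

text \<open>Each pair (m, n) yields the Fourier transform of the Gaussian at ln(n / m): 1 on the
  diagonal, at most exp(-H^2 / (8 X^2)) off it, plus a window error. Equality m = n forces n \<le>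
  X, so the main term has length X however long the other factor is.\<close>

lemma dpoly_mean_value:
  assumes a: "\<And>n. a n \<ge> 0" and H: "H > 0" and "\<Delta> \<ge> 0" "T1 + \<Delta> \<le> u" "u \<le> T2 - \<Delta>"
    and X: "1 \<le> X" "X \<le> M"
  shows "norm (integral {T1..T2} (\<lambda>t. of_real (normal_density u H t) *
              (dpoly a M (1 / 2 + \<i> * of_real t) * cnj (dpoly a X (1 / 2 + \<i> * of_real t)))) -
            of_real (\<Sum>n=1..X. a n ^ 2 / real n))
         \<le> (\<Sum>m=1..M. a m * real m powr (- (1 / 2))) ^ 2 *
            (exp (- H\<^sup>2 / (8 * real X ^ 2)) + sqrt 2 * exp (- \<Delta>\<^sup>2 / (4 * H\<^sup>2)))"
proof -
  define \<tau> where "\<tau> = sqrt 2 * exp (- \<Delta>\<^sup>2 / (4 * H\<^sup>2))"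
  define \<epsilon> where "\<epsilon> = exp (- H\<^sup>2 / (8 * real X ^ 2))"
  define b where "b = (\<lambda>m. a m * real m powr (- (1 / 2)))"
  have b: "b m \<ge> 0" for m using a by (simp add: b_def)
  define q where "q = (\<lambda>m n t. of_real (normal_density u H t) * exp (\<i> * of_real ((ln (real n) - ln (real m)) * t)) :: complex)"
  have cq: "continuous_on A (q m n)" for A m n
    unfolding q_def normal_density_def using H by (intro continuous_intros) auto
  have "dpoly a N (1 / 2 + \<i> * of_real t) = (\<Sum>m=1..N. of_real (b m) * exp (- \<i> * of_real (ln (real m) * t)))" for N t
    unfolding dpoly_def b_def
  proof (intro sum.cong refl)
    fix m assume "m \<in> {1..N}"
    thus "of_real (a m) * of_nat m powr - (1 / 2 + \<i> * of_real t) =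
            of_real (a m * real m powr - (1 / 2)) * exp (- \<i> * of_real (ln (real m) * t))"
      by (subst nat_powr_critical) auto
  qed
  note dp = this
  have "of_real (normal_density u H t) * (dpoly a M (1 / 2 + \<i> * of_real t) * cnj (dpoly a X (1 / 2 + \<i> * of_real t))) =
     (\<Sum>m=1..M. \<Sum>n=1..X. of_real (b m * b n) * q m n t)" for t
  proof -
    have "of_real (normal_density u H t) *
            ((of_real (b m) * exp (- \<i> * of_real (ln (real m) * t))) * cnj (of_real (b n) * exp (- \<i> * of_real (ln (real n) * t))))
          = of_real (b m * b n) * q m n t" for m n
    proof -
      have "exp (- \<i> * of_real (ln (real m) * t)) * cnj (exp (- \<i> * of_real (ln (real n) * t))) =
              exp (\<i> * of_real ((ln (real n) - ln (real m)) * t))"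
        by (simp add: exp_cnj exp_add[symmetric] algebra_simps)
      thus ?thesis by (simp add: q_def mult_ac)
    qed
    thus ?thesis unfolding dp cnj_sum sum_product by (simp only: sum_distrib_left)
  qed
  hence "integral {T1..T2} (\<lambda>t. of_real (normal_density u H t) *
              (dpoly a M (1 / 2 + \<i> * of_real t) * cnj (dpoly a X (1 / 2 + \<i> * of_real t)))) =
         integral {T1..T2} (\<lambda>t. \<Sum>m=1..M. \<Sum>n=1..X. of_real (b m * b n) * q m n t)" by simp
  also have "\<dots> = (\<Sum>m=1..M. \<Sum>n=1..X. of_real (b m * b n) * integral {T1..T2} (q m n))"
    by (simp add: integral_sum integrable_continuous_interval cq continuous_intros)
  finally have eq: "integral {T1..T2} (\<lambda>t. of_real (normal_density u H t) *
              (dpoly a M (1 / 2 + \<i> * of_real t) * cnj (dpoly a X (1 / 2 + \<i> * of_real t)))) =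
       (\<Sum>m=1..M. \<Sum>n=1..X. of_real (b m * b n) * integral {T1..T2} (q m n))" .
  have "(\<Sum>m=1..M. \<Sum>n=1..X. of_real (b m * b n) * (if m = n then 1 else 0 :: complex)) =
          (\<Sum>m=1..M. if m \<in> {1..X} then of_real (b m * b m) else 0)"
    by (intro sum.cong refl) (simp add: if_distrib[of "\<lambda>x. _ * x"] cong: if_cong)
  also have "\<dots> = (\<Sum>m\<in>{1..M} \<inter> {1..X}. of_real (b m * b m))"
    by (subst sum.inter_restrict) auto
  also have "{1..M} \<inter> {1..X} = {1..X}" using X by auto
  also have "(\<Sum>m=1..X. complex_of_real (b m * b m)) = of_real (\<Sum>n=1..X. a n ^ 2 / real n)"
    unfolding of_real_sum b_def
    by (intro sum.cong refl) (simp add: power2_eq_square powr_add[symmetric] powr_minus field_simps)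
  finally have eq2: "of_real (\<Sum>n=1..X. a n ^ 2 / real n) =
       (\<Sum>m=1..M. \<Sum>n=1..X. of_real (b m * b n) * (if m = n then 1 else 0 :: complex))" by simp
  have bd: "norm (integral {T1..T2} (q m n) - (if m = n then 1 else 0)) \<le> \<epsilon> + \<tau>"
    if "m \<in> {1..M}" "n \<in> {1..X}" for m n
  proof -
    define \<xi> where "\<xi> = ln (real n) - ln (real m)"
    define e where "e = exp (\<i> * of_real (\<xi> * u)) * complex_of_real (exp (- (H * \<xi>)\<^sup>2 / 2))"
    have 1: "norm (integral {T1..T2} (q m n) - e) \<le> \<tau>"
      using normal_density_window[OF H assms(3-5), of \<xi>] unfolding \<tau>_def q_def e_def \<xi>_def .
    have 2: "norm (e - (if m = n then 1 else 0)) \<le> \<epsilon>"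
    proof (cases "m = n")
      case True
      thus ?thesis by (simp add: e_def \<xi>_def \<epsilon>_def)
    next
      case False
      have "1 / (2 * real X) \<le> \<bar>\<xi>\<bar>" unfolding \<xi>_def using that False by (intro ln_gap) auto
      hence "(1 / (2 * real X))\<^sup>2 \<le> \<xi>\<^sup>2" using X by (subst abs_le_square_iff[symmetric]) auto
      hence "H\<^sup>2 * (1 / (2 * real X))\<^sup>2 \<le> H\<^sup>2 * \<xi>\<^sup>2" by (intro mult_left_mono) auto
      hence "- (H * \<xi>)\<^sup>2 / 2 \<le> - H\<^sup>2 / (8 * real X ^ 2)"
        by (simp add: power_mult_distrib power_divide)
      thus ?thesis using False by (simp add: e_def \<epsilon>_def norm_mult)
    qed
    show ?thesis using norm_triangle_ineq[of "integral {T1..T2} (q m n) - e" "e - (if m = n then 1 else 0)"] 1 2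
      by simp
  qed
  have "norm ((\<Sum>m=1..M. \<Sum>n=1..X. of_real (b m * b n) * integral {T1..T2} (q m n)) -
         (\<Sum>m=1..M. \<Sum>n=1..X. of_real (b m * b n) * (if m = n then 1 else 0 :: complex)))
      = norm (\<Sum>m=1..M. \<Sum>n=1..X. of_real (b m * b n) * (integral {T1..T2} (q m n) - (if m = n then 1 else 0)))"
    by (simp only: sum_subtractf right_diff_distrib)
  also have "\<dots> \<le> (\<Sum>m=1..M. \<Sum>n=1..X. b m * b n * (\<epsilon> + \<tau>))"
  proof (intro sum_norm_le)
    fix m n assume "m \<in> {1..M}" "n \<in> {1..X}"
    from mult_left_mono[OF bd[OF this], of "b m * b n"] b[of m] b[of n]
    show "norm (of_real (b m * b n) * (integral {T1..T2} (q m n) - (if m = n then 1 else 0)))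
            \<le> b m * b n * (\<epsilon> + \<tau>)"
      unfolding norm_mult norm_of_real by simp
  qed
  also have "\<dots> = (\<Sum>m=1..M. b m) * (\<Sum>n=1..X. b n) * (\<epsilon> + \<tau>)"
    by (subst sum_product) (simp only: sum_distrib_right)
  also have "\<dots> \<le> (\<Sum>m=1..M. b m) * (\<Sum>n=1..M. b n) * (\<epsilon> + \<tau>)"
    using b X by (intro mult_right_mono mult_left_mono sum_mono2 sum_nonneg) (auto simp: \<epsilon>_def \<tau>_def)
  finally show ?thesis unfolding eq eq2 by (simp add: b_def \<epsilon>_def \<tau>_def power2_eq_square)
qed

section \<open>Mean square with a Gaussian weight\<close>

text \<open>The upper half-plane is convex, so \<Phi> has a primitive P there. The two vertical
  integrals then differ only by the changes of P along the two horizontal sides.\<close>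

lemma vertical_shift:
  fixes \<Phi> :: "complex \<Rightarrow> complex"
  assumes hol: "\<Phi> holomorphic_on {s. Im s > 0}" and T: "0 < T1" "T1 \<le> T2" and \<sigma>: "\<sigma>1 \<le> \<sigma>2"
    and bd: "\<And>\<sigma> T. \<sigma> \<in> {\<sigma>1..\<sigma>2} \<Longrightarrow> T \<in> {T1, T2} \<Longrightarrow> norm (\<Phi> (Complex \<sigma> T)) \<le> \<epsilon>"
  shows "norm (integral {T1..T2} (\<lambda>t. \<Phi> (Complex \<sigma>1 t)) - integral {T1..T2} (\<lambda>t. \<Phi> (Complex \<sigma>2 t)))
           \<le> 2 * \<epsilon> * (\<sigma>2 - \<sigma>1)"
proof -
  let ?S = "{s::complex. Im s > 0}"
  have S: "open ?S" "convex ?S" by (rule open_halfspace_Im_gt convex_halfspace_Im_gt)+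
  obtain P where P: "\<And>s. s \<in> ?S \<Longrightarrow> (P has_field_derivative \<Phi> s) (at s)"
    using holomorphic_convex_primitive'[OF S(2,1) hol] at_within_open[OF _ S(1)] by metis
  have int: "((\<lambda>t. \<Phi> (Complex \<sigma> t)) has_integral (P (Complex \<sigma> T2) - P (Complex \<sigma> T1)) / \<i>) {T1..T2}" for \<sigma>
  proof -
    have "((\<lambda>t. \<i> * \<Phi> (Complex \<sigma> t)) has_integral (P (Complex \<sigma> T2) - P (Complex \<sigma> T1))) {T1..T2}"
    proof (rule fundamental_theorem_of_calculus[OF T(2)])
      fix t assume t: "t \<in> {T1..T2}"
      have "((\<lambda>t. Complex \<sigma> t) has_vector_derivative \<i>) (at t within {T1..T2})"
        unfolding Complex_eq by (auto intro!: derivative_eq_intros simp: has_vector_derivative_def scaleR_conv_of_real)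
      from field_vector_diff_chain_within[OF this has_field_derivative_at_within[OF P[of "Complex \<sigma> t"]]]
      show "((\<lambda>t. P (Complex \<sigma> t)) has_vector_derivative \<i> * \<Phi> (Complex \<sigma> t)) (at t within {T1..T2})"
        using t T by (auto simp: o_def)
    qed
    from has_integral_divide[OF this, of \<i>] show ?thesis by simp
  qed
  have seg: "norm (P (Complex \<sigma>1 T) - P (Complex \<sigma>2 T)) \<le> \<epsilon> * (\<sigma>2 - \<sigma>1)" if "T \<in> {T1, T2}" for T
  proof -
    have in_seg: "Im z = T \<and> Re z \<in> {\<sigma>1..\<sigma>2}" if "z \<in> closed_segment (Complex \<sigma>1 T) (Complex \<sigma>2 T)" for z
    proof -
      from that obtain w where w: "0 \<le> w" "w \<le> 1" "z = (1 - w) *\<^sub>R Complex \<sigma>1 T + w *\<^sub>R Complex \<sigma>2 T"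
        by (auto simp: closed_segment_def)
      have "Re z = \<sigma>1 + w * (\<sigma>2 - \<sigma>1)" "Im z = T" unfolding w(3) by (simp_all add: algebra_simps)
      moreover have "0 \<le> w * (\<sigma>2 - \<sigma>1)" "w * (\<sigma>2 - \<sigma>1) \<le> 1 * (\<sigma>2 - \<sigma>1)"
        using w \<sigma> by (auto intro!: mult_left_le_one_le)
      ultimately show ?thesis by simp
    qed
    have "norm (P (Complex \<sigma>1 T) - P (Complex \<sigma>2 T)) \<le> \<epsilon> * norm (Complex \<sigma>1 T - Complex \<sigma>2 T)"
    proof (rule field_differentiable_bound)
      fix z assume "z \<in> closed_segment (Complex \<sigma>1 T) (Complex \<sigma>2 T)"
      note z = in_seg[OF this]
      show "(P has_field_derivative \<Phi> z) (at z within closed_segment (Complex \<sigma>1 T) (Complex \<sigma>2 T))"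
        by (rule has_field_derivative_at_within, rule P) (use z that T in auto)
      have "z = Complex (Re z) T" using z by (simp add: complex_eq_iff)
      thus "norm (\<Phi> z) \<le> \<epsilon>" using bd[of "Re z" T] z that by simp
    qed auto
    also have "norm (Complex \<sigma>1 T - Complex \<sigma>2 T) = \<sigma>2 - \<sigma>1"
      using \<sigma> by (simp add: cmod_def)
    finally show ?thesis .
  qed
  have "integral {T1..T2} (\<lambda>t. \<Phi> (Complex \<sigma>1 t)) - integral {T1..T2} (\<lambda>t. \<Phi> (Complex \<sigma>2 t)) =
          ((P (Complex \<sigma>1 T2) - P (Complex \<sigma>2 T2)) - (P (Complex \<sigma>1 T1) - P (Complex \<sigma>2 T1))) / \<i>"
    unfolding integral_unique[OF int] by (simp add: algebra_simps)
  also have "norm \<dots> \<le> norm (P (Complex \<sigma>1 T2) - P (Complex \<sigma>2 T2)) + norm (P (Complex \<sigma>1 T1) - P (Complex \<sigma>2 T1))"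
    by (simp add: norm_mult norm_triangle_ineq4)
  also have "\<dots> \<le> \<epsilon> * (\<sigma>2 - \<sigma>1) + \<epsilon> * (\<sigma>2 - \<sigma>1)"
    by (intro add_mono seg) auto
  finally show ?thesis by simp
qed

text \<open>The entire extension of the normal density from the critical line, which permits moving
  the line of integration.\<close>

definition gauss_kernel :: "real \<Rightarrow> real \<Rightarrow> complex \<Rightarrow> complex" where
  "gauss_kernel u H s = of_real (1 / sqrt (2 * pi * H\<^sup>2)) * exp ((s - Complex (1 / 2) u)\<^sup>2 / of_real (2 * H\<^sup>2))"

lemma gauss_kernel_critical: "gauss_kernel u H (Complex (1 / 2) t) = of_real (normal_density u H t)"
proof -
  have "(Complex (1 / 2) t - Complex (1 / 2) u)\<^sup>2 / of_real (2 * H\<^sup>2) = complex_of_real (- (t - u)\<^sup>2 / (2 * H\<^sup>2))"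
    by (simp add: complex_eq_iff power2_eq_square Re_divide_of_real Im_divide_of_real del: of_real_mult of_real_power)
  thus ?thesis unfolding gauss_kernel_def normal_density_def exp_of_real[symmetric] by (simp only: of_real_mult exp_of_real)
qed

text \<open>Leaving the critical line raises the exponent by at most (5/2)^2 / (2 H^2), which is
  below 4 for H \<ge> 1.\<close>

lemma norm_gauss_kernel_le:
  assumes "H \<ge> 1" "\<sigma> \<in> {1 / 2..3}"
  shows "norm (gauss_kernel u H (Complex \<sigma> t)) \<le> exp 4 * exp (- (t - u)\<^sup>2 / (2 * H\<^sup>2))"
proof -
  have H2: "H\<^sup>2 \<ge> 1" using assms(1) by simp
  have "1 / sqrt (2 * pi * H\<^sup>2) \<le> 1"
  proof -
    have "1 \<le> 2 * pi * H\<^sup>2" using mult_mono[of 1 "2 * pi" 1 "H\<^sup>2"] H2 pi_gt3 by simp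
    thus ?thesis by simp
  qed
  moreover have "((\<sigma> - 1 / 2)\<^sup>2 - (t - u)\<^sup>2) / (2 * H\<^sup>2) \<le> 4 + - (t - u)\<^sup>2 / (2 * H\<^sup>2)"
  proof -
    have "(\<sigma> - 1 / 2)\<^sup>2 \<le> (5 / 2)\<^sup>2" using assms(2) by (intro power_mono) auto
    also have "\<dots> \<le> 8 * H\<^sup>2" using H2 by (simp add: power2_eq_square)
    finally have "(\<sigma> - 1 / 2)\<^sup>2 / (2 * H\<^sup>2) \<le> 4" using assms(1) by (simp add: field_simps)
    thus ?thesis by (simp add: diff_divide_distrib)
  qed
  moreover have "Re ((Complex \<sigma> t - Complex (1 / 2) u)\<^sup>2 / of_real (2 * H\<^sup>2)) = ((\<sigma> - 1 / 2)\<^sup>2 - (t - u)\<^sup>2) / (2 * H\<^sup>2)"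
    by (simp add: Re_divide_of_real power2_eq_square del: of_real_mult of_real_power)
  ultimately have "norm (gauss_kernel u H (Complex \<sigma> t)) \<le> 1 * exp (4 + - (t - u)\<^sup>2 / (2 * H\<^sup>2))"
    unfolding gauss_kernel_def norm_mult norm_exp_eq_Re norm_of_real
    by (intro mult_mono) auto
  thus ?thesis by (simp only: exp_add mult_1_left)
qed

text \<open>Convergence at 2 against the series on Re s = 3 leaves one power of n to spare, which
  bounds the tail beyond M by S / M. The remaining bounds may be crude, since they meet Gaussian
  decay or the factor 1 / M.\<close>

locale critical_line_setup =
  fixes a :: "nat \<Rightarrow> real" and f :: "complex \<Rightarrow> complex" and S C :: real and B :: nat
  assumes nonneg: "\<And>n. a n \<ge> 0"
    and hol: "f holomorphic_on {s. Im s > 0}"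
    and sum2: "((\<lambda>n. a n * real n powr (- 2)) has_sum S) {1..}"
    and series: "\<And>s. Re s = 3 \<Longrightarrow> ((\<lambda>n. of_real (a n) * of_nat n powr (- s)) has_sum f s) {1..}"
    and C: "C \<ge> 0"
    and growth: "\<And>s. Re s \<ge> 1 / 2 \<Longrightarrow> Im s \<ge> 1 \<Longrightarrow> norm (f s) \<le> C * (norm s + 3) ^ B"
begin

lemma S_nonneg: "S \<ge> 0"
  by (rule has_sum_nonneg[OF sum2]) (auto simp: nonneg)

lemma partial_sum_le:
  assumes "e + 2 \<le> real k"
  shows "(\<Sum>n=1..M. a n * real n powr e) \<le> real M ^ k * S"
proof -
  have "(\<Sum>n=1..M. a n * real n powr e) \<le> (\<Sum>n=1..M. real M ^ k * (a n * real n powr (- 2)))"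
  proof (intro sum_mono)
    fix n assume n: "n \<in> {1..M}"
    have "real n powr e = real n powr (- 2) * real n powr (e + 2)" using n by (simp add: powr_add[symmetric])
    also have "real n powr (e + 2) \<le> real n powr (real k)" using n assms by (intro powr_mono) auto
    also have "\<dots> = real n ^ k" using n by (simp add: powr_realpow)
    also have "\<dots> \<le> real M ^ k" using n by (intro power_mono) auto
    finally have "real n powr e \<le> real n powr (- 2) * real M ^ k" by (simp add: mult_left_mono)
    from mult_left_mono[OF this nonneg[of n]]
    show "a n * real n powr e \<le> real M ^ k * (a n * real n powr (- 2))" by (simp add: mult_ac)
  qed
  also have "\<dots> = real M ^ k * (\<Sum>n=1..M. a n * real n powr (- 2))" by (simp add: sum_distrib_left)
  also have "(\<Sum>n=1..M. a n * real n powr (- 2)) \<le> S"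
    by (rule has_sum_mono2[OF has_sum_finite sum2]) (auto simp: nonneg)
  finally show ?thesis by (simp add: mult_left_mono)
qed

lemma norm_dpoly_le:
  assumes "Re s \<ge> 1 / 2"
  shows "norm (dpoly a M s) \<le> real M ^ 2 * S"
proof -
  have "norm (dpoly a M s) \<le> (\<Sum>m=1..M. a m * real m powr (- Re s))"
    unfolding dpoly_def by (intro sum_norm_le) (auto simp: norm_mult norm_nat_powr' nonneg)
  also have "\<dots> \<le> real M ^ 2 * S" using assms by (intro partial_sum_le) auto
  finally show ?thesis .
qed

lemma norm_dual_dpoly_le:
  assumes "Re s \<le> 3"
  shows "norm (dpoly a X (1 - s)) \<le> real X ^ 4 * S"
proof -
  have "norm (dpoly a X (1 - s)) \<le> (\<Sum>m=1..X. a m * real m powr (Re s - 1))"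
    unfolding dpoly_def by (intro sum_norm_le) (auto simp: norm_mult norm_nat_powr' nonneg)
  also have "\<dots> \<le> real X ^ 4 * S" using assms by (intro partial_sum_le) auto
  finally show ?thesis .
qed

lemma series_tail_le:
  assumes s: "Re s = 3" and M: "M \<ge> 1"
  shows "norm (f s - dpoly a M s) \<le> S / real M"
proof -
  have "((\<lambda>n. of_real (a n) * of_nat n powr (- s)) has_sum (f s - dpoly a M s)) ({1..} - {1..M})"
    unfolding dpoly_def by (intro has_sum_Diff series s has_sum_finite) auto
  moreover have "((\<lambda>n. a n * real n powr (- 2) / real M) has_sum
       (S / real M - (\<Sum>n=1..M. a n * real n powr (- 2) / real M))) ({1..} - {1..M})"
    using has_sum_cmult_left[OF sum2, of "1 / real M"]
    by (intro has_sum_Diff has_sum_finite) auto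
  ultimately have "norm (f s - dpoly a M s) \<le> S / real M - (\<Sum>n=1..M. a n * real n powr (- 2) / real M)"
  proof (rule norm_infsum_le)
    fix n assume n: "n \<in> {1..} - {1..M}"
    have "real n powr (- 3) = real n powr (- 2) / real n" using n powr_diff[of "real n" "-2" 1] by simp
    also have "\<dots> \<le> real n powr (- 2) / real M" using n M by (intro divide_left_mono) auto
    finally have "a n * real n powr (- 3) \<le> a n * (real n powr (- 2) / real M)"
      by (intro mult_left_mono nonneg)
    thus "norm (of_real (a n) * of_nat n powr (- s) :: complex) \<le> a n * real n powr (- 2) / real M"
      using n s nonneg[of n] by (simp add: norm_mult norm_nat_powr')
  qed
  also have "\<dots> \<le> S / real M" by (simp add: sum_nonneg nonneg)
  finally show ?thesis .
qed

lemma dual_dpoly_critical: "dpoly a X (1 - Complex (1 / 2) t) = cnj (dpoly a X (Complex (1 / 2) t))"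
proof -
  have "- (1 - Complex (1 / 2) t) = cnj (- Complex (1 / 2) t)" by (simp add: complex_eq_iff)
  moreover have "cnj (of_nat m powr b) = of_nat m powr cnj b" for m b by (simp add: cnj_powr)
  ultimately show ?thesis unfolding dpoly_def cnj_sum by simp
qed

lemma dpoly_holomorphic: "dpoly a M holomorphic_on A"
  unfolding dpoly_def[abs_def] by (intro holomorphic_intros) auto

text \<open>The first summand comes from the two horizontal sides of length 5/2, the second from the
  line Re s = 3.\<close>

definition shift_error :: "real \<Rightarrow> real \<Rightarrow> real \<Rightarrow> nat \<Rightarrow> nat \<Rightarrow> real" where
  "shift_error T H \<Delta> M X =
     5 * (exp 4 * exp (- \<Delta>\<^sup>2 / (2 * H\<^sup>2)) * ((C * (T + 6) ^ B + real M ^ 2 * S) * (real X ^ 4 * S))) +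
     exp 4 * (S / real M * (real X ^ 4 * S)) * T"

text \<open>The difference of f and its partial sum is a small series tail on Re s = 3 but has no
  such bound on the critical line, so the integral is moved there. The ends of the interval lie at
  distance at least \<Delta> from the centre, so the kernel suppresses the horizontal sides.\<close>

lemma tail_correlation_le:
  assumes T: "1 \<le> T1" "T1 \<le> T2" and H: "H \<ge> 1" and u: "\<Delta> \<ge> 0" "T1 + \<Delta> \<le> u" "u \<le> T2 - \<Delta>" and M: "M \<ge> 1"
  shows "norm (integral {T1..T2} (\<lambda>t. of_real (normal_density u H t) *
           ((f (Complex (1 / 2) t) - dpoly a M (Complex (1 / 2) t)) * cnj (dpoly a X (Complex (1 / 2) t)))))
         \<le> shift_error T2 H \<Delta> M X"
proof -
  define \<Phi> where "\<Phi> = (\<lambda>s. gauss_kernel u H s * ((f s - dpoly a M s) * dpoly a X (1 - s)))"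
  define E where "E = (C * (T2 + 6) ^ B + real M ^ 2 * S) * (real X ^ 4 * S)"
  define \<epsilon> where "\<epsilon> = exp 4 * exp (- \<Delta>\<^sup>2 / (2 * H\<^sup>2)) * E"
  define \<eta> where "\<eta> = exp 4 * (S / real M * (real X ^ 4 * S))"
  have hol\<Phi>: "\<Phi> holomorphic_on {s. Im s > 0}"
  proof -
    have "(dpoly a X \<circ> (\<lambda>s. 1 - s)) holomorphic_on {s. Im s > 0}"
      by (intro holomorphic_on_compose dpoly_holomorphic holomorphic_intros)
    hence "(\<lambda>s. dpoly a X (1 - s)) holomorphic_on {s. Im s > 0}" by (simp add: o_def)
    thus ?thesis unfolding \<Phi>_def gauss_kernel_def using H
      by (intro holomorphic_intros hol dpoly_holomorphic) auto
  qed
  have horiz: "norm (\<Phi> (Complex \<sigma> T)) \<le> \<epsilon>" if \<sigma>: "\<sigma> \<in> {1 / 2..3}" and T': "T \<in> {T1, T2}" for \<sigma> T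
  proof -
    have "\<bar>T - u\<bar> \<ge> \<Delta>" using T' u by auto
    hence "\<Delta>\<^sup>2 \<le> (T - u)\<^sup>2" using u(1) by (metis abs_le_square_iff abs_of_nonneg)
    hence "exp (- (T - u)\<^sup>2 / (2 * H\<^sup>2)) \<le> exp (- \<Delta>\<^sup>2 / (2 * H\<^sup>2))"
      using H by (simp add: divide_right_mono)
    hence "exp 4 * exp (- (T - u)\<^sup>2 / (2 * H\<^sup>2)) \<le> exp 4 * exp (- \<Delta>\<^sup>2 / (2 * H\<^sup>2))" by simp
    with norm_gauss_kernel_le[OF H \<sigma>, of u T]
    have g: "norm (gauss_kernel u H (Complex \<sigma> T)) \<le> exp 4 * exp (- \<Delta>\<^sup>2 / (2 * H\<^sup>2))" by linarith
    have "norm (Complex \<sigma> T) \<le> \<bar>\<sigma>\<bar> + \<bar>T\<bar>" using cmod_le[of "Complex \<sigma> T"] by simp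
    hence "norm (Complex \<sigma> T) + 3 \<le> T2 + 6" using \<sigma> T' T by auto
    hence "C * (norm (Complex \<sigma> T) + 3) ^ B \<le> C * (T2 + 6) ^ B"
      using C by (intro mult_left_mono power_mono) auto
    moreover have "norm (f (Complex \<sigma> T)) \<le> C * (norm (Complex \<sigma> T) + 3) ^ B"
      using \<sigma> T' T by (intro growth) auto
    moreover have "norm (dpoly a M (Complex \<sigma> T)) \<le> real M ^ 2 * S" using \<sigma> by (intro norm_dpoly_le) auto
    ultimately have "norm (f (Complex \<sigma> T) - dpoly a M (Complex \<sigma> T)) \<le> C * (T2 + 6) ^ B + real M ^ 2 * S"
      using norm_triangle_ineq4[of "f (Complex \<sigma> T)" "dpoly a M (Complex \<sigma> T)"] by linarith
    moreover have "norm (dpoly a X (1 - Complex \<sigma> T)) \<le> real X ^ 4 * S" using \<sigma> by (intro norm_dual_dpoly_le) auto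
    ultimately have "norm (f (Complex \<sigma> T) - dpoly a M (Complex \<sigma> T)) * norm (dpoly a X (1 - Complex \<sigma> T)) \<le> E"
      unfolding E_def using C T S_nonneg by (intro mult_mono) auto
    with g show ?thesis unfolding \<Phi>_def \<epsilon>_def norm_mult by (intro mult_mono) auto
  qed
  have right: "norm (\<Phi> (Complex 3 t)) \<le> \<eta>" for t
  proof -
    have "exp (- (t - u)\<^sup>2 / (2 * H\<^sup>2)) \<le> 1" by simp
    hence "exp 4 * exp (- (t - u)\<^sup>2 / (2 * H\<^sup>2)) \<le> exp 4 * 1" by (intro mult_left_mono) auto
    moreover have "norm (gauss_kernel u H (Complex 3 t)) \<le> exp 4 * exp (- (t - u)\<^sup>2 / (2 * H\<^sup>2))"
      by (rule norm_gauss_kernel_le[OF H]) auto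
    ultimately have "norm (gauss_kernel u H (Complex 3 t)) \<le> exp 4" by linarith
    moreover have "norm (f (Complex 3 t) - dpoly a M (Complex 3 t)) * norm (dpoly a X (1 - Complex 3 t)) \<le> S / real M * (real X ^ 4 * S)"
      using S_nonneg M by (intro mult_mono series_tail_le norm_dual_dpoly_le) auto
    ultimately show ?thesis unfolding \<Phi>_def \<eta>_def norm_mult by (rule mult_mono) auto
  qed
  have "continuous_on {T1..T2} (\<lambda>t. \<Phi> (Complex 3 t))"
  proof -
    have "continuous_on {s. Im s > 0} \<Phi>" by (rule holomorphic_on_imp_continuous_on[OF hol\<Phi>])
    moreover have "continuous_on {T1..T2} (\<lambda>t. Complex 3 t)" unfolding Complex_eq by (intro continuous_intros)
    ultimately show ?thesis by (rule continuous_on_compose2) (use T in auto)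
  qed
  hence "norm (integral {T1..T2} (\<lambda>t. \<Phi> (Complex 3 t))) \<le> \<eta> * (T2 - T1)"
    by (intro integral_bound T right)
  also have "\<dots> \<le> \<eta> * T2" using T S_nonneg unfolding \<eta>_def by (intro mult_left_mono) auto
  finally have r: "norm (integral {T1..T2} (\<lambda>t. \<Phi> (Complex 3 t))) \<le> \<eta> * T2" .
  have "norm (integral {T1..T2} (\<lambda>t. \<Phi> (Complex (1 / 2) t)) - integral {T1..T2} (\<lambda>t. \<Phi> (Complex 3 t))) \<le> 2 * \<epsilon> * (3 - 1 / 2)"
    using T by (intro vertical_shift hol\<Phi> horiz) auto
  also have "2 * \<epsilon> * (3 - 1 / 2) = 5 * \<epsilon>" by simp
  finally have "norm (integral {T1..T2} (\<lambda>t. \<Phi> (Complex (1 / 2) t))) \<le> 5 * \<epsilon> + \<eta> * T2"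
    using r norm_triangle_sub[of "integral {T1..T2} (\<lambda>t. \<Phi> (Complex (1 / 2) t))" "integral {T1..T2} (\<lambda>t. \<Phi> (Complex 3 t))"]
    by linarith
  thus ?thesis
    by (simp only: \<Phi>_def gauss_kernel_critical dual_dpoly_critical shift_error_def \<epsilon>_def \<eta>_def E_def)
qed

definition mean_error :: "real \<Rightarrow> real \<Rightarrow> nat \<Rightarrow> nat \<Rightarrow> real" where
  "mean_error H \<Delta> M X = (real M ^ 2 * S) ^ 2 *
            (exp (- H\<^sup>2 / (8 * real X ^ 2)) + sqrt 2 * exp (- \<Delta>\<^sup>2 / (4 * H\<^sup>2)))"

text \<open>Expanding \<open>\<bar>f - A\<bar>\<^sup>2 \<ge> 0\<close> for the partial sum \<open>A\<close> of length \<open>X\<close> reduces the mean square of \<open>f\<close>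
  to two mean values.\<close>

lemma gaussian_mean_square_lower:
  assumes T: "1 \<le> T1" "T1 \<le> T2" and H: "H \<ge> 1" and u: "\<Delta> \<ge> 0" "T1 + \<Delta> \<le> u" "u \<le> T2 - \<Delta>"
    and X: "1 \<le> X" "X \<le> M"
  shows "integral {T1..T2} (\<lambda>t. normal_density u H t * norm (f (Complex (1 / 2) t)) ^ 2) \<ge>
           (\<Sum>n=1..X. a n ^ 2 / real n) - 3 * mean_error H \<Delta> M X - 2 * shift_error T2 H \<Delta> M X"
proof -
  define g where "g = normal_density u H"
  define F P Q where "F = (\<lambda>t. f (Complex (1 / 2) t))" and "P = (\<lambda>t. dpoly a M (Complex (1 / 2) t))"
    and "Q = (\<lambda>t. dpoly a X (Complex (1 / 2) t))"
  define D where "D = (\<Sum>n=1..X. a n ^ 2 / real n)"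
  define I where "I = (\<lambda>h. integral {T1..T2} (\<lambda>t. of_real (g t) * h t) :: complex)"
  have cg: "continuous_on {T1..T2} g" unfolding g_def normal_density_def using H by (intro continuous_intros) auto
  have cC: "continuous_on {T1..T2} (\<lambda>t. Complex (1 / 2) t)" unfolding Complex_eq by (intro continuous_intros)
  have cF: "continuous_on {T1..T2} F" unfolding F_def
    by (rule continuous_on_compose2[OF holomorphic_on_imp_continuous_on[OF hol] cC]) (use T in auto)
  have cd: "continuous_on {T1..T2} (\<lambda>t. dpoly a N (Complex (1 / 2) t))" for N
    by (rule continuous_on_compose2[OF holomorphic_on_imp_continuous_on[OF dpoly_holomorphic] cC]) auto
  have cP: "continuous_on {T1..T2} P" and cQ: "continuous_on {T1..T2} Q" unfolding P_def Q_def by (rule cd)+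
  have intI: "(\<lambda>t. of_real (g t) * h t) integrable_on {T1..T2}" if "continuous_on {T1..T2} h" for h :: "real \<Rightarrow> complex"
    by (intro integrable_continuous_interval continuous_intros cg that)
  have mono: "(\<Sum>m=1..N. a m * real m powr (- (1 / 2))) ^ 2 \<le> (real M ^ 2 * S) ^ 2" if "N \<le> M" for N
  proof (intro power_mono)
    have "(\<Sum>m=1..N. a m * real m powr (- (1 / 2))) \<le> real N ^ 2 * S" by (intro partial_sum_le) auto
    also have "\<dots> \<le> real M ^ 2 * S" using S_nonneg that by (intro mult_right_mono power_mono) auto
    finally show "(\<Sum>m=1..N. a m * real m powr (- (1 / 2))) \<le> real M ^ 2 * S" .
  qed (auto intro!: sum_nonneg simp: nonneg)
  \<comment> \<open>Used with N = X for |Q|^2 and with N = M for P times the conjugate of Q; the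
    diagonal is the same in both cases.\<close>
  have mv: "norm (I (\<lambda>t. dpoly a N (Complex (1 / 2) t) * cnj (Q t)) - of_real D) \<le> mean_error H \<Delta> M X"
    if "X \<le> N" "N \<le> M" for N
  proof -
    have "norm (I (\<lambda>t. dpoly a N (Complex (1 / 2) t) * cnj (Q t)) - of_real D) \<le>
        (\<Sum>m=1..N. a m * real m powr (- (1 / 2))) ^ 2 *
            (exp (- H\<^sup>2 / (8 * real X ^ 2)) + sqrt 2 * exp (- \<Delta>\<^sup>2 / (4 * H\<^sup>2)))"
      using dpoly_mean_value[OF nonneg _ u X(1) that(1), of H] H
      unfolding I_def g_def Q_def D_def Complex_eq by simp
    also have "\<dots> \<le> mean_error H \<Delta> M X" unfolding mean_error_def
      by (intro mult_right_mono mono that) auto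
    finally show ?thesis .
  qed
  have QQ: "Re (I (\<lambda>t. Q t * cnj (Q t))) \<le> D + mean_error H \<Delta> M X"
    using mv[of X] X abs_Re_le_cmod[of "I (\<lambda>t. Q t * cnj (Q t)) - of_real D"] unfolding Q_def by simp
  have PQ: "Re (I (\<lambda>t. P t * cnj (Q t))) \<ge> D - mean_error H \<Delta> M X"
    using mv[of M] X abs_Re_le_cmod[of "I (\<lambda>t. P t * cnj (Q t)) - of_real D"] unfolding P_def by simp
  have FPQ: "Re (I (\<lambda>t. (F t - P t) * cnj (Q t))) \<ge> - shift_error T2 H \<Delta> M X"
    using tail_correlation_le[OF T H u, of M X] X abs_Re_le_cmod[of "I (\<lambda>t. (F t - P t) * cnj (Q t))"]
    unfolding I_def g_def F_def P_def Q_def by simp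
  \<comment> \<open>F is written as P + (F - P). The correlation of P with Q counts twice and |Q|^2
    once, whence three mean errors and two shift errors.\<close>
  have pw: "g t * norm (F t) ^ 2 \<ge>
     Re (of_real (g t) * (2 * (P t * cnj (Q t)) + 2 * ((F t - P t) * cnj (Q t)) - Q t * cnj (Q t)))" for t
  proof -
    have "0 \<le> norm (F t - Q t) ^ 2" by simp
    also have "\<dots> = norm (F t) ^ 2 - Re (2 * (P t * cnj (Q t)) + 2 * ((F t - P t) * cnj (Q t)) - Q t * cnj (Q t))"
      unfolding cmod_power2 by (simp add: power2_eq_square algebra_simps)
    finally have "Re (2 * (P t * cnj (Q t)) + 2 * ((F t - P t) * cnj (Q t)) - Q t * cnj (Q t)) \<le> norm (F t) ^ 2" by simp
    from mult_left_mono[OF this, of "g t"] show ?thesis by (simp add: g_def)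
  qed
  have "Re (I (\<lambda>t. 2 * (P t * cnj (Q t)) + 2 * ((F t - P t) * cnj (Q t)) - Q t * cnj (Q t))) =
        integral {T1..T2} (\<lambda>t. Re (of_real (g t) * (2 * (P t * cnj (Q t)) + 2 * ((F t - P t) * cnj (Q t)) - Q t * cnj (Q t))))"
    unfolding I_def
    using integral_linear[OF intI bounded_linear_Re,
        of "\<lambda>t. 2 * (P t * cnj (Q t)) + 2 * ((F t - P t) * cnj (Q t)) - Q t * cnj (Q t)"]
    by (simp add: o_def continuous_on_mult continuous_on_diff continuous_on_add continuous_on_cnj cF cP cQ)
  also have "\<dots> \<le> integral {T1..T2} (\<lambda>t. g t * norm (F t) ^ 2)"
    by (intro integral_le integrable_continuous_interval continuous_intros cF cP cQ cg pw)
  finally have le: "Re (I (\<lambda>t. 2 * (P t * cnj (Q t)) + 2 * ((F t - P t) * cnj (Q t)) - Q t * cnj (Q t)))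
      \<le> integral {T1..T2} (\<lambda>t. g t * norm (F t) ^ 2)" .
  have "I (\<lambda>t. 2 * (P t * cnj (Q t)) + 2 * ((F t - P t) * cnj (Q t)) - Q t * cnj (Q t)) =
          2 * I (\<lambda>t. P t * cnj (Q t)) + 2 * I (\<lambda>t. (F t - P t) * cnj (Q t)) - I (\<lambda>t. Q t * cnj (Q t))"
  proof -
    have hi: "((\<lambda>t. of_real (g t) * h t) has_integral I h) {T1..T2}" if "continuous_on {T1..T2} h" for h
      unfolding I_def using intI[OF that] by (rule integrable_integral)
    have "((\<lambda>t. 2 * (of_real (g t) * (P t * cnj (Q t))) + 2 * (of_real (g t) * ((F t - P t) * cnj (Q t))) -
             of_real (g t) * (Q t * cnj (Q t))) has_integral
             2 * I (\<lambda>t. P t * cnj (Q t)) + 2 * I (\<lambda>t. (F t - P t) * cnj (Q t)) - I (\<lambda>t. Q t * cnj (Q t))) {T1..T2}"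
      by (intro has_integral_diff has_integral_add has_integral_mult_right hi continuous_intros cF cP cQ)
    from integral_unique[OF this] show ?thesis unfolding I_def by (simp add: algebra_simps)
  qed
  with le QQ PQ FPQ show ?thesis by (simp add: g_def F_def D_def)
qed

end

section \<open>Averaging over the centre of the Gaussian\<close>

text \<open>The density is symmetric in its centre and its argument, so integrating over the centre
  is again integrating a normal density.\<close>

lemma normal_density_integral_le_1:
  assumes "H > 0"
  shows "integral {U1..U2} (\<lambda>u. normal_density u H t) \<le> 1"
proof -
  have sym: "normal_density u H t = normal_density t H u" for u
    by (simp add: normal_density_def power2_commute)
  have i: "set_integrable lborel {U1..U2} (normal_density t H)"
    unfolding set_integrable_def by (intro integrable_mult_indicator integrable_normal_density assms) auto
  have "integral {U1..U2} (normal_density t H) = (LINT u:{U1..U2}|lborel. normal_density t H u)"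
    by (rule set_borel_integral_eq_integral(2)[OF i, symmetric])
  also have "\<dots> \<le> (LINT u|lborel. normal_density t H u)"
    unfolding set_lebesgue_integral_def
    by (rule integral_mono) (use i assms in \<open>auto simp: set_integrable_def indicator_def\<close>)
  also have "\<dots> = 1" using assms by simp
  finally show ?thesis unfolding sym .
qed

text \<open>Integrating the lower bound over the centre and exchanging the integrals weights each
  point t with total mass at most 1, so the nonnegative h is never overcounted.\<close>

lemma average_gaussian_windows:
  fixes h :: "real \<Rightarrow> real"
  assumes H: "H > 0" and h: "continuous_on {T1..T2} h" "\<And>t. t \<in> {T1..T2} \<Longrightarrow> h t \<ge> 0"
    and T: "T1 \<le> T2" and U: "U1 \<le> U2"
    and lower: "\<And>u. u \<in> {U1..U2} \<Longrightarrow> integral {T1..T2} (\<lambda>t. normal_density u H t * h t) \<ge> m"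
  shows "(U2 - U1) * m \<le> integral {T1..T2} h"
proof -
  have cn: "continuous_on A (\<lambda>x. normal_density (p x) H (q x))" if "continuous_on A p" "continuous_on A q" for A and p q :: "real \<times> real \<Rightarrow> real"
    unfolding normal_density_def using H that by (intro continuous_intros) auto
  have cj: "continuous_on ({U1..U2} \<times> {T1..T2}) (\<lambda>(u,t). normal_density u H t * h t)"
    unfolding case_prod_unfold
    by (intro continuous_on_mult cn continuous_on_fst continuous_on_snd continuous_on_id
          continuous_on_compose2[OF h(1)]) auto
  have cj': "continuous_on (cbox (U1, T1) (U2, T2)) (\<lambda>(u,t). normal_density u H t * h t)"
    using cj by (simp add: cbox_Pair_eq)
  have cn1: "continuous_on A (\<lambda>u. normal_density u H t)" for A t
    unfolding normal_density_def using H by (intro continuous_intros) auto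
  have swap: "integral {U1..U2} (\<lambda>u. integral {T1..T2} (\<lambda>t. normal_density u H t * h t)) =
               integral {T1..T2} (\<lambda>t. integral {U1..U2} (\<lambda>u. normal_density u H t * h t))"
    using integral_swap_continuous[OF cj'] by simp
  have c1: "continuous_on {U1..U2} (\<lambda>u. integral {T1..T2} (\<lambda>t. normal_density u H t * h t))"
    using integral_continuous_on_param[of "{U1..U2}" T1 T2 "\<lambda>u t. normal_density u H t * h t"] cj by simp
  have "continuous_on (cbox (T1, U1) (T2, U2)) (\<lambda>(t,u). normal_density u H t * h t)"
    unfolding case_prod_unfold cbox_Pair_eq
    by (intro continuous_on_mult cn continuous_on_fst continuous_on_snd continuous_on_id
          continuous_on_compose2[OF h(1)]) auto
  hence c2: "continuous_on {T1..T2} (\<lambda>t. integral {U1..U2} (\<lambda>u. normal_density u H t * h t))"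
    using integral_continuous_on_param[of "{T1..T2}" U1 U2 "\<lambda>t u. normal_density u H t * h t"]
    by (simp add: cbox_Pair_eq)
  have "(U2 - U1) * m = integral {U1..U2} (\<lambda>_. m)" using U by simp
  also have "\<dots> \<le> integral {U1..U2} (\<lambda>u. integral {T1..T2} (\<lambda>t. normal_density u H t * h t))"
    by (intro integral_le integrable_continuous_interval c1 lower) auto
  also note swap
  also have "integral {T1..T2} (\<lambda>t. integral {U1..U2} (\<lambda>u. normal_density u H t * h t)) \<le> integral {T1..T2} h"
  proof (intro integral_le integrable_continuous_interval c2 h(1))
    fix t assume t: "t \<in> {T1..T2}"
    have "integral {U1..U2} (\<lambda>u. normal_density u H t * h t) = integral {U1..U2} (\<lambda>u. normal_density u H t) * h t"
      by simp
    also have "\<dots> \<le> 1 * h t" by (intro mult_right_mono normal_density_integral_le_1 H h(2) t)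
    finally show "integral {U1..U2} (\<lambda>u. normal_density u H t * h t) \<le> h t" by simp
  qed
  finally show ?thesis .
qed

context critical_line_setup
begin

text \<open>A majorant of three mean errors and two shift errors for H = T^(1 - \<epsilon>/2),
  \<Delta> = \<delta> T, X \<le> T and T^6 \<le> M \<le> 2 T^6.\<close>

definition total_error :: "real \<Rightarrow> real \<Rightarrow> real \<Rightarrow> real" where
  "total_error \<delta> \<epsilon> T =
     3 * (((2 * T ^ 6) ^ 2 * S) ^ 2 * (exp (- (T powr \<epsilon>) / 8) + sqrt 2 * exp (- (\<delta>\<^sup>2 * T powr \<epsilon>) / 4))) +
     2 * (5 * (exp 4 * exp (- (\<delta>\<^sup>2 * T powr \<epsilon>) / 2) * ((C * (T + 6) ^ B + (2 * T ^ 6) ^ 2 * S) * (T ^ 4 * S))) +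
          exp 4 * (S\<^sup>2 / T))"

lemma total_error_tendsto:
  assumes "\<delta> > 0" "\<epsilon> > 0"
  shows "(total_error \<delta> \<epsilon> \<longlongrightarrow> 0) at_top"
proof -
  have pow: "((\<lambda>T. T ^ k * exp (- (c * T powr \<epsilon>))) \<longlongrightarrow> 0) at_top" if "c > 0" for c and k :: nat
    using that assms(2) by real_asymp
  have powB: "((\<lambda>T. (T + 6) ^ B * T ^ 4 * exp (- (c * T powr \<epsilon>))) \<longlongrightarrow> 0) at_top" if "c > 0" for c
    using that assms(2) by real_asymp
  have "((\<lambda>T. 48 * S\<^sup>2 * (T ^ 24 * exp (- (1 / 8 * T powr \<epsilon>))) +
              48 * sqrt 2 * S\<^sup>2 * (T ^ 24 * exp (- (\<delta>\<^sup>2 / 4 * T powr \<epsilon>))) +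
              10 * exp 4 * C * S * ((T + 6) ^ B * T ^ 4 * exp (- (\<delta>\<^sup>2 / 2 * T powr \<epsilon>))) +
              40 * exp 4 * S\<^sup>2 * (T ^ 16 * exp (- (\<delta>\<^sup>2 / 2 * T powr \<epsilon>))) +
              2 * exp 4 * S\<^sup>2 * (1 / T)) \<longlongrightarrow>
          48 * S\<^sup>2 * 0 + 48 * sqrt 2 * S\<^sup>2 * 0 + 10 * exp 4 * C * S * 0 + 40 * exp 4 * S\<^sup>2 * 0 + 2 * exp 4 * S\<^sup>2 * 0) at_top"
    using assms(1) by (intro tendsto_intros pow powB) (auto, real_asymp)
  moreover have "\<forall>\<^sub>F T in at_top. 48 * S\<^sup>2 * (T ^ 24 * exp (- (1 / 8 * T powr \<epsilon>))) +
              48 * sqrt 2 * S\<^sup>2 * (T ^ 24 * exp (- (\<delta>\<^sup>2 / 4 * T powr \<epsilon>))) +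
              10 * exp 4 * C * S * ((T + 6) ^ B * T ^ 4 * exp (- (\<delta>\<^sup>2 / 2 * T powr \<epsilon>))) +
              40 * exp 4 * S\<^sup>2 * (T ^ 16 * exp (- (\<delta>\<^sup>2 / 2 * T powr \<epsilon>))) +
              2 * exp 4 * S\<^sup>2 * (1 / T) = total_error \<delta> \<epsilon> T"
    using eventually_gt_at_top[of 0]
  proof eventually_elim
    case (elim T)
    show ?case unfolding total_error_def
      by (simp add: algebra_simps power_mult_distrib power_mult[symmetric] power2_eq_square power_add[symmetric])
  qed
  ultimately show ?thesis by (simp add: Lim_transform_eventually)
qed

text \<open>The centres fill an interval of length (1 - \<alpha> - 2\<delta>) T, which leaves a
  margin \<delta> T on both sides for the windows. The subtracted 1 absorbs the total error.\<close>

lemma mean_square_lower: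
  assumes "0 < \<alpha>" "0 < \<delta>" "\<alpha> + 2 * \<delta> < 1" "0 < \<epsilon>" "\<epsilon> < 1"
  shows "\<forall>\<^sub>F T in at_top. (1 - \<alpha> - 2 * \<delta>) * T * ((\<Sum>n\<in>{1..nat \<lfloor>T powr (1 - \<epsilon>)\<rfloor>}. a n ^ 2 / real n) - 1)
            \<le> integral {\<alpha> * T..T} (\<lambda>t. norm (f (Complex (1 / 2) t)) ^ 2)"
proof -
  have "\<forall>\<^sub>F T in at_top. total_error \<delta> \<epsilon> T < 1"
    by (intro order_tendstoD(2)[OF total_error_tendsto] assms) auto
  moreover have "\<forall>\<^sub>F T in at_top. \<alpha> * T \<ge> 1" using assms by real_asymp
  ultimately show ?thesis using eventually_ge_at_top[of 1]
  proof eventually_elim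
    case (elim T)
    \<comment> \<open>Between X and T on the logarithmic scale: H / X \<ge> T^(\<epsilon>/2) removes
      the off-diagonal terms, and \<delta> T / H = \<delta> T^(\<epsilon>/2) removes the window
      tails.\<close>
    define H where "H = T powr (1 - \<epsilon> / 2)"
    define X where "X = nat \<lfloor>T powr (1 - \<epsilon>)\<rfloor>"
    \<comment> \<open>The line Re s = 3 contributes about X^4 T / M, and X^4 T \<le> T^5; the sixth
      power leaves 1 / T.\<close>
    define M where "M = nat \<lceil>T ^ 6\<rceil>"
    define m where "m = (\<Sum>n\<in>{1..X}. a n ^ 2 / real n) - 1"
    have T: "T \<ge> 1" by fact
    have H: "H \<ge> 1" unfolding H_def using T assms by (intro ge_one_powr_ge_zero) auto
    have Xr: "1 \<le> T powr (1 - \<epsilon>)" using T assms by (intro ge_one_powr_ge_zero) auto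
    have X: "1 \<le> X" "real X \<le> T powr (1 - \<epsilon>)" unfolding X_def using Xr by (simp_all add: le_nat_iff)
    have XT: "real X \<le> T"
    proof -
      have "T powr (1 - \<epsilon>) \<le> T powr 1" using T assms by (intro powr_mono) auto
      thus ?thesis using X(2) T by simp
    qed
    have T6: "1 \<le> T ^ 6" "T \<le> T ^ 6" using T one_le_power[OF T] power_increasing[of 1 6 T] by auto
    have M: "T ^ 6 \<le> real M" "real M \<le> 2 * T ^ 6"
      unfolding M_def using T6 by (auto simp: real_nat_ceiling_ge, linarith)
    have "real X \<le> real M" using XT T6 M by linarith
    hence XM: "X \<le> M" by simp
    have H2: "H\<^sup>2 = T powr (2 - \<epsilon>)"
      using T by (simp add: H_def powr_power)
    have e1: "- H\<^sup>2 / (8 * real X ^ 2) \<le> - (T powr \<epsilon>) / 8"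
    proof -
      have "T powr \<epsilon> * real X ^ 2 \<le> T powr \<epsilon> * (T powr (1 - \<epsilon>)) ^ 2"
        using X by (intro mult_left_mono power_mono) auto
      also have "\<dots> = H\<^sup>2" unfolding H2 using T by (simp add: powr_power powr_add[symmetric] algebra_simps)
      finally show ?thesis using X(1) by (simp add: field_simps)
    qed
    have \<Delta>H: "(\<delta> * T)\<^sup>2 / H\<^sup>2 = \<delta>\<^sup>2 * T powr \<epsilon>"
    proof -
      have "T\<^sup>2 = T powr \<epsilon> * T powr (2 - \<epsilon>)" using T by (simp add: powr_add[symmetric])
      thus ?thesis unfolding H2 power_mult_distrib using T by simp
    qed
    have e2: "- (\<delta> * T)\<^sup>2 / (4 * H\<^sup>2) = - (\<delta>\<^sup>2 * T powr \<epsilon>) / 4" "- (\<delta> * T)\<^sup>2 / (2 * H\<^sup>2) = - (\<delta>\<^sup>2 * T powr \<epsilon>) / 2"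
      unfolding \<Delta>H[symmetric] using H by (simp_all add: field_simps)
    have me: "mean_error H (\<delta> * T) M X \<le> ((2 * T ^ 6) ^ 2 * S) ^ 2 * (exp (- (T powr \<epsilon>) / 8) + sqrt 2 * exp (- (\<delta>\<^sup>2 * T powr \<epsilon>) / 4))"
      unfolding mean_error_def e2
      by (intro mult_mono power_mono add_mono mult_right_mono M S_nonneg) (use e1 S_nonneg in auto)
    have se: "shift_error T H (\<delta> * T) M X \<le>
          5 * (exp 4 * exp (- (\<delta>\<^sup>2 * T powr \<epsilon>) / 2) * ((C * (T + 6) ^ B + (2 * T ^ 6) ^ 2 * S) * (T ^ 4 * S))) +
          exp 4 * (S\<^sup>2 / T)"
    proof -
      have "S / T ^ 6 * (T ^ 4 * S) * T = S\<^sup>2 / T"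
        using T by (simp add: field_simps power2_eq_square eval_nat_numeral)
      hence T1: "exp 4 * (S / T ^ 6 * (T ^ 4 * S)) * T = exp 4 * (S\<^sup>2 / T)" by (simp only: mult.assoc)
      have "(C * (T + 6) ^ B + real M ^ 2 * S) * (real X ^ 4 * S) \<le> (C * (T + 6) ^ B + (2 * T ^ 6) ^ 2 * S) * (T ^ 4 * S)"
        by (intro mult_mono add_mono order_refl power_mono M XT S_nonneg mult_right_mono add_nonneg_nonneg mult_nonneg_nonneg)
           (use C T S_nonneg in auto)
      moreover have "S / real M * (real X ^ 4 * S) \<le> S / T ^ 6 * (T ^ 4 * S)"
        using T T6 M S_nonneg XT by (intro mult_mono divide_left_mono power_mono) auto
      ultimately show ?thesis unfolding shift_error_def e2 T1[symmetric]
        using T by (intro add_mono mult_left_mono mult_right_mono) auto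
    qed
    have pt: "integral {\<alpha> * T..T} (\<lambda>t. normal_density u H t * norm (f (Complex (1 / 2) t)) ^ 2) \<ge> m"
      if u: "u \<in> {\<alpha> * T + \<delta> * T..T - \<delta> * T}" for u
    proof -
      have "\<alpha> * T \<le> 1 * T" using assms T by (intro mult_right_mono) auto
      hence "integral {\<alpha> * T..T} (\<lambda>t. normal_density u H t * norm (f (Complex (1 / 2) t)) ^ 2) \<ge>
           (\<Sum>n=1..X. a n ^ 2 / real n) - 3 * mean_error H (\<delta> * T) M X - 2 * shift_error T H (\<delta> * T) M X"
        using u assms T elim by (intro gaussian_mean_square_lower H X(1) XM) auto
      moreover have "3 * mean_error H (\<delta> * T) M X + 2 * shift_error T H (\<delta> * T) M X \<le> total_error \<delta> \<epsilon> T"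
        unfolding total_error_def using me se by (intro add_mono mult_left_mono) auto
      ultimately show ?thesis using elim(1) unfolding m_def by linarith
    qed
    have "((T - \<delta> * T) - (\<alpha> * T + \<delta> * T)) * m \<le> integral {\<alpha> * T..T} (\<lambda>t. norm (f (Complex (1 / 2) t)) ^ 2)"
    proof (rule average_gaussian_windows[where H = H])
      have "continuous_on {\<alpha> * T..T} (\<lambda>t. Complex (1 / 2) t)" unfolding Complex_eq by (intro continuous_intros)
      hence "continuous_on {\<alpha> * T..T} (\<lambda>t. f (Complex (1 / 2) t))"
        by (rule continuous_on_compose2[OF holomorphic_on_imp_continuous_on[OF hol]]) (use elim(2) in auto)
      thus "continuous_on {\<alpha> * T..T} (\<lambda>t. (norm (f (Complex (1 / 2) t)))\<^sup>2)"
        by (intro continuous_intros)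
      have "(\<alpha> + 2 * \<delta>) * T \<le> 1 * T" using assms T by (intro mult_right_mono) auto
      thus "\<alpha> * T + \<delta> * T \<le> T - \<delta> * T" by (simp add: algebra_simps)
      have "\<alpha> * T \<le> 1 * T" using assms T by (intro mult_right_mono) auto
      thus "\<alpha> * T \<le> T" by simp
    qed (use H pt in auto)
    also have "((T - \<delta> * T) - (\<alpha> * T + \<delta> * T)) * m = (1 - \<alpha> - 2 * \<delta>) * T * m" by (simp add: algebra_simps)
    finally show ?case unfolding m_def X_def .
  qed
qed

end

section \<open>Proof of the theorem\<close>

lemma zeta_prod_mean_square_lower:
  assumes "as \<noteq> []" "0 < \<alpha>" "\<alpha> < 1" "e > 0"
  shows "\<forall>\<^sub>F T in at_top. ((1 - \<alpha>) * moment_const as - e) * T * ln T ^ ((length as)\<^sup>2 + 2 * sum_list as)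
           \<le> integral {\<alpha> * T..T} (\<lambda>t. norm (zeta_prod as (Complex (1 / 2) t)) ^ 2)"
proof -
  define c where "c = moment_const as"
  define E where "E = (length as)\<^sup>2 + 2 * sum_list as"
  have E: "E > 0" using assms(1) by (simp add: E_def)
  obtain S where S: "((\<lambda>n. deriv_coeff as n * real n powr (- 2)) has_sum S) {1..}"
    using zeta_prod_has_sum(1)[of 2 as] by (auto simp: summable_on_def)
  obtain C where C: "C > 0"
    "\<And>s. Re s \<ge> 1/2 \<Longrightarrow> \<bar>Im s\<bar> \<ge> 1 \<Longrightarrow> norm (zeta_prod as s) \<le> C * (norm s + 3) ^ (2 * length as)"
    using zeta_prod_growth by blast
  interpret critical_line_setup "deriv_coeff as" "zeta_prod as" S C "2 * length as"
  proof
    show "zeta_prod as holomorphic_on {s. 0 < Im s}"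
      by (rule holomorphic_on_subset[OF zeta_prod_holomorphic]) auto
    show "((\<lambda>n. of_real (deriv_coeff as n) * of_nat n powr (- s)) has_sum zeta_prod as s) {1..}" if "Re s = 3" for s
      using that by (intro zeta_prod_has_sum(2)) auto
  qed (use S C in \<open>auto intro: deriv_coeff_nonneg\<close>)
  \<comment> \<open>One parameter \<kappa> serves as window margin, as loss in the exponent of X, as
    Tauberian error and as the share that absorbs the subtracted 1. The factor (1 - \<kappa>)^E
    comes from ln(T^(1 - \<kappa>)).\<close>
  have "((\<lambda>\<kappa>. (1 - \<alpha> - 2 * \<kappa>) * ((c - \<kappa>) * (1 - \<kappa>) ^ E - \<kappa>)) \<longlongrightarrow> (1 - \<alpha> - 2 * 0) * ((c - 0) * (1 - 0) ^ E - 0)) (at_right 0)"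
    by (intro tendsto_intros)
  hence "\<forall>\<^sub>F \<kappa> in at_right 0. (1 - \<alpha> - 2 * \<kappa>) * ((c - \<kappa>) * (1 - \<kappa>) ^ E - \<kappa>) > (1 - \<alpha>) * c - e"
    using assms(4) by (intro order_tendstoD(1)) auto
  hence "\<forall>\<^sub>F \<kappa> in at_right 0. (1 - \<alpha> - 2 * \<kappa>) * ((c - \<kappa>) * (1 - \<kappa>) ^ E - \<kappa>) > (1 - \<alpha>) * c - e \<and> \<kappa> \<in> {0<..<(1 - \<alpha>) / 2}"
    using assms by (intro eventually_conj eventually_at_right_real) auto
  then obtain \<kappa> where \<kappa>: "(1 - \<alpha> - 2 * \<kappa>) * ((c - \<kappa>) * (1 - \<kappa>) ^ E - \<kappa>) > (1 - \<alpha>) * c - e" "0 < \<kappa>" "\<kappa> < (1 - \<alpha>) / 2"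
    using eventually_happens[of _ "at_right (0::real)"] trivial_limit_at_right_real by fastforce
  have \<kappa>': "\<alpha> + 2 * \<kappa> < 1" "\<kappa> < 1" using \<kappa> assms by (auto simp: field_simps)
  have "filterlim (\<lambda>T::real. T powr (1 - \<kappa>)) at_top at_top" using \<kappa>'(2) by real_asymp
  hence ev1: "\<forall>\<^sub>F T in at_top. (\<Sum>n\<in>{1..nat \<lfloor>T powr (1 - \<kappa>)\<rfloor>}. deriv_coeff as n ^ 2 / real n) \<ge> (c - \<kappa>) * ln (T powr (1 - \<kappa>)) ^ E"
    using deriv_coeff_square_sum_lower[OF assms(1) \<kappa>(2)] unfolding c_def E_def
    by (rule eventually_compose_filterlim[rotated])
  have "filterlim (\<lambda>T::real. ln T ^ E) at_top at_top"
    using E by (intro filterlim_pow_at_top ln_at_top)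
  hence ev2: "\<forall>\<^sub>F T in at_top. ln T ^ E \<ge> 1 / \<kappa>" by (rule filterlim_at_top[THEN iffD1, rule_format])
  show ?thesis
    using mean_square_lower[OF assms(2) \<kappa>(2) \<kappa>'(1) \<kappa>(2) \<kappa>'(2)] ev1 ev2 eventually_gt_at_top[of 1]
    unfolding c_def[symmetric] E_def[symmetric]
  proof eventually_elim
    case (elim T)
    define D where "D = (\<Sum>n\<in>{1..nat \<lfloor>T powr (1 - \<kappa>)\<rfloor>}. deriv_coeff as n ^ 2 / real n)"
    have "1 \<le> \<kappa> * ln T ^ E" using elim(3) \<kappa>(2) by (simp add: field_simps)
    moreover have "D \<ge> ((c - \<kappa>) * (1 - \<kappa>) ^ E) * ln T ^ E"
      using elim(2,4) by (simp add: D_def ln_powr power_mult_distrib mult.assoc)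
    ultimately have D: "D - 1 \<ge> ((c - \<kappa>) * (1 - \<kappa>) ^ E - \<kappa>) * ln T ^ E" by (simp add: left_diff_distrib)
    have "((1 - \<alpha>) * c - e) * (T * ln T ^ E) \<le> ((1 - \<alpha> - 2 * \<kappa>) * ((c - \<kappa>) * (1 - \<kappa>) ^ E - \<kappa>)) * (T * ln T ^ E)"
      using \<kappa>(1) elim(4) by (intro mult_right_mono) auto
    also have "\<dots> = (1 - \<alpha> - 2 * \<kappa>) * T * (((c - \<kappa>) * (1 - \<kappa>) ^ E - \<kappa>) * ln T ^ E)" by simp
    also have "\<dots> \<le> (1 - \<alpha> - 2 * \<kappa>) * T * (D - 1)"
      using D \<kappa>'(1) elim(4) by (intro mult_left_mono) auto
    also have "\<dots> \<le> integral {\<alpha> * T..T} (\<lambda>t. norm (zeta_prod as (Complex (1 / 2) t)) ^ 2)"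
      using elim(1) by (simp add: D_def)
    finally show ?case by (simp add: mult.assoc)
  qed
qed

lemma smallo_one_lower_bound:
  fixes I w :: "real \<Rightarrow> real"
  assumes w: "\<forall>\<^sub>F T in at_top. w T > 0"
    and lower: "\<And>e. e > 0 \<Longrightarrow> \<forall>\<^sub>F T in at_top. I T \<ge> (c - e) * w T"
  shows "\<exists>\<epsilon> \<in> o[at_top](\<lambda>_. 1). \<forall>\<^sub>F T in at_top. I T \<ge> (c + \<epsilon> T) * w T"
\<comment> \<open>The witness is I T / w T - c cut off at 0 from above: it is never positive, so the
  lower bounds for all e already force it to tend to 0.\<close>
proof (rule bexI[of _ "\<lambda>T. min 0 (I T / w T - c)"])
  show "\<forall>\<^sub>F T in at_top. I T \<ge> (c + min 0 (I T / w T - c)) * w T"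
    using w
  proof eventually_elim
    case (elim T)
    have "(c + min 0 (I T / w T - c)) * w T \<le> (I T / w T) * w T"
      using elim by (intro mult_right_mono) auto
    thus ?case using elim by simp
  qed
  have "((\<lambda>T. min 0 (I T / w T - c)) \<longlongrightarrow> 0) at_top"
  proof (rule order_tendstoI)
    fix a :: real assume a: "a < 0"
    have "- a / 2 > 0" using a by simp
    from lower[OF this] w show "\<forall>\<^sub>F T in at_top. a < min 0 (I T / w T - c)"
    proof eventually_elim
      case (elim T)
      have "c - (- a / 2) \<le> I T / w T" using elim by (simp add: pos_le_divide_eq)
      thus ?case using a by auto
    qed
  qed (auto intro!: always_eventually)
  thus "(\<lambda>T. min 0 (I T / w T - c)) \<in> o(\<lambda>_. 1)" by (intro smalloI_tendsto) auto
qed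

lemma concat_replicate_props:
  fixes k n :: "nat \<Rightarrow> nat" and j :: nat
  defines "a \<equiv> concat (map (\<lambda>\<mu>. replicate (k \<mu>) (n \<mu>)) [1..<Suc j])"
  shows "length a = (\<Sum>\<mu>=1..j. k \<mu>)" "sum_list a = (\<Sum>\<mu>=1..j. k \<mu> * n \<mu>)"
    "(\<Prod>r<length a. g (a ! r)) = (\<Prod>\<mu>=1..j. (g (n \<mu>) :: real) ^ k \<mu>)"
proof -
  have set: "{1..j} = set [1..<Suc j]" by auto
  have "length a = sum_list (map k [1..<Suc j])"
    by (simp add: a_def length_concat o_def del: upt_Suc)
  thus "length a = (\<Sum>\<mu>=1..j. k \<mu>)"
    unfolding set by (subst sum.distinct_set_conv_list) auto
  have "sum_list a = sum_list (map (\<lambda>\<mu>. k \<mu> * n \<mu>) [1..<Suc j])"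
  proof -
    have "sum_list (concat xss) = sum_list (map sum_list xss)" for xss :: "nat list list"
      by (induction xss) auto
    thus ?thesis by (simp add: a_def o_def sum_list_replicate del: upt_Suc)
  qed
  thus "sum_list a = (\<Sum>\<mu>=1..j. k \<mu> * n \<mu>)"
    unfolding set by (subst sum.distinct_set_conv_list) auto
  have "prod_list (map g (concat xss)) = prod_list (map (\<lambda>xs. prod_list (map g xs)) xss)" for xss
    by (induction xss) auto
  moreover have "prod_list (map g (replicate m x)) = g x ^ m" for m x
    by (induction m) auto
  ultimately have "prod_list (map g a) = prod_list (map (\<lambda>\<mu>. g (n \<mu>) ^ k \<mu>) [1..<Suc j])"
    by (simp add: a_def o_def del: upt_Suc map_replicate)
  moreover have "prod_list (map g a) = (\<Prod>r<length a. g (a ! r))"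
    by (simp add: prod.list_conv_set_nth atLeast0LessThan)
  ultimately show "(\<Prod>r<length a. g (a ! r)) = (\<Prod>\<mu>=1..j. g (n \<mu>) ^ k \<mu>)"
    unfolding set by (subst prod.distinct_set_conv_list) auto
qed

theorem theorem11:
  fixes j K N :: nat and k n :: "nat \<Rightarrow> nat" and a :: "nat list" and F :: "real \<Rightarrow> real"
  assumes "j \<ge> 1"
    and "\<And>\<mu>. \<mu> \<in> {1..j} \<Longrightarrow> k \<mu> \<ge> 1"
  defines "K \<equiv> (\<Sum>\<mu>=1..j. k \<mu>)"
    and "N \<equiv> (\<Sum>\<mu>=1..j. k \<mu> * n \<mu>)"
    and "a \<equiv> concat (map (\<lambda>\<mu>. replicate (k \<mu>) (n \<mu>)) [1..<Suc j])"
    and "F \<equiv> (\<lambda>t. \<Prod>\<mu>=1..j.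
               norm ((deriv ^^ n \<mu>) riemann_zeta (1 / 2 + \<i> * of_real t)) ^ (2 * k \<mu>))"
  shows "(\<exists>\<epsilon> \<in> o[at_top](\<lambda>_. 1). \<forall>\<^sub>F T in at_top.
           integral {T..2 * T} F \<ge> (moment_const a + \<epsilon> T) * T * ln T ^ (K\<^sup>2 + 2 * N)) \<and>
    (\<exists>\<epsilon> \<in> o[at_top](\<lambda>_. 1). \<forall>\<^sub>F T in at_top.
           integral {1..T} F \<ge> (moment_const a + \<epsilon> T) * T * ln T ^ (K\<^sup>2 + 2 * N))"
proof -
  define E where "E = K\<^sup>2 + 2 * N"
  define c where "c = moment_const a"
  have len: "length a = K" and sum: "sum_list a = N"
    using concat_replicate_props(1,2)[where k = k and n = n and j = j] by (simp_all add: a_def K_def N_def)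
  have "k 1 \<le> K" unfolding K_def using assms(1) by (intro member_le_sum) auto
  hence ne: "a \<noteq> []" using assms(1) assms(2)[of 1] len by auto
  \<comment> \<open>Taking norms removes the signs in \<open>zeta_prod\<close>, and the k \<mu>
    copies of n \<mu> in the list, once squared, account for the exponent 2 k \<mu>.\<close>
  have F: "F = (\<lambda>t. norm (zeta_prod a (Complex (1 / 2) t)) ^ 2)"
  proof
    fix t
    define z where "z = (\<lambda>m. norm ((deriv ^^ m) riemann_zeta (Complex (1 / 2) t)))"
    have "norm (zeta_prod a (Complex (1 / 2) t)) = (\<Prod>r<length a. z (a ! r))"
      by (simp add: zeta_prod_def z_def norm_mult norm_power flip: prod_norm)
    also have "\<dots> = (\<Prod>\<mu>=1..j. z (n \<mu>) ^ k \<mu>)"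
      unfolding a_def by (rule concat_replicate_props)
    finally show "F t = norm (zeta_prod a (Complex (1 / 2) t)) ^ 2"
      by (simp add: F_def z_def Complex_eq prod_power_distrib power_mult[symmetric] mult.commute)
  qed
  have cF: "continuous_on {x..y} F" if "x > 0" for x y
  proof -
    have "continuous_on {x..y} (\<lambda>t. Complex (1 / 2) t)" unfolding Complex_eq by (intro continuous_intros)
    hence "continuous_on {x..y} (\<lambda>t. zeta_prod a (Complex (1 / 2) t))"
      by (rule continuous_on_compose2[OF holomorphic_on_imp_continuous_on[OF zeta_prod_holomorphic]])
         (auto simp: complex_eq_iff)
    thus ?thesis unfolding F by (intro continuous_intros)
  qed
  have lower: "\<forall>\<^sub>F T in at_top. ((1 - \<alpha>) * c - e) * T * ln T ^ E \<le> integral {\<alpha> * T..T} F"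
    if "0 < \<alpha>" "\<alpha> < 1" "e > 0" for \<alpha> e
    using zeta_prod_mean_square_lower[OF ne that] by (simp only: F c_def E_def len sum)
  have w: "\<forall>\<^sub>F T :: real in at_top. T * ln T ^ E > 0"
    using eventually_gt_at_top[of 1] by eventually_elim auto
  have "\<exists>\<epsilon> \<in> o[at_top](\<lambda>_. 1). \<forall>\<^sub>F T in at_top. integral {T..2 * T} F \<ge> (c + \<epsilon> T) * (T * ln T ^ E)"
  proof (rule smallo_one_lower_bound[OF w])
    fix e :: real assume "e > 0"
    \<comment> \<open>This is to be used at 2T, where [T, 2T] is the upper half of [0, 2T]: the
      factors 1/2 and 2 cancel, and e/2 becomes e.\<close>
    hence "\<forall>\<^sub>F T in at_top. ((1 - 1 / 2) * c - e / 2) * T * ln T ^ E \<le> integral {1 / 2 * T..T} F"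
      by (intro lower) auto
    moreover have "filterlim (\<lambda>T::real. 2 * T) at_top at_top" by real_asymp
    ultimately have "\<forall>\<^sub>F T in at_top. ((1 - 1 / 2) * c - e / 2) * (2 * T) * ln (2 * T) ^ E \<le> integral {1 / 2 * (2 * T)..2 * T} F"
      by (rule eventually_compose_filterlim)
    thus "\<forall>\<^sub>F T in at_top. (c - e) * (T * ln T ^ E) \<le> integral {T..2 * T} F"
      using eventually_gt_at_top[of 1]
    proof eventually_elim
      case (elim T)
      show ?case
      \<comment> \<open>Replacing ln(2T) by ln T weakens the bound only if the constant is
        nonnegative; otherwise nonnegativity of the integral suffices.\<close>
      proof (cases "c - e \<ge> 0")
        case True
        have "ln T ^ E \<le> ln (2 * T) ^ E" using elim(2) by (intro power_mono) auto
        hence "(c - e) * (T * ln T ^ E) \<le> (c - e) * (T * ln (2 * T) ^ E)"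
          using True elim(2) by (intro mult_left_mono) auto
        also have "\<dots> = ((1 - 1 / 2) * c - e / 2) * (2 * T) * ln (2 * T) ^ E" by (simp add: algebra_simps)
        finally show ?thesis using elim(1) by simp
      next
        case False
        hence "(c - e) * (T * ln T ^ E) \<le> 0" using elim(2) by (intro mult_nonpos_nonneg) auto
        also have "0 \<le> integral {T..2 * T} F"
          using elim(2) by (intro integral_nonneg integrable_continuous_interval cF) (auto simp: F)
        finally show ?thesis .
      qed
    qed
  qed
  moreover have "\<exists>\<epsilon> \<in> o[at_top](\<lambda>_. 1). \<forall>\<^sub>F T in at_top. integral {1..T} F \<ge> (c + \<epsilon> T) * (T * ln T ^ E)"
  proof (rule smallo_one_lower_bound[OF w])
    fix e :: real assume e: "e > 0"
    \<comment> \<open>Chosen so that the loss \<alpha> c from giving up [1, \<alpha> T] is at most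
      e/2; adding 1 to |c| keeps the denominator positive.\<close>
    define \<alpha> where "\<alpha> = min (1 / 2) (e / (2 * (\<bar>c\<bar> + 1)))"
    have \<alpha>: "0 < \<alpha>" "\<alpha> < 1" using e by (auto simp: \<alpha>_def)
    have "\<alpha> * c \<le> \<alpha> * (\<bar>c\<bar> + 1)" using \<alpha> by (intro mult_left_mono) auto
    also have "\<dots> \<le> e / (2 * (\<bar>c\<bar> + 1)) * (\<bar>c\<bar> + 1)" by (intro mult_right_mono) (auto simp: \<alpha>_def)
    also have "\<dots> = e / 2" by (simp add: field_simps)
    finally have \<alpha>c: "\<alpha> * c \<le> e / 2" .
    have "\<forall>\<^sub>F T in at_top. ((1 - \<alpha>) * c - e / 2) * T * ln T ^ E \<le> integral {\<alpha> * T..T} F"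
      using \<alpha> e by (intro lower) auto
    moreover have "\<forall>\<^sub>F T in at_top. \<alpha> * T \<ge> 1" using \<alpha> by real_asymp
    ultimately show "\<forall>\<^sub>F T in at_top. (c - e) * (T * ln T ^ E) \<le> integral {1..T} F"
      using eventually_gt_at_top[of 1]
    proof eventually_elim
      case (elim T)
      have "(c - e) * (T * ln T ^ E) \<le> ((1 - \<alpha>) * c - e / 2) * (T * ln T ^ E)"
        using \<alpha>c elim(3) by (intro mult_right_mono) (auto simp: algebra_simps)
      also have "\<dots> \<le> integral {\<alpha> * T..T} F" using elim(1) by (simp only: mult.assoc)
      also have "\<dots> \<le> integral {1..T} F"
        using elim(2) by (intro integral_subset_le integrable_continuous_interval cF) (auto simp: F)
      finally show ?case .
    qed
  qed
  ultimately show ?thesis by (simp only: c_def E_def mult.assoc)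
qed

end
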